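(* For any set of generalized fixed data and any reciprocal generalized torus seed, the Fock–Goncharov cluster chambers in $\mathcal{A}^\vee(\mathbb{R}^T)$ are the maximal cones of a simplicial fan.
   Context: Generalized fixed data: a lattice $N$ with skew-symmetric form $\{\cdot,\cdot\}:N\times N\to\mathbb{Q}$, saturated sublattice $N_{\mathrm{uf}}$, index sets $I_{\mathrm{uf}}\subseteq I$, positive integers $d_i$ with $\gcd 1$, a finite-index sublattice $N^\circ\subseteq N$ with $\{N_{\mathrm{uf}},N^\circ\}\subseteq\mathbb{Z}$, $\{N,N_{\mathrm{uf}}\cap N^\circ\}\subseteq\mathbb{Z}$, $M=\operatorname{Hom}(N,\mathbb{Z})$, $M^\circ=\operatorname{Hom}(N^\circ,\mathbb{Z})$, positive integers $r_i$, and formal variables $a_{i,j}$ ($i\in I_{\mathrm{uf}}$, $1\le j\le r_i-1$). A generalized torus seed $\mathbf s$ is a basis $\{e_i\}$ of $N$ (with $\{e_i\}_{i\in I_{\mathrm{uf}}}$ a basis of $N_{\mathrm{uf}}$ and $\{d_ie_i\}$ a basis of $N^\circ$) together with tuples $(a_{i,j})_j$, reciprocal meaning $a_{i,j}=a_{i,r_i-j}$. Let $\epsilon_{ij}=\{e_i,e_j\}d_j$, $v_i=\{e_i,\cdot\}|_{N^\circ}\in M^\circ$. Mutation in direction $k\in I_{\mathrm{uf}}$: $e_k'=-e_k$, $e_i'=e_i+r_k[\epsilon_{ik}]_+e_k$ ($i\ne k$), $a'_{k,s}=a_{k,r_k-s}$. The tropicalized mutation is the piecewise linear map $T_k:M^\circ_\mathbb{R}\to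 M^\circ_\mathbb{R}$, $T_k(m)=m+r_kv_k\langle d_ke_k,m\rangle$ if $\langle e_k,m\rangle\ge0$ and $T_k(m)=m$ otherwise. The space $\mathcal{A}^\vee(\mathbb{R}^T)$ (real tropical points of the Fock–Goncharov dual) is obtained by taking one copy $M^\circ_{\mathbb{R},\mathbf s'}$ of $M^\circ_\mathbb{R}$ for each seed $\mathbf s'$ mutation equivalent to $\mathbf s$ and identifying $M^\circ_{\mathbb{R},\mathbf s'}$ with $M^\circ_{\mathbb{R},\mu_k(\mathbf s')}$ via $T_k$ (defined using $\mathbf s'$); so each seed gives an identification of $\mathcal{A}^\vee(\mathbb{R}^T)$ with $M^\circ_\mathbb{R}$. The Fock–Goncharov cluster chamber associated to a seed $\mathbf s'=\{e_i'\}$ is the set of points of $\mathcal{A}^\vee(\mathbb{R}^T)$ whose coordinates $x\in M^\circ_{\mathbb{R},\mathbf s'}$ satisfy $\langle e_i',x\rangle\ge0$ for all $i\in I_{\mathrm{uf}}$ (equivalently, via the canonical sign-change identification, the tropicalizations of $z^{e_i'}$ are $\le0$). *)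

theory Defs
  imports "HOL-Analysis.Analysis" "HOL-Computational_Algebra.Group_Closure"
begin

text \<open>
  The lattice \<open>N\<close> is realised as a full-rank lattice in the real vector space \<open>'v = N \<otimes> \<real>\<close>.
  As \<open>N\<^sup>\<circ>\<close> has finite index in \<open>N\<close>, also \<open>N\<^sup>\<circ> \<otimes> \<real> = 'v\<close>, so that the space
  \<open>M\<^sup>\<circ>\<^sub>\<real> = Hom(N\<^sup>\<circ>, \<int>) \<otimes> \<real>\<close> is the dual space \<open>'v \<Rightarrow>\<^sub>L real\<close>, with the evaluation pairing.
  The form on \<open>N\<close> is given by its unique \<open>\<real>\<close>-bilinear extension to \<open>'v\<close>.
  The index set \<open>I\<close> is the type \<open>'i\<close>, and \<open>'c\<close> is the type of formal variables.
\<close>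

definition lattice_basis_on :: "'i set \<Rightarrow> ('i \<Rightarrow> 'v::real_vector) \<Rightarrow> 'v set \<Rightarrow> bool" where
  "lattice_basis_on J e L \<longleftrightarrow>
     inj_on e J \<and> independent (e ` J) \<and> group_closure (e ` J) = L"

definition full_lattice :: "'v::real_vector set \<Rightarrow> bool" where
  "full_lattice L \<longleftrightarrow> (\<exists>B. independent B \<and> span B = UNIV \<and> group_closure B = L)"

definition sublattice :: "'v::real_vector set \<Rightarrow> 'v set \<Rightarrow> bool" where
  "sublattice K L \<longleftrightarrow> K \<subseteq> L \<and> 0 \<in> K \<and> (\<forall>x\<in>K. \<forall>y\<in>K. x - y \<in> K)"

definition saturated_in :: "'v::real_vector set \<Rightarrow> 'v set \<Rightarrow> bool" where
  "saturated_in K L \<longleftrightarrow>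
     (\<forall>n\<in>L. \<forall>z::int. z \<noteq> 0 \<and> of_int z *\<^sub>R n \<in> K \<longrightarrow> n \<in> K)"

definition finite_index_in :: "'v::real_vector set \<Rightarrow> 'v set \<Rightarrow> bool" where
  "finite_index_in K L \<longleftrightarrow> finite ((\<lambda>n. (+) n ` K) ` L)"

record ('v, 'i, 'c) fixed_data =
  lat :: "'v set"
  form :: "'v \<Rightarrow> 'v \<Rightarrow> real"
  lat_uf :: "'v set"
  idx_uf :: "'i set"
  mult :: "'i \<Rightarrow> nat"
  lat_circ :: "'v set"
  rdeg :: "'i \<Rightarrow> nat"
  fvar :: "'i \<Rightarrow> nat \<Rightarrow> 'c"

definition generalized_fixed_data ::
    "('v::euclidean_space, 'i::finite, 'c) fixed_data \<Rightarrow> bool" where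
  "generalized_fixed_data \<Gamma> \<longleftrightarrow>
     full_lattice (lat \<Gamma>) \<and>
     bilinear (form \<Gamma>) \<and>
     (\<forall>x\<in>lat \<Gamma>. \<forall>y\<in>lat \<Gamma>. form \<Gamma> x y \<in> \<rat> \<and> form \<Gamma> x y = - form \<Gamma> y x) \<and>
     sublattice (lat_uf \<Gamma>) (lat \<Gamma>) \<and> saturated_in (lat_uf \<Gamma>) (lat \<Gamma>) \<and>
     (\<forall>i. mult \<Gamma> i > 0) \<and> Gcd (range (mult \<Gamma>)) = 1 \<and>
     sublattice (lat_circ \<Gamma>) (lat \<Gamma>) \<and> finite_index_in (lat_circ \<Gamma>) (lat \<Gamma>) \<and>
     (\<forall>x\<in>lat_uf \<Gamma>. \<forall>y\<in>lat_circ \<Gamma>. form \<Gamma> x y \<in> \<int>) \<and>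
     (\<forall>x\<in>lat \<Gamma>. \<forall>y\<in>lat_uf \<Gamma> \<inter> lat_circ \<Gamma>. form \<Gamma> x y \<in> \<int>) \<and>
     (\<forall>i\<in>idx_uf \<Gamma>. rdeg \<Gamma> i > 0)"

record ('v, 'i, 'c) seed =
  vec :: "'i \<Rightarrow> 'v"
  coef :: "'i \<Rightarrow> nat \<Rightarrow> 'c"

text \<open>
  Only the values \<open>coef s i j\<close> with \<open>i \<in> I_uf\<close> and \<open>1 \<le> j \<le> r_i - 1\<close> are meaningful.
  They are taken from the formal variables with the same index \<open>i\<close>, in any arrangement,
  because mutation rearranges them.
\<close>

definition torus_seed ::
    "('v::euclidean_space, 'i::finite, 'c) fixed_data \<Rightarrow> ('v, 'i, 'c) seed \<Rightarrow> bool" where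
  "torus_seed \<Gamma> s \<longleftrightarrow>
     lattice_basis_on UNIV (vec s) (lat \<Gamma>) \<and>
     lattice_basis_on (idx_uf \<Gamma>) (vec s) (lat_uf \<Gamma>) \<and>
     lattice_basis_on UNIV (\<lambda>i. real (mult \<Gamma> i) *\<^sub>R vec s i) (lat_circ \<Gamma>) \<and>
     (\<forall>i\<in>idx_uf \<Gamma>. \<forall>j\<in>{1..<rdeg \<Gamma> i}. coef s i j \<in> fvar \<Gamma> i ` {1..<rdeg \<Gamma> i})"

definition reciprocal_seed ::
    "('v, 'i, 'c) fixed_data \<Rightarrow> ('v, 'i, 'c) seed \<Rightarrow> bool" where
  "reciprocal_seed \<Gamma> s \<longleftrightarrow>
     (\<forall>i\<in>idx_uf \<Gamma>. \<forall>j\<in>{1..<rdeg \<Gamma> i}. coef s i j = coef s i (rdeg \<Gamma> i - j))"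

definition exch :: "('v, 'i, 'c) fixed_data \<Rightarrow> ('v, 'i, 'c) seed \<Rightarrow> 'i \<Rightarrow> 'i \<Rightarrow> real" where
  "exch \<Gamma> s i j = form \<Gamma> (vec s i) (vec s j) * real (mult \<Gamma> j)"

definition vdual ::
    "('v::euclidean_space, 'i, 'c) fixed_data \<Rightarrow> ('v, 'i, 'c) seed \<Rightarrow> 'i \<Rightarrow> 'v \<Rightarrow>\<^sub>L real" where
  "vdual \<Gamma> s i = Blinfun (form \<Gamma> (vec s i))"

definition mutate ::
    "('v::euclidean_space, 'i, 'c) fixed_data \<Rightarrow> 'i \<Rightarrow> ('v, 'i, 'c) seed \<Rightarrow> ('v, 'i, 'c) seed" where
  "mutate \<Gamma> k s =
     \<lparr>vec = (\<lambda>i. if i = k then - vec s k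
                 else vec s i + (real (rdeg \<Gamma> k) * max 0 (exch \<Gamma> s i k)) *\<^sub>R vec s k),
      coef = (\<lambda>i j. if i = k \<and> j \<in> {1..<rdeg \<Gamma> k} then coef s k (rdeg \<Gamma> k - j)
                    else coef s i j)\<rparr>"

definition trop_mutation ::
    "('v::euclidean_space, 'i, 'c) fixed_data \<Rightarrow> ('v, 'i, 'c) seed \<Rightarrow> 'i \<Rightarrow>
      ('v \<Rightarrow>\<^sub>L real) \<Rightarrow> ('v \<Rightarrow>\<^sub>L real)" where
  "trop_mutation \<Gamma> s k m =
     (if blinfun_apply m (vec s k) \<ge> 0
      then m + (real (rdeg \<Gamma> k) * blinfun_apply m (real (mult \<Gamma> k) *\<^sub>R vec s k)) *\<^sub>R vdual \<Gamma> s k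
      else m)"

text \<open>
  The seeds mutation equivalent to \<open>s\<close> are indexed by the vertices of the rooted tree of mutation
  sequences, that is, by words over \<open>I_uf\<close>. This is essential: different sequences can lead to
  the same basis with different composite tropical maps (for example, in type \<open>A\<^sub>2\<close> six alternating
  mutations restore the basis, but the composite tropical map is not the identity), so copies
  indexed by the bases alone would not glue consistently.
\<close>

definition seed_at ::
    "('v::euclidean_space, 'i, 'c) fixed_data \<Rightarrow> ('v, 'i, 'c) seed \<Rightarrow> 'i list \<Rightarrow> ('v, 'i, 'c) seed" where
  "seed_at \<Gamma> s w = fold (mutate \<Gamma>) w s"

inductive glue ::
    "('v::euclidean_space, 'i, 'c) fixed_data \<Rightarrow> ('v, 'i, 'c) seed \<Rightarrow>
      'i list \<times> ('v \<Rightarrow>\<^sub>L real) \<Rightarrow> 'i list \<times> ('v \<Rightarrow>\<^sub>L real) \<Rightarrow> bool"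
  for \<Gamma> s where
  "w \<in> lists (idx_uf \<Gamma>) \<Longrightarrow> k \<in> idx_uf \<Gamma> \<Longrightarrow>
     glue \<Gamma> s (w, m) (w @ [k], trop_mutation \<Gamma> (seed_at \<Gamma> s w) k m)"

definition trop_point ::
    "('v::euclidean_space, 'i, 'c) fixed_data \<Rightarrow> ('v, 'i, 'c) seed \<Rightarrow> 'i list \<Rightarrow>
      ('v \<Rightarrow>\<^sub>L real) \<Rightarrow> ('i list \<times> ('v \<Rightarrow>\<^sub>L real)) set" where
  "trop_point \<Gamma> s w m = {p. equivclp (glue \<Gamma> s) (w, m) p}"

definition trop_space ::
    "('v::euclidean_space, 'i, 'c) fixed_data \<Rightarrow> ('v, 'i, 'c) seed \<Rightarrow>
      ('i list \<times> ('v \<Rightarrow>\<^sub>L real)) set set" where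
  "trop_space \<Gamma> s =
     (lists (idx_uf \<Gamma>) \<times> UNIV) // {(p, q). equivclp (glue \<Gamma> s) p q}"

definition fg_chamber ::
    "('v::euclidean_space, 'i, 'c) fixed_data \<Rightarrow> ('v, 'i, 'c) seed \<Rightarrow> 'i list \<Rightarrow>
      ('i list \<times> ('v \<Rightarrow>\<^sub>L real)) set set" where
  "fg_chamber \<Gamma> s w =
     trop_point \<Gamma> s w ` {x. \<forall>i\<in>idx_uf \<Gamma>. blinfun_apply x (vec (seed_at \<Gamma> s w) i) \<ge> 0}"

text \<open>
  Cones are not required to be strictly convex: every chamber contains the linear space
  orthogonal to \<open>N_uf\<close>, which is nonzero if there are frozen indices. Accordingly, a cone is
  simplicial if it is generated by a linear subspace \<open>L\<close> together with finitely many vectors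
  that are linearly independent modulo \<open>L\<close>.
\<close>

definition simplicial_cone :: "'a::real_vector set \<Rightarrow> bool" where
  "simplicial_cone C \<longleftrightarrow>
     (\<exists>L B. subspace L \<and> finite B \<and>
        (\<forall>c. (\<Sum>b\<in>B. c b *\<^sub>R b) \<in> L \<longrightarrow> (\<forall>b\<in>B. c b = 0)) \<and>
        C = {l + (\<Sum>b\<in>B. c b *\<^sub>R b) | l c. l \<in> L \<and> (\<forall>b\<in>B. c b \<ge> 0)})"

definition simplicial_fan :: "'a::real_vector set set \<Rightarrow> bool" where
  "simplicial_fan F \<longleftrightarrow>
     (\<forall>C\<in>F. simplicial_cone C) \<and>
     (\<forall>C\<in>F. \<forall>G. G face_of C \<and> G \<noteq> {} \<longrightarrow> G \<in> F) \<and>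
     (\<forall>C\<in>F. \<forall>D\<in>F. (C \<inter> D) face_of C \<and> (C \<inter> D) face_of D)"

text \<open>
  The tropical space carries only a piecewise linear structure. A collection of its subsets is
  a simplicial fan if it becomes one under the identification with \<open>M\<^sup>\<circ>\<^sub>\<real>\<close> given by each seed.
\<close>

definition trop_simplicial_fan ::
    "('v::euclidean_space, 'i, 'c) fixed_data \<Rightarrow> ('v, 'i, 'c) seed \<Rightarrow>
      ('i list \<times> ('v \<Rightarrow>\<^sub>L real)) set set set \<Rightarrow> bool" where
  "trop_simplicial_fan \<Gamma> s F \<longleftrightarrow>
     F \<subseteq> Pow (trop_space \<Gamma> s) \<and>
     (\<forall>w\<in>lists (idx_uf \<Gamma>). simplicial_fan ((\<lambda>C. trop_point \<Gamma> s w -` C) ` F))"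

definition maximal_cones :: "'a set set \<Rightarrow> 'a set set" where
  "maximal_cones F = {C \<in> F. \<forall>D\<in>F. C \<subseteq> D \<longrightarrow> D = C}"

end

theory Submission
  imports Defs
begin

text \<open>
  The fan property reduces to sign coherence: there is, for every seed, a set of functionals that
  misses the open chamber of the seed, contains all hyperplanes orthogonal to its mutable basis
  vectors, and is carried to the set of the adjacent seed by the tropical mutation. Given such
  sets, every chamber lies on one side of every coordinate hyperplane of every chart. Hence the
  transition maps are linear on chambers, and two chambers meet in a common face.

  The sets are supports of consistent scattering diagrams. In the completed quantum torus with
  product \<open>x\<^sup>m x\<^sup>n = exp (\<omega> m n) x\<^sup>m\<^sup>+\<^sup>n\<close>, where \<open>\<omega>\<close> is the form, a series with constant term 1
  supported on the positive cone of a seed factors uniquely into parts of positive, zero and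
  negative degree with respect to a functional \<open>\<theta>\<close>, and \<open>\<theta>\<close> belongs to the set if the middle
  factor is nontrivial. The series \<open>g\<close> of a seed is chosen so that it is the quantum dilogarithm
  along every basis vector and has no other incoming walls: for all other \<open>n\<close>, the logarithm of
  the middle factor for \<open>\<theta> = \<omega> n\<close> has no term of degree \<open>n\<close>. Writing \<open>g = h E = E h'\<close> with the
  dilogarithm \<open>E\<close> of \<open>e\<^sub>k\<close>, the absence of incoming walls confines \<open>h\<close> to the degrees common to
  the cones of the seed and of its mutation, and \<open>E' h\<close>, with \<open>E'\<close> the dilogarithm of \<open>- e\<^sub>k\<close>, is
  the series of the mutated seed. Replacing \<open>d\<^sub>i\<close> by \<open>r\<^sub>i d\<^sub>i\<close> turns the generalized mutations into
  ordinary ones.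
\<close>

section \<open>Series over a quantum torus\<close>

text \<open>The dilogarithms of \<open>e\<^sub>k\<close> and \<open>- e\<^sub>k\<close> have no
  common completion: along every line in direction \<open>e\<^sub>k\<close> one runs upwards and the
  other downwards. The passage between them rests on a finite product. Monomials satisfy
  \<open>x^n x^e = exp (2 * \<omega> n e) x^e x^n\<close>, so a dilogarithm with parameter
  \<open>exp (2 / D\<^sub>i)\<close>, where \<open>D\<^sub>i = r\<^sub>i d\<^sub>i\<close>, sees
  commutation factors that are integral powers of its parameter. The quotient of two dilogarithms
  rescaled by such powers is a polynomial or the inverse of one, and for series of finite support on
  the line a relation given by a palindromic polynomial can be read in both directions. One bound on
  the support comes from the cone of the seed; the absence of incoming walls supplies the other one.

  The quantum parameter is a fixed real number, and the dilogarithm parameters are greater than 1,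
  so no denominator vanishes and all coefficients are real. The form may be degenerate: the series
  keep the degrees themselves and not only the functionals \<open>\<omega> n\<close>, and walls are
  tested with arbitrary \<open>\<theta>\<close>.\<close>

locale skew_form =
  fixes \<omega> :: "'v::real_vector \<Rightarrow> 'v \<Rightarrow> real"
  assumes bil: "bilinear \<omega>" and skew: "\<omega> x y = - \<omega> y x"
begin

lemma form_simps [simp]:
  "\<omega> (x + y) z = \<omega> x z + \<omega> y z" "\<omega> z (x + y) = \<omega> z x + \<omega> z y"
  "\<omega> (x - y) z = \<omega> x z - \<omega> y z" "\<omega> z (x - y) = \<omega> z x - \<omega> z y"
  "\<omega> (- x) z = - \<omega> x z" "\<omega> z (- x) = - \<omega> z x"
  "\<omega> (c *\<^sub>R x) z = c * \<omega> x z" "\<omega> z (c *\<^sub>R x) = c * \<omega> z x"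
  "\<omega> 0 z = 0" "\<omega> z 0 = 0"
  using bilinear_ladd[OF bil] bilinear_radd[OF bil] bilinear_lsub[OF bil] bilinear_rsub[OF bil]
    bilinear_lneg[OF bil] bilinear_rneg[OF bil] bilinear_lmul[OF bil] bilinear_rmul[OF bil]
    bilinear_lzero[OF bil] bilinear_rzero[OF bil] by auto

lemma form_self [simp]: "\<omega> x x = 0"
  using skew[of x x] by simp

text \<open>
  The factor \<open>exp (\<omega> m n)\<close> equals \<open>exp (\<omega> m (n - m))\<close>. The sum is meaningful only if its index set is
  finite, which holds for series supported on a common graded monoid.
\<close>

definition conv :: "('v \<Rightarrow> real) \<Rightarrow> ('v \<Rightarrow> real) \<Rightarrow> 'v \<Rightarrow> real" (infixl "\<star>" 70) where
  "(f \<star> g) n = (\<Sum>m | f m \<noteq> 0 \<and> g (n - m) \<noteq> 0. exp (\<omega> m n) * f m * g (n - m))"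

definition one :: "'v \<Rightarrow> real" where
  "one n = (if n = 0 then 1 else 0)"

end

text \<open>Finiteness of the decompositions makes every coefficient of a product a finite sum. As
  \<open>ht\<close> is constrained on \<open>P\<close> only, the same height serves all submonoids
  of \<open>P\<close>.\<close>

definition graded :: "'v::real_vector set \<Rightarrow> ('v \<Rightarrow> nat) \<Rightarrow> bool" where
  "graded P ht \<longleftrightarrow> 0 \<in> P \<and> (\<forall>m\<in>P. \<forall>n\<in>P. m + n \<in> P \<and> ht (m + n) = ht m + ht n) \<and>
     (\<forall>n\<in>P. ht n = 0 \<longrightarrow> n = 0) \<and> (\<forall>n. finite {m\<in>P. n - m \<in> P})"

definition ser :: "'v::real_vector set \<Rightarrow> ('v \<Rightarrow> real) set" where
  "ser P = {f. \<forall>n. n \<notin> P \<longrightarrow> f n = 0}"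

definition unip :: "'v::real_vector set \<Rightarrow> ('v \<Rightarrow> real) set" where
  "unip P = {f \<in> ser P. f 0 = 1}"

lemma unip_mono: "P \<subseteq> P' \<Longrightarrow> f \<in> unip P \<Longrightarrow> f \<in> unip P'"
  by (auto simp: unip_def ser_def)

lemma unip_ser: "f \<in> unip P \<Longrightarrow> f \<in> ser P"
  by (simp add: unip_def)

lemma unip_0: "f \<in> unip P \<Longrightarrow> f 0 = 1"
  by (simp add: unip_def)

lemma ser_out: "f \<in> ser P \<Longrightarrow> n \<notin> P \<Longrightarrow> f n = 0"
  by (simp add: ser_def)

lemma unip_out: "f \<in> unip P \<Longrightarrow> n \<notin> P \<Longrightarrow> f n = 0"
  by (simp add: unip_def ser_def)

lemma gradedD:
  assumes "graded P ht"
  shows "0 \<in> P" "ht 0 = 0" "m \<in> P \<Longrightarrow> n \<in> P \<Longrightarrow> m + n \<in> P"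
    "m \<in> P \<Longrightarrow> n \<in> P \<Longrightarrow> ht (m + n) = ht m + ht n"
    "n \<in> P \<Longrightarrow> ht n = 0 \<Longrightarrow> n = 0" "finite {m\<in>P. n - m \<in> P}"
proof -
  show "0 \<in> P" using assms by (simp add: graded_def)
  then have "ht (0 + 0) = ht 0 + ht 0" using assms unfolding graded_def by blast
  then show "ht 0 = 0" by simp
qed (use assms in \<open>auto simp: graded_def\<close>)

lemma graded_subset:
  assumes "graded P ht" "P' \<subseteq> P" "0 \<in> P'" "\<And>m n. m \<in> P' \<Longrightarrow> n \<in> P' \<Longrightarrow> m + n \<in> P'"
  shows "graded P' ht"
proof -
  have "finite {m\<in>P'. n - m \<in> P'}" for n
    by (rule finite_subset[OF _ gradedD(6)[OF assms(1), of n]]) (use assms(2) in auto)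
  moreover have "ht (m + n) = ht m + ht n" if "m \<in> P'" "n \<in> P'" for m n
    using gradedD(4)[OF assms(1)] that assms(2) by blast
  moreover have "n = 0" if "n \<in> P'" "ht n = 0" for n
    using gradedD(5)[OF assms(1)] that assms(2) by blast
  ultimately show ?thesis using assms(3,4) unfolding graded_def by simp
qed

lemma graded_lower:
  assumes "graded P ht" "m \<in> P" "n - m \<in> P"
  shows "n \<in> P" "ht n = ht m + ht (n - m)"
  using gradedD(3,4)[OF assms] by auto

lemma graded_strict:
  assumes "graded P ht" "m \<in> P" "n - m \<in> P" "m \<noteq> 0" "m \<noteq> n"
  shows "ht m < ht n" "ht (n - m) < ht n"
proof -
  have "ht m \<noteq> 0" "ht (n - m) \<noteq> 0"
    using gradedD(5)[OF assms(1)] assms by force+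
  then show "ht m < ht n" "ht (n - m) < ht n"
    using graded_lower(2)[OF assms(1-3)] by auto
qed

text \<open>Iteration from the zero function stabilises at \<open>n\<close> after
  \<open>ht n + 1\<close> steps. Recursive constructions of series are written so that the unknown
  top coefficient cancels, which gives the assumption.\<close>

lemma graded_fixpoint:
  fixes \<Phi> :: "('a \<Rightarrow> real) \<Rightarrow> 'a \<Rightarrow> real" and ht :: "'a \<Rightarrow> nat"
  assumes "\<And>f f' n. (\<And>m. ht m < ht n \<Longrightarrow> f m = f' m) \<Longrightarrow> \<Phi> f n = \<Phi> f' n"
  shows "\<exists>f. \<Phi> f = f"
proof -
  define F where "F j = (\<Phi> ^^ j) (\<lambda>_. 0)" for j
  have FS: "F (Suc j) = \<Phi> (F j)" for j by (simp add: F_def)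
  have stab: "F (Suc j) n = F j n" if "ht n < j" for j n
    using that
  proof (induction j arbitrary: n)
    case (Suc j)
    show ?case
      by (subst (2) FS, subst FS, rule assms) (use Suc in auto)
  qed simp
  have stab': "F j n = F (Suc (ht n)) n" if "ht n < j" for j n
    using that
  proof (induction j)
    case (Suc j)
    then show ?case using stab[of n j] by (cases "ht n = j") auto
  qed simp
  define f where "f n = F (Suc (ht n)) n" for n
  have "\<Phi> f n = f n" for n
  proof -
    have "f n = \<Phi> (F (ht n)) n" by (simp add: f_def FS)
    also have "\<dots> = \<Phi> f n"
      by (rule assms) (auto simp: f_def intro: stab')
    finally show ?thesis by simp
  qed
  then show ?thesis by blast
qed

context skew_form
begin

lemma conv_eq:
  assumes "graded P ht" "f \<in> ser P" "g \<in> ser P"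
  shows "(f \<star> g) n = (\<Sum>m\<in>{m\<in>P. n - m \<in> P}. exp (\<omega> m n) * f m * g (n - m))"
  unfolding conv_def
  by (rule sum.mono_neutral_left[OF gradedD(6)[OF assms(1)]])
     (use assms(2,3) in \<open>auto simp: ser_def\<close>)

lemma conv_ser:
  assumes "graded P ht" "f \<in> ser P" "g \<in> ser P"
  shows "f \<star> g \<in> ser P"
proof -
  have "(f \<star> g) n = 0" if "n \<notin> P" for n
  proof -
    have "{m\<in>P. n - m \<in> P} = {}"
      using graded_lower(1)[OF assms(1)] that by blast
    then show ?thesis unfolding conv_eq[OF assms] by (simp only: sum.empty)
  qed
  then show ?thesis by (simp add: ser_def)
qed

lemma one_unip: "0 \<in> P \<Longrightarrow> one \<in> unip P"
  by (auto simp: unip_def ser_def one_def)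

lemma conv_at_0:
  assumes "graded P ht" "f \<in> ser P" "g \<in> ser P"
  shows "(f \<star> g) 0 = f 0 * g 0"
proof -
  have "m = 0" if "m \<in> P" "0 - m \<in> P" for m
    using graded_lower(2)[OF assms(1) that] gradedD(2,5)[OF assms(1)] that(1) by force
  then have "{m\<in>P. 0 - m \<in> P} = {0}"
    using gradedD(1)[OF assms(1)] by auto
  then show ?thesis unfolding conv_eq[OF assms] by simp
qed

lemma conv_unip:
  assumes "graded P ht" "f \<in> unip P" "g \<in> unip P"
  shows "f \<star> g \<in> unip P"
  using conv_ser[OF assms(1)] conv_at_0[OF assms(1)] assms(2,3) by (auto simp: unip_def)

lemma conv_add:
  assumes "graded P ht" "f \<in> ser P" "f' \<in> ser P" "g \<in> ser P"
  shows "(\<lambda>n. f n + f' n) \<star> g = (\<lambda>n. (f \<star> g) n + (f' \<star> g) n)"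
    "g \<star> (\<lambda>n. f n + f' n) = (\<lambda>n. (g \<star> f) n + (g \<star> f') n)"
proof -
  have "(\<lambda>n. f n + f' n) \<in> ser P" using assms by (auto simp: ser_def)
  then show "(\<lambda>n. f n + f' n) \<star> g = (\<lambda>n. (f \<star> g) n + (f' \<star> g) n)"
    "g \<star> (\<lambda>n. f n + f' n) = (\<lambda>n. (g \<star> f) n + (g \<star> f') n)"
    by (auto simp: conv_eq[OF assms(1)] assms sum.distrib[symmetric] algebra_simps intro!: sum.cong)
qed

lemma conv_one_left [simp]: "one \<star> f = f"
proof
  fix n
  have "{m. one m \<noteq> 0 \<and> f (n - m) \<noteq> 0} = (if f n = 0 then {} else {0})"
    by (auto simp: one_def)
  then show "(one \<star> f) n = f n"
    by (simp add: conv_def one_def)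
qed

lemma conv_one_right [simp]: "f \<star> one = f"
proof
  fix n
  have "{m. f m \<noteq> 0 \<and> one (n - m) \<noteq> 0} = (if f n = 0 then {} else {n})"
    by (auto simp: one_def)
  then show "(f \<star> one) n = f n"
    by (simp add: conv_def one_def)
qed

text \<open>Both sides sum over decompositions of \<open>n\<close> into three degrees of
  \<open>P\<close>. The exponents agree because the discrepancy is
  \<open>\<omega> m l + \<omega> l m\<close>.\<close>

lemma conv_assoc:
  assumes "graded P ht" "f \<in> ser P" "g \<in> ser P" "h \<in> ser P"
  shows "f \<star> g \<star> h = f \<star> (g \<star> h)"
proof
  fix n
  note fin = gradedD(6)[OF assms(1)]
  note cl = gradedD(3)[OF assms(1)]
  have "(f \<star> g \<star> h) n = (\<Sum>m\<in>{m\<in>P. n - m \<in> P}. \<Sum>l\<in>{l\<in>P. m - l \<in> P}.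
      exp (\<omega> m n) * (exp (\<omega> l m) * f l * g (m - l)) * h (n - m))"
    by (simp add: conv_eq[OF assms(1)] conv_ser[OF assms(1)] assms sum_distrib_left sum_distrib_right)
  also have "\<dots> = (\<Sum>(m,l)\<in>Sigma {m\<in>P. n - m \<in> P} (\<lambda>m. {l\<in>P. m - l \<in> P}).
      exp (\<omega> m n) * (exp (\<omega> l m) * f l * g (m - l)) * h (n - m))"
    by (rule sum.Sigma) (auto simp: fin)
  also have "\<dots> = (\<Sum>(l,k)\<in>Sigma {l\<in>P. n - l \<in> P} (\<lambda>l. {k\<in>P. n - l - k \<in> P}).
      exp (\<omega> l n) * f l * (exp (\<omega> k (n - l)) * g k * h (n - l - k)))"
  proof (rule sum.reindex_bij_witness[where i = "\<lambda>(l,k). (l + k, l)" and j = "\<lambda>(m,l). (l, m - l)"], goal_cases)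
    case (2 a)
    then obtain m l where a: "a = (m,l)" "m \<in> P" "n - m \<in> P" "l \<in> P" "m - l \<in> P" by auto
    have "n - l = (n - m) + (m - l)" by simp
    then have "n - l \<in> P" using cl a by metis
    then show ?case using a by auto
  next
    case (4 b)
    then obtain l k where a: "b = (l,k)" "l \<in> P" "n - l \<in> P" "k \<in> P" "n - l - k \<in> P" by auto
    then show ?case using cl by (auto simp: algebra_simps)
  next
    case (5 a)
    then obtain m l where a: "a = (m,l)" by (cases a)
    have "\<omega> m n + \<omega> l m = \<omega> l n + \<omega> (m - l) (n - l)"
      using skew[of m l] by simp
    then have "exp (\<omega> m n) * exp (\<omega> l m) = exp (\<omega> l n) * exp (\<omega> (m - l) (n - l))"
      by (simp only: exp_add[symmetric])
    then show ?case by (simp add: a mult_ac del: form_simps)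
  qed auto
  also have "\<dots> = (\<Sum>l\<in>{l\<in>P. n - l \<in> P}. \<Sum>k\<in>{k\<in>P. n - l - k \<in> P}.
      exp (\<omega> l n) * f l * (exp (\<omega> k (n - l)) * g k * h (n - l - k)))"
    by (rule sum.Sigma[symmetric]) (auto simp: fin)
  also have "\<dots> = (f \<star> (g \<star> h)) n"
    by (simp add: conv_eq[OF assms(1)] conv_ser[OF assms(1)] assms sum_distrib_left sum_distrib_right)
  finally show "(f \<star> g \<star> h) n = (f \<star> (g \<star> h)) n" .
qed

lemma conv_agree:
  assumes "graded P ht" "f \<in> ser P" "f' \<in> ser P" "g \<in> ser P" "g' \<in> ser P"
    and "\<And>m. m \<in> P \<Longrightarrow> ht m < N \<Longrightarrow> f m = f' m" "\<And>m. m \<in> P \<Longrightarrow> ht m < N \<Longrightarrow> g m = g' m"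
    and "ht n < N"
  shows "(f \<star> g) n = (f' \<star> g') n"
  unfolding conv_eq[OF assms(1,2,4)] conv_eq[OF assms(1,3,5)]
proof (rule sum.cong[OF refl])
  fix m assume "m \<in> {m\<in>P. n - m \<in> P}"
  then have m: "m \<in> P" "n - m \<in> P" by auto
  have "ht m < N" "ht (n - m) < N"
    using graded_lower(2)[OF assms(1) m] assms(8) by auto
  then show "exp (\<omega> m n) * f m * g (n - m) = exp (\<omega> m n) * f' m * g' (n - m)"
    using assms(6,7) m by simp
qed

text \<open>If the factors agree below the height of \<open>n\<close>, only the decompositions with
  \<open>m = 0\<close> or \<open>m = n\<close> can differ. In its top coefficients a product is
  therefore additive, and all recursions and comparisons of series rest on this.\<close>

lemma conv_diff:
  assumes "graded P ht" "f \<in> ser P" "f' \<in> ser P" "g \<in> ser P" "g' \<in> ser P"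
    and "\<And>m. m \<in> P \<Longrightarrow> ht m < ht n \<Longrightarrow> f m = f' m" "\<And>m. m \<in> P \<Longrightarrow> ht m < ht n \<Longrightarrow> g m = g' m"
    and "n \<in> P" "n \<noteq> 0"
  shows "(f \<star> g) n - (f' \<star> g') n = f 0 * (g n - g' n) + (f n - f' n) * g 0"
proof -
  have pos: "0 < ht n" using gradedD(5)[OF assms(1)] assms(8,9) by force
  have e0: "f 0 = f' 0" "g 0 = g' 0"
    using assms(6,7)[of 0] pos gradedD(1,2)[OF assms(1)] by auto
  have "(f \<star> g) n - (f' \<star> g') n = (\<Sum>m\<in>{m\<in>P. n - m \<in> P}.
      exp (\<omega> m n) * f m * g (n - m) - exp (\<omega> m n) * f' m * g' (n - m))"
    unfolding conv_eq[OF assms(1,2,4)] conv_eq[OF assms(1,3,5)] by (simp add: sum_subtractf)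
  also have "\<dots> = (\<Sum>m\<in>{0,n}.
      exp (\<omega> m n) * f m * g (n - m) - exp (\<omega> m n) * f' m * g' (n - m))"
  proof (rule sum.mono_neutral_right)
    show "{0, n} \<subseteq> {m \<in> P. n - m \<in> P}" using gradedD(1)[OF assms(1)] assms(8) by auto
    show "\<forall>i\<in>{m \<in> P. n - m \<in> P} - {0, n}.
       exp (\<omega> i n) * f i * g (n - i) - exp (\<omega> i n) * f' i * g' (n - i) = 0"
    proof
      fix i assume "i \<in> {m \<in> P. n - m \<in> P} - {0, n}"
      then have i: "i \<in> P" "n - i \<in> P" "i \<noteq> 0" "i \<noteq> n" by auto
      then show "exp (\<omega> i n) * f i * g (n - i) - exp (\<omega> i n) * f' i * g' (n - i) = 0"
        using graded_strict[OF assms(1) i] assms(6,7) by simp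
    qed
  qed (use gradedD(6)[OF assms(1)] in auto)
  also have "\<dots> = f 0 * (g n - g' n) + (f n - f' n) * g 0"
    using assms(9) e0 by (simp add: algebra_simps)
  finally show ?thesis .
qed

lemma conv_indecomposable:
  assumes "graded P ht" "f \<in> ser P" "g \<in> ser P" "n \<noteq> 0"
    and "\<And>m. m \<in> P \<Longrightarrow> n - m \<in> P \<Longrightarrow> m = 0 \<or> m = n"
  shows "(f \<star> g) n = f 0 * g n + f n * g 0"
proof (cases "n \<in> P")
  case True
  then have "{m\<in>P. n - m \<in> P} = {0,n}"
    using assms(5) gradedD(1)[OF assms(1)] by auto
  then show ?thesis unfolding conv_eq[OF assms(1-3)] using assms(4) by simp
next
  case False
  then show ?thesis using conv_ser[OF assms(1-3)] assms(2,3) by (simp add: ser_def)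
qed

lemma right_inverse_exists:
  assumes "graded P ht" "f \<in> unip P"
  shows "\<exists>f'\<in>unip P. f \<star> f' = one"
proof -
  define nm where "nm x m = (if m = 0 then 1 else if m \<in> P then x m else (0::real))" for x m
  have nm: "nm x \<in> ser P" "nm x 0 = 1" for x
    using gradedD(1)[OF assms(1)] by (auto simp: ser_def nm_def)
  \<comment> \<open>As \<open>f 0 = 1\<close>, the product has coefficient \<open>x n\<close> plus
    terms of lower height. The difference depends on lower heights only, and a fixed point makes the
    product vanish at \<open>n\<close>.\<close>
  define \<Phi> where "\<Phi> x n = (if n = 0 then 1 else if n \<in> P then x n - (f \<star> nm x) n else 0)" for x n
  have "\<exists>x. \<Phi> x = x"
  proof (rule graded_fixpoint[where ht = ht])
    fix x y n assume ag: "\<And>m. ht m < ht n \<Longrightarrow> x m = (y m :: real)"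
    show "\<Phi> x n = \<Phi> y n"
    proof (cases "n = 0 \<or> n \<notin> P")
      case False
      have "(f \<star> nm x) n - (f \<star> nm y) n = f 0 * (nm x n - nm y n) + (f n - f n) * nm x 0"
        by (rule conv_diff[OF assms(1)]) (use False nm assms(2) ag in \<open>auto simp: unip_def nm_def\<close>)
      then have "(f \<star> nm x) n - (f \<star> nm y) n = x n - y n"
        using False assms(2) by (simp add: unip_def nm_def)
      then show ?thesis using False by (simp add: \<Phi>_def)
    qed (auto simp: \<Phi>_def)
  qed
  then obtain x where x: "\<Phi> x = x" by blast
  have xn: "nm x = x"
  proof
    fix n show "nm x n = x n" using fun_cong[OF x, of n] by (auto simp: \<Phi>_def nm_def split: if_splits)
  qed
  have xu: "x \<in> unip P" using nm[of x] by (simp add: xn unip_def)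
  have "(f \<star> x) n = one n" for n
  proof -
    consider "n = 0" | "n \<notin> P" | "n \<noteq> 0" "n \<in> P" by blast
    then show ?thesis
    proof cases
      case 1
      then show ?thesis using conv_unip[OF assms xu] by (simp add: unip_def one_def)
    next
      case 2
      then show ?thesis using unip_out[OF conv_unip[OF assms xu] 2] gradedD(1)[OF assms(1)]
        by (auto simp: one_def)
    next
      case 3
      then show ?thesis using fun_cong[OF x, of n] xn by (simp add: \<Phi>_def one_def)
    qed
  qed
  then show ?thesis using xu by blast
qed

text \<open>A right inverse has a right inverse of its own, and associativity identifies the latter
  with \<open>f\<close>.\<close>

lemma inverse_exists:
  assumes "graded P ht" "f \<in> unip P"
  shows "\<exists>f'\<in>unip P. f \<star> f' = one \<and> f' \<star> f = one"
proof -
  obtain f' where f': "f' \<in> unip P" "f \<star> f' = one" using right_inverse_exists[OF assms] by blast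
  obtain f'' where f'': "f'' \<in> unip P" "f' \<star> f'' = one"
    using right_inverse_exists[OF assms(1) f'(1)] by blast
  have "f = f \<star> (f' \<star> f'')" by (simp add: f'')
  also have "\<dots> = f''"
    using conv_assoc[OF assms(1), of f f' f''] f' f'' assms(2) by (simp add: unip_ser)
  finally show ?thesis using f' f'' by auto
qed

lemma inverse_unique:
  assumes "graded P ht" "f \<in> ser P" "f' \<in> ser P" "f'' \<in> ser P" "f \<star> f' = one" "f'' \<star> f = one"
  shows "f'' = f'"
  using conv_assoc[OF assms(1,4,2,3)] assms(5,6) by simp

end

section \<open>Factorization with respect to a functional\<close>

definition pos_part :: "'v::real_vector set \<Rightarrow> ('v \<Rightarrow> real) \<Rightarrow> 'v set" where
  "pos_part P \<theta> = {n\<in>P. n = 0 \<or> \<theta> n > 0}"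

definition zero_part :: "'v::real_vector set \<Rightarrow> ('v \<Rightarrow> real) \<Rightarrow> 'v set" where
  "zero_part P \<theta> = {n\<in>P. \<theta> n = 0}"

definition neg_part :: "'v::real_vector set \<Rightarrow> ('v \<Rightarrow> real) \<Rightarrow> 'v set" where
  "neg_part P \<theta> = {n\<in>P. n = 0 \<or> \<theta> n < 0}"

lemmas parts_def = pos_part_def zero_part_def neg_part_def

lemma parts_subset: "pos_part P \<theta> \<subseteq> P" "zero_part P \<theta> \<subseteq> P" "neg_part P \<theta> \<subseteq> P"
  by (auto simp: parts_def)

lemma parts_mono:
  assumes "P \<subseteq> P'"
  shows "pos_part P \<theta> \<subseteq> pos_part P' \<theta>" "zero_part P \<theta> \<subseteq> zero_part P' \<theta>" "neg_part P \<theta> \<subseteq> neg_part P' \<theta>"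
  using assms by (auto simp: parts_def)

lemma graded_parts:
  assumes "graded P ht" "linear \<theta>"
  shows "graded (pos_part P \<theta>) ht" "graded (zero_part P \<theta>) ht" "graded (neg_part P \<theta>) ht"
  by (rule graded_subset[OF assms(1)];
      use assms gradedD(1,3)[OF assms(1)] in \<open>auto simp: parts_def linear_add linear_0\<close>)+

context skew_form
begin

definition factors :: "'v set \<Rightarrow> ('v \<Rightarrow> real) \<Rightarrow> ('v \<Rightarrow> real) \<Rightarrow> ('v \<Rightarrow> real) \<Rightarrow> ('v \<Rightarrow> real) \<Rightarrow> ('v \<Rightarrow> real) \<Rightarrow> bool" where
  "factors P \<theta> g p z m \<longleftrightarrow> p \<in> unip (pos_part P \<theta>) \<and> z \<in> unip (zero_part P \<theta>) \<and>
     m \<in> unip (neg_part P \<theta>) \<and> g = p \<star> z \<star> m"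

lemma factors_unip:
  assumes "factors P \<theta> g p z m"
  shows "p \<in> unip P" "z \<in> unip P" "m \<in> unip P"
  using assms unip_mono parts_subset by (metis factors_def)+

lemma factors_mono: "P \<subseteq> P' \<Longrightarrow> factors P \<theta> g p z m \<Longrightarrow> factors P' \<theta> g p z m"
  unfolding factors_def using unip_mono parts_mono by metis

lemma factors_diff:
  assumes P: "graded P ht" and f: "factors P \<theta> g p z m" and f': "factors P \<theta> g' p' z' m'"
    and ag: "\<And>m. m \<in> P \<Longrightarrow> ht m < ht n \<Longrightarrow> p m = p' m" "\<And>m. m \<in> P \<Longrightarrow> ht m < ht n \<Longrightarrow> z m = z' m"
      "\<And>l. l \<in> P \<Longrightarrow> ht l < ht n \<Longrightarrow> m l = m' l"
    and n: "n \<in> P" "n \<noteq> 0"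
  shows "g n - g' n = (p n - p' n) + (z n - z' n) + (m n - m' n)"
proof -
  note u = factors_unip[OF f] factors_unip[OF f']
  note s = u[THEN unip_ser] and z = u[THEN unip_0]
  have 1: "(p \<star> z) n - (p' \<star> z') n = p 0 * (z n - z' n) + (p n - p' n) * z 0"
    by (rule conv_diff[OF P]) (use s ag n in auto)
  have "(p \<star> z \<star> m) n - (p' \<star> z' \<star> m') n
    = (p \<star> z) 0 * (m n - m' n) + ((p \<star> z) n - (p' \<star> z') n) * m 0"
  proof (rule conv_diff[OF P])
    show "(p \<star> z) l = (p' \<star> z') l" if "l \<in> P" "ht l < ht n" for l
      by (rule conv_agree[OF P s(1) s(4) s(2) s(5), where N = "ht n"]) (use ag that in auto)
  qed (use s conv_ser[OF P] ag n in auto)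
  then show ?thesis using f f' 1 z conv_at_0[OF P] s by (simp add: factors_def)
qed

text \<open>Every nonzero degree lies in exactly one of the three parts, so only one factor can have
  a coefficient there. Together with \<open>factors_diff\<close> this makes the coefficient of the
  product determine that of the factor.\<close>

lemma factors_single:
  assumes "factors P \<theta> g p z m" "n \<noteq> 0"
  shows "\<theta> n \<le> 0 \<Longrightarrow> p n = 0" "\<theta> n \<noteq> 0 \<Longrightarrow> z n = 0" "\<theta> n \<ge> 0 \<Longrightarrow> m n = 0"
  using assms by (auto simp: factors_def unip_def ser_def parts_def)

lemma factors_agree:
  assumes P: "graded P ht" and f: "factors P \<theta> g p z m" and f': "factors P \<theta> g' p' z' m'"
    and ag: "\<And>n. n \<in> P \<Longrightarrow> ht n < N \<Longrightarrow> g n = g' n"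
  shows "n \<in> P \<Longrightarrow> ht n < N \<Longrightarrow> p n = p' n \<and> z n = z' n \<and> m n = m' n"
proof (induction "ht n" arbitrary: n rule: less_induct)
  case less
  show ?case
  proof (cases "n = 0")
    case True
    then show ?thesis using factors_unip[OF f] factors_unip[OF f'] by (simp add: unip_0)
  next
    case False
    have "g n - g' n = (p n - p' n) + (z n - z' n) + (m n - m' n)"
      by (rule factors_diff[OF P f f']) (use less False in auto)
    then have "(p n - p' n) + (z n - z' n) + (m n - m' n) = 0" using ag less.prems by simp
    then show ?thesis
      using factors_single[OF f False] factors_single[OF f' False]
      by (cases "\<theta> n < 0"; cases "\<theta> n = 0") auto
  qed
qed

lemma factors_unique:
  assumes P: "graded P ht" and f: "factors P \<theta> g p z m" and f': "factors P \<theta> g p' z' m'"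
  shows "p = p'" "z = z'" "m = m'"
proof -
  have "p n = p' n \<and> z n = z' n \<and> m n = m' n" for n
  proof (cases "n \<in> P")
    case True
    then show ?thesis using factors_agree[OF P f f', where N = "Suc (ht n)"] by auto
  next
    case False
    then show ?thesis using factors_unip[OF f] factors_unip[OF f'] by (simp add: unip_out)
  qed
  then show "p = p'" "z = z'" "m = m'" by auto
qed

text \<open>A single function \<open>x\<close> stores all three factors, since the parts are
  disjoint away from 0, and the recursion for \<open>x\<close> is solved by height.\<close>

lemma factors_exist:
  assumes P: "graded P ht" and \<theta>: "linear \<theta>" and g: "g \<in> unip P"
  shows "\<exists>p z m. factors P \<theta> g p z m"
proof -
  define rs where "rs x S l = (if l = 0 then 1 else if l \<in> S then x l else (0::real))" for x :: "'v \<Rightarrow> real" and S l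
  define pp where "pp x = rs x (pos_part P \<theta>)" for x
  define zz where "zz x = rs x (zero_part P \<theta>)" for x
  define mm where "mm x = rs x (neg_part P \<theta>)" for x
  note P0 = gradedD(1)[OF P]
  have fac: "factors P \<theta> (pp x \<star> zz x \<star> mm x) (pp x) (zz x) (mm x)" for x
    using P0 linear_0[OF \<theta>]
    by (auto simp: factors_def unip_def ser_def pp_def zz_def mm_def rs_def parts_def)
  have sumx: "pp x n + zz x n + mm x n = x n" if "n \<in> P" "n \<noteq> 0" for x n
    using that linear_0[OF \<theta>] by (auto simp: pp_def zz_def mm_def rs_def parts_def)
  define \<Phi> where "\<Phi> x n = (if n = 0 then 1 else if n \<in> P then x n - (pp x \<star> zz x \<star> mm x) n + g n else 0)" for x n
  have "\<exists>x. \<Phi> x = x"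
  proof (rule graded_fixpoint[where ht = ht])
    fix x y n assume ag: "\<And>m. ht m < ht n \<Longrightarrow> x m = (y m :: real)"
    show "\<Phi> x n = \<Phi> y n"
    proof (cases "n = 0 \<or> n \<notin> P")
      case False
      have "(pp x \<star> zz x \<star> mm x) n - (pp y \<star> zz y \<star> mm y) n
          = (pp x n - pp y n) + (zz x n - zz y n) + (mm x n - mm y n)"
        by (rule factors_diff[OF P fac fac])
           (use ag False in \<open>auto simp: pp_def zz_def mm_def rs_def\<close>)
      then show ?thesis using False sumx[of n x] sumx[of n y] by (simp add: \<Phi>_def)
    qed (auto simp: \<Phi>_def)
  qed
  then obtain x where x: "\<Phi> x = x" by blast
  have "g n = (pp x \<star> zz x \<star> mm x) n" for n
  proof -
    have u: "pp x \<star> zz x \<star> mm x \<in> unip P"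
      using conv_unip[OF P] factors_unip[OF fac] by blast
    consider "n = 0" | "n \<notin> P" | "n \<noteq> 0" "n \<in> P" by blast
    then show ?thesis
      by cases (use u g fun_cong[OF x, of n] in \<open>auto simp: unip_0 unip_out \<Phi>_def\<close>)
  qed
  then have "g = pp x \<star> zz x \<star> mm x" by auto
  then show ?thesis using fac by metis
qed

section \<open>Logarithmic derivatives and traces\<close>

definition euler :: "('v \<Rightarrow> real) \<Rightarrow> ('v \<Rightarrow> real) \<Rightarrow> 'v \<Rightarrow> real" where
  "euler \<delta> f n = \<delta> n * f n"

lemma euler_ser: "f \<in> ser P \<Longrightarrow> euler \<delta> f \<in> ser P"
  by (auto simp: ser_def euler_def)

lemma euler_conv:
  assumes P: "graded P ht" and \<delta>: "linear \<delta>" and "f \<in> ser P" "g \<in> ser P"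
  shows "euler \<delta> (f \<star> g) = (\<lambda>n. (euler \<delta> f \<star> g) n + (f \<star> euler \<delta> g) n)"
proof
  fix n
  have "euler \<delta> (f \<star> g) n = (\<Sum>m\<in>{m\<in>P. n - m \<in> P}. (\<delta> m + \<delta> (n - m)) * (exp (\<omega> m n) * f m * g (n - m)))"
    by (simp add: euler_def conv_eq[OF P] assms sum_distrib_left linear_diff[OF \<delta>])
  also have "\<dots> = (euler \<delta> f \<star> g) n + (f \<star> euler \<delta> g) n"
    by (simp add: conv_eq[OF P] euler_ser assms sum.distrib[symmetric])
       (auto simp: euler_def algebra_simps intro!: sum.cong)
  finally show "euler \<delta> (f \<star> g) n = (euler \<delta> f \<star> g) n + (f \<star> euler \<delta> g) n" .
qed

text \<open>All exponentials in degree \<open>n\<close> equal 1, so substituting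
  \<open>n - m\<close> for \<open>m\<close> exchanges the two factors.\<close>

lemma conv_trace:
  assumes P: "graded P ht" and "f \<in> ser P" "g \<in> ser P" and "\<And>m. m \<in> P \<Longrightarrow> \<omega> m n = 0"
  shows "(f \<star> g) n = (g \<star> f) n"
  unfolding conv_eq[OF P assms(2,3)] conv_eq[OF P assms(3,2)]
  by (rule sum.reindex_bij_witness[where i = "\<lambda>m. n - m" and j = "\<lambda>m. n - m"])
     (use assms(4) in auto)

text \<open>By the Leibniz rule the logarithmic derivative of \<open>y \<star> z\<close> is that of
  \<open>z\<close> plus a conjugate of that of \<open>y\<close>, and the trace at \<open>n\<close>
  does not see the conjugation.\<close>

lemma log_derivative_conv:
  assumes P: "graded P ht" and \<delta>: "linear \<delta>"
    and s: "y \<in> ser P" "z \<in> ser P" "yi \<in> ser P" "zi \<in> ser P"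
    and i: "yi \<star> y = one" "z \<star> zi = one" "zi \<star> z = one"
    and n: "\<And>m. m \<in> P \<Longrightarrow> \<omega> m n = 0"
  shows "(zi \<star> yi \<star> euler \<delta> (y \<star> z)) n = (yi \<star> euler \<delta> y) n + (zi \<star> euler \<delta> z) n"
proof -
  note c = conv_ser[OF P] and a = conv_assoc[OF P] and e = euler_ser[of _ P]
  have "zi \<star> yi \<star> euler \<delta> (y \<star> z) = (\<lambda>n. (zi \<star> yi \<star> (euler \<delta> y \<star> z)) n + (zi \<star> yi \<star> (y \<star> euler \<delta> z)) n)"
    unfolding euler_conv[OF P \<delta> s(1,2)] by (rule conv_add(2)[OF P]) (auto intro!: c e s)
  moreover have "(zi \<star> yi \<star> (euler \<delta> y \<star> z)) n = (zi \<star> (yi \<star> euler \<delta> y \<star> z)) n"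
    by (simp add: a c e s)
  moreover have "\<dots> = (yi \<star> euler \<delta> y \<star> z \<star> zi) n"
    by (rule conv_trace[OF P]) (auto intro!: c e s n)
  moreover have "\<dots> = (yi \<star> euler \<delta> y) n"
    using a[of "yi \<star> euler \<delta> y" z zi] i by (simp add: c e s)
  moreover have "zi \<star> yi \<star> (y \<star> euler \<delta> z) = zi \<star> (yi \<star> y \<star> euler \<delta> z)"
    by (simp add: a c e s)
  ultimately show ?thesis by (simp add: i)
qed

end

section \<open>The quantum dilogarithm\<close>

text \<open>Coefficients of the series with constant term 1 that satisfies
  \<open>E(X) = (1 + p^(1/2) X) E(p X)\<close>. For \<open>p > 1\<close> it is the product of
  \<open>1 / (1 + p^(-j-1/2) X)\<close> over all \<open>j \<ge> 0\<close>.\<close>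

primrec qdilog :: "real \<Rightarrow> nat \<Rightarrow> real" where
  "qdilog p 0 = 1"
| "qdilog p (Suc j) = sqrt p * p ^ j * qdilog p j / (1 - p ^ Suc j)"

text \<open>Multiplication by \<open>E(\<sigma> X)\<close>, where \<open>H b\<close> is the
  coefficient of \<open>X^b\<close> in a Laurent series. In the same reading
  \<open>binom_act s\<close> is multiplication by \<open>1 + s X\<close>.\<close>

definition qdilog_act :: "real \<Rightarrow> real \<Rightarrow> (int \<Rightarrow> real) \<Rightarrow> int \<Rightarrow> real" where
  "qdilog_act p \<sigma> H b = (\<Sum>j | H (b - int j) \<noteq> 0. \<sigma> ^ j * qdilog p j * H (b - int j))"

definition bounded_below :: "(int \<Rightarrow> real) \<Rightarrow> bool" where
  "bounded_below H \<longleftrightarrow> (\<exists>b0. \<forall>b<b0. H b = 0)"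

definition binom_act :: "real \<Rightarrow> (int \<Rightarrow> real) \<Rightarrow> int \<Rightarrow> real" where
  "binom_act s H b = H b + s * H (b - 1)"

text \<open>
  The exponents are symmetric about 0, so the product of the factors \<open>1 + p\<^sup>s X\<close> is palindromic. This is
  what relates the dilogarithms of \<open>x\<close> and \<open>x\<^sup>-\<^sup>1\<close>.
\<close>

definition qbinom_exps :: "real \<Rightarrow> nat \<Rightarrow> real list" where
  "qbinom_exps p L = map (\<lambda>j. p powr (real j + 1/2 - real L / 2)) [0..<L]"

definition qbinom_act :: "real \<Rightarrow> nat \<Rightarrow> (int \<Rightarrow> real) \<Rightarrow> int \<Rightarrow> real" where
  "qbinom_act p L = fold binom_act (qbinom_exps p L)"

lemma qdilog_Suc:
  assumes "p > 1"
  shows "qdilog p (Suc j) = p ^ Suc j * qdilog p (Suc j) + sqrt p * p ^ j * qdilog p j"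
proof -
  have "1 - p ^ Suc j \<noteq> 0" using one_less_power[OF assms, of "Suc j"] by simp
  then have "qdilog p (Suc j) * (1 - p ^ Suc j) = sqrt p * p ^ j * qdilog p j" by simp
  then show ?thesis by (simp only: algebra_simps)
qed

lemma qdilog_nonzero: "p > 1 \<Longrightarrow> qdilog p j \<noteq> 0"
proof (induction j)
  case (Suc j)
  have "1 - p ^ Suc j \<noteq> 0" using one_less_power[OF Suc.prems, of "Suc j"] by simp
  then show ?case using Suc by simp
qed simp

lemma qdilog_act_eq:
  assumes "\<And>b. b < b0 \<Longrightarrow> H b = 0" "b - b0 < int N"
  shows "qdilog_act p \<sigma> H b = (\<Sum>j<N. \<sigma> ^ j * qdilog p j * H (b - int j))"
  unfolding qdilog_act_def
proof (rule sum.mono_neutral_left)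
  show "{j. H (b - int j) \<noteq> 0} \<subseteq> {..<N}"
  proof
    fix j assume "j \<in> {j. H (b - int j) \<noteq> 0}"
    then have "\<not> b - int j < b0" using assms(1) by auto
    then show "j \<in> {..<N}" using assms(2) by auto
  qed
qed auto

lemma bounded_below_binom: "bounded_below H \<Longrightarrow> bounded_below (binom_act s H)"
proof -
  assume "bounded_below H"
  then obtain b0 where "\<forall>b<b0. H b = 0" by (auto simp: bounded_below_def)
  then have "\<forall>b<b0. binom_act s H b = 0" by (simp add: binom_act_def)
  then show ?thesis by (auto simp: bounded_below_def)
qed

lemma bounded_below_fold: "bounded_below H \<Longrightarrow> bounded_below (fold binom_act xs H)"
  by (induction xs arbitrary: H) (auto simp: bounded_below_binom)

lemma qdilog_act_binom:
  assumes p: "p > 1" and H: "bounded_below H"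
  shows "qdilog_act p \<sigma> H = qdilog_act p (p * \<sigma>) (binom_act (sqrt p * \<sigma>) H)"
proof
  fix b
  obtain b0 where b0: "\<And>b. b < b0 \<Longrightarrow> H b = 0" using H by (auto simp: bounded_below_def)
  \<comment> \<open>With this length the coefficients of \<open>H\<close> just beyond the truncation
    vanish, so the sums can be shifted without a boundary term.\<close>
  define N where "N = nat (b - b0 + 1)"
  have N: "b - b0 < int N" by (simp add: N_def)
  have z: "H (b - int N) = 0" "H (b - 1 - int N) = 0" by (rule b0, use N in auto)+
  have "qdilog_act p (p * \<sigma>) (binom_act (sqrt p * \<sigma>) H) b
      = (\<Sum>j<Suc N. (p * \<sigma>) ^ j * qdilog p j * binom_act (sqrt p * \<sigma>) H (b - int j))"
    using qdilog_act_eq[of b0 "binom_act (sqrt p * \<sigma>) H" b "Suc N" p "p * \<sigma>"] b0 N by (simp add: binom_act_def)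
  also have "\<dots> = (\<Sum>j<Suc N. (p * \<sigma>) ^ j * qdilog p j * H (b - int j))
      + (\<Sum>j<Suc N. (p * \<sigma>) ^ j * qdilog p j * (sqrt p * \<sigma>) * H (b - 1 - int j))"
    by (simp only: binom_act_def distrib_left sum.distrib mult.assoc diff_diff_eq add.commute)
  also have "(\<Sum>j<Suc N. (p * \<sigma>) ^ j * qdilog p j * H (b - int j))
      = H b + (\<Sum>j<N. (p * \<sigma>) ^ Suc j * qdilog p (Suc j) * H (b - int (Suc j)))"
    by (subst sum.lessThan_Suc_shift) (simp del: qdilog.simps(2))
  also have "(\<Sum>j<Suc N. (p * \<sigma>) ^ j * qdilog p j * (sqrt p * \<sigma>) * H (b - 1 - int j))
      = (\<Sum>j<N. (p * \<sigma>) ^ j * qdilog p j * (sqrt p * \<sigma>) * H (b - int (Suc j)))"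
    using z by (simp add: diff_diff_eq)
  also have "H b + (\<Sum>j<N. (p * \<sigma>) ^ Suc j * qdilog p (Suc j) * H (b - int (Suc j))) + \<dots>
      = H b + (\<Sum>j<N. \<sigma> ^ Suc j * qdilog p (Suc j) * H (b - int (Suc j)))"
  proof -
    have "(p * \<sigma>) ^ Suc j * qdilog p (Suc j) + (p * \<sigma>) ^ j * qdilog p j * (sqrt p * \<sigma>)
        = \<sigma> ^ Suc j * qdilog p (Suc j)" for j
      by (subst (2) qdilog_Suc[OF p]) (simp del: qdilog.simps add: algebra_simps power_mult_distrib)
    then show ?thesis
      by (simp only: add.assoc sum.distrib[symmetric] distrib_right[symmetric])
  qed
  also have "\<dots> = (\<Sum>j<Suc N. \<sigma> ^ j * qdilog p j * H (b - int j))"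
    by (subst sum.lessThan_Suc_shift) (simp del: qdilog.simps(2))
  also have "\<dots> = qdilog_act p \<sigma> H b"
    using qdilog_act_eq[of b0 H b "Suc N" p "\<sigma>"] b0 N by simp
  finally show "qdilog_act p \<sigma> H b = qdilog_act p (p * \<sigma>) (binom_act (sqrt p * \<sigma>) H) b" ..
qed

text \<open>The functional equation is applied \<open>L\<close> times. Starting from
  \<open>p^(-L/2)\<close> instead of 1 is what makes the exponents of the binomial factors
  symmetric.\<close>

lemma qdilog_act_qbinom:
  assumes p: "p > 1" and H: "bounded_below H"
  shows "qdilog_act p (p powr (- real L / 2)) H = qdilog_act p (p powr (real L / 2)) (qbinom_act p L H)"
proof -
  define \<sigma> where "\<sigma> = p powr (- real L / 2)"
  have *: "qdilog_act p \<sigma> H = qdilog_act p (p ^ M * \<sigma>) (fold binom_act (map (\<lambda>j. sqrt p * (p ^ j * \<sigma>)) [0..<M]) H)" for M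
  proof (induction M)
    case (Suc M)
    show ?case
      by (subst Suc, subst qdilog_act_binom[OF p bounded_below_fold[OF H]]) (simp add: mult.assoc)
  qed simp
  have "map (\<lambda>j. sqrt p * (p ^ j * \<sigma>)) [0..<L] = qbinom_exps p L"
    unfolding qbinom_exps_def
  proof (rule map_cong[OF refl])
    fix j
    show "sqrt p * (p ^ j * \<sigma>) = p powr (real j + 1/2 - real L / 2)"
      using p by (simp add: \<sigma>_def powr_half_sqrt[symmetric] powr_realpow[symmetric] powr_add[symmetric] algebra_simps)
  qed
  moreover have "p ^ L * \<sigma> = p powr (real L / 2)"
    using p by (simp add: \<sigma>_def powr_realpow[symmetric] powr_add[symmetric])
  ultimately show ?thesis using *[of L] by (simp add: qbinom_act_def \<sigma>_def)
qed

text \<open>The dilogarithm has constant term 1, so the coefficients are recovered one after the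
  other, upwards from a common lower bound.\<close>

lemma qdilog_act_cancel:
  assumes "bounded_below X" "bounded_below Y" "qdilog_act p \<sigma> X = qdilog_act p \<sigma> Y"
  shows "X = Y"
proof -
  obtain b1 b2 where "\<forall>b<b1. X b = 0" "\<forall>b<b2. Y b = 0" using assms by (auto simp: bounded_below_def)
  then obtain b0 where b0: "\<And>b. b < b0 \<Longrightarrow> X b = 0" "\<And>b. b < b0 \<Longrightarrow> Y b = 0"
    by (metis min_less_iff_conj min.strict_boundedE)
  have "X b = Y b" for b
  proof (induction "nat (b - b0 + 1)" arbitrary: b rule: less_induct)
    case less
    show ?case
    proof (cases "b < b0")
      case False
      define N where "N = nat (b - b0)"
      have N: "b - b0 < int (Suc N)" by (simp add: N_def)
      have "(\<Sum>j<Suc N. \<sigma> ^ j * qdilog p j * X (b - int j)) = (\<Sum>j<Suc N. \<sigma> ^ j * qdilog p j * Y (b - int j))"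
        using qdilog_act_eq[of b0 X b "Suc N" p \<sigma>] qdilog_act_eq[of b0 Y b "Suc N" p \<sigma>] b0 N
          fun_cong[OF assms(3), of b] by simp
      moreover have "(\<Sum>j<N. \<sigma> ^ Suc j * qdilog p (Suc j) * X (b - int (Suc j)))
          = (\<Sum>j<N. \<sigma> ^ Suc j * qdilog p (Suc j) * Y (b - int (Suc j)))"
        by (rule sum.cong[OF refl], subst less) (use False in auto)
      ultimately show ?thesis by (simp only: sum.lessThan_Suc_shift) simp
    qed (simp add: b0)
  qed
  then show ?thesis by auto
qed

lemma fold_binom_supp: "fold binom_act xs H b \<noteq> 0 \<Longrightarrow> \<exists>i\<le>length xs. H (b - int i) \<noteq> 0"
proof (induction xs arbitrary: H)
  case (Cons s xs)
  then obtain i where i: "i \<le> length xs" "binom_act s H (b - int i) \<noteq> 0" by auto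
  then have "H (b - int i) \<noteq> 0 \<or> H (b - int (Suc i)) \<noteq> 0"
    by (auto simp: binom_act_def diff_diff_eq add.commute)
  then show ?case using i(1) by (metis Suc_le_mono le_SucI length_Cons)
qed auto

lemma qbinom_supp: "qbinom_act p L H b \<noteq> 0 \<Longrightarrow> \<exists>i\<le>L. H (b - int i) \<noteq> 0"
  using fold_binom_supp[of "qbinom_exps p L" H b] by (simp add: qbinom_act_def qbinom_exps_def)

lemma fold_binom_scale: "fold binom_act xs (\<lambda>b. c * H b) = (\<lambda>b. c * fold binom_act xs H b)"
proof (induction xs arbitrary: H)
  case (Cons s xs)
  have "binom_act s (\<lambda>b. c * H b) = (\<lambda>b. c * binom_act s H b)"
    by (auto simp: binom_act_def algebra_simps)
  then show ?case using Cons by simp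
qed simp

lemma fold_binom_shift: "fold binom_act xs (\<lambda>b. H (b + c)) = (\<lambda>b. fold binom_act xs H (b + c))"
proof (induction xs arbitrary: H)
  case (Cons s xs)
  have "binom_act s (\<lambda>b. H (b + c)) = (\<lambda>b. binom_act s H (b + c))"
    by (auto simp: binom_act_def algebra_simps)
  then show ?case using Cons by simp
qed simp

text \<open>The substitution of \<open>X^-1\<close> acts on each factor by
  \<open>1 + s X^-1 = s X^-1 (1 + s^-1 X)\<close>.\<close>

lemma fold_binom_flip:
  assumes "\<forall>s\<in>set xs. s \<noteq> 0"
  shows "fold binom_act xs H (- b)
    = prod_list xs * fold binom_act (map inverse xs) (\<lambda>b. H (- b - int (length xs))) b"
  using assms
proof (induction xs arbitrary: H)
  case (Cons s xs)
  have "(\<lambda>b. binom_act s H (- b - int (length xs)))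
    = (\<lambda>b. s * binom_act (inverse s) (\<lambda>b. H (- b - int (length (s # xs)))) b)"
  proof
    fix b
    have "- (b - 1) - int (length (s # xs)) = - b - int (length xs)"
       "- b - int (length (s # xs)) = - b - int (length xs) - 1" by auto
    then show "binom_act s H (- b - int (length xs))
      = s * binom_act (inverse s) (\<lambda>b. H (- b - int (length (s # xs)))) b"
      using Cons.prems by (simp only: binom_act_def) (simp add: field_simps)
  qed
  then show ?case using Cons by (simp add: fold_binom_scale)
qed simp

lemma qbinom_exps_inverse:
  assumes "p > 0"
  shows "map inverse (qbinom_exps p L) = rev (qbinom_exps p L)"
  using assms
  by (intro nth_equalityI)
     (auto simp: qbinom_exps_def rev_nth powr_minus[symmetric] of_nat_diff algebra_simps add_divide_distrib diff_divide_distrib)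

lemma qbinom_flip:
  assumes "p > 0"
  shows "qbinom_act p L H (- b) = qbinom_act p L (\<lambda>b. H (- b - int L)) b"
proof -
  let ?xs = "qbinom_exps p L"
  have pos: "\<forall>s\<in>set ?xs. s > 0" using assms by (auto simp: qbinom_exps_def)
  have len: "length ?xs = L" by (simp add: qbinom_exps_def)
  have "prod_list (map inverse xs) = inverse (prod_list xs)" for xs :: "real list"
    by (induction xs) auto
  \<comment> \<open>Inverting the exponents reverses the list, so its product equals its own
    inverse. Being positive, it is 1, and the scalar in \<open>fold_binom_flip\<close>
    disappears.\<close>
  from this[of ?xs] have inv: "prod_list ?xs = inverse (prod_list ?xs)"
    by (simp add: qbinom_exps_inverse[OF assms] prod_list.rev)
  moreover have "prod_list xs > 0" if "\<forall>s\<in>set xs. s > 0" for xs :: "real list"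
    using that by (induction xs) auto
  ultimately have "prod_list ?xs = 1" using pos
    by (metis less_irrefl mult_eq_0_iff mult_less_cancel_right1 nonzero_inverse_eq_divide power2_eq_1_iff
        power2_eq_square right_inverse less_minus_one_simps(1) order_less_trans zero_less_one)
  moreover have "fold binom_act (rev ?xs) = fold binom_act ?xs"
    by (rule fold_rev) (auto simp: fun_eq_iff binom_act_def algebra_simps)
  ultimately show ?thesis
    using fold_binom_flip[of ?xs H b] pos len
    by (force simp: qbinom_act_def qbinom_exps_inverse[OF assms])
qed

lemma qdilog_intertwine:
  assumes "p > 1" "bounded_below X" "bounded_below Y"
    and "qdilog_act p (p powr (real L / 2)) X = qdilog_act p (p powr (- real L / 2)) Y"
  shows "X = qbinom_act p L Y"
  using qdilog_act_cancel[of X "qbinom_act p L Y" p "p powr (real L / 2)"] assms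
    qdilog_act_qbinom[OF assms(1,3), of L] bounded_below_fold[OF assms(3)]
  by (simp add: qbinom_act_def)

text \<open>According to the sign of \<open>l\<close>, one of the two series is the product of the
  other one with a polynomial of degree \<open>\<bar>l\<bar>\<close>.\<close>

lemma qdilog_intertwine_supp:
  assumes "p > 1" "bounded_below H" "bounded_below G"
    and "qdilog_act p (p powr (of_int l / 2)) H = qdilog_act p (p powr (- of_int l / 2)) G"
  shows "l \<ge> 0 \<Longrightarrow> H b \<noteq> 0 \<Longrightarrow> \<exists>i\<ge>0. i \<le> l \<and> G (b - i) \<noteq> 0"
    "l \<le> 0 \<Longrightarrow> G b \<noteq> 0 \<Longrightarrow> \<exists>i\<ge>0. i \<le> - l \<and> H (b - i) \<noteq> 0"
proof -
  assume l: "l \<ge> 0" "H b \<noteq> 0"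
  have "H = qbinom_act p (nat l) G"
    by (rule qdilog_intertwine) (use assms l in auto)
  then show "\<exists>i\<ge>0. i \<le> l \<and> G (b - i) \<noteq> 0"
    using qbinom_supp[of p "nat l" G b] l
    by (metis nat_eq_iff2 of_nat_0_le_iff of_nat_mono)
next
  assume l: "l \<le> 0" "G b \<noteq> 0"
  have "G = qbinom_act p (nat (- l)) H"
    by (rule qdilog_intertwine) (use assms l in auto)
  then show "\<exists>i\<ge>0. i \<le> - l \<and> H (b - i) \<noteq> 0"
    using qbinom_supp[of p "nat (- l)" H b] l
    by (metis neg_0_le_iff_le nat_eq_iff2 of_nat_0_le_iff of_nat_mono)
qed

text \<open>The polynomial \<open>Q\<close> of degree \<open>\<bar>l\<bar>\<close> relating the
  series satisfies \<open>Q(X^-1) = X^-\<bar>l\<bar> Q(X)\<close>, hence the shift by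
  \<open>l\<close>. Boundedness in both directions says that \<open>H\<close> and \<open>G\<close>
  are Laurent polynomials, so that reversing them is harmless.\<close>

lemma qdilog_intertwine_flip:
  assumes p: "p > 1" and b: "bounded_below H" "bounded_below G"
    "bounded_below (\<lambda>b. H (- b))" "bounded_below (\<lambda>b. G (- b - l))"
    and eq: "qdilog_act p (p powr (of_int l / 2)) H = qdilog_act p (p powr (- of_int l / 2)) G"
  shows "qdilog_act p (p powr (of_int l / 2)) (\<lambda>b. H (- b))
    = qdilog_act p (p powr (- of_int l / 2)) (\<lambda>b. G (- b - l))"
proof (cases "l \<ge> 0")
  case True
  then have H: "H = qbinom_act p (nat l) G"
    by (intro qdilog_intertwine) (use assms in auto)
  have "(\<lambda>b. H (- b)) = qbinom_act p (nat l) (\<lambda>b. G (- b - l))"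
    by (rule ext) (subst H, subst qbinom_flip, use p True in auto)
  then show ?thesis using qdilog_act_qbinom[OF p b(4), of "nat l"] True by simp
next
  case False
  then have G: "G = qbinom_act p (nat (- l)) H"
    by (intro qdilog_intertwine) (use assms in auto)
  have "(\<lambda>b. G (- b - l)) = qbinom_act p (nat (- l)) (\<lambda>b. H (- b))"
  proof
    fix b
    have "G (- b - l) = qbinom_act p (nat (- l)) H (- (b + l))" by (subst G) simp
    also have "\<dots> = qbinom_act p (nat (- l)) (\<lambda>b. H (- b + l)) (b + l)"
      by (subst qbinom_flip) (use p False in auto)
    also have "\<dots> = qbinom_act p (nat (- l)) (\<lambda>b. H (- (b + l) + l)) b"
      by (simp only: qbinom_act_def fold_binom_shift[of _ "\<lambda>b. H (- b + l)"])
    finally show "G (- b - l) = qbinom_act p (nat (- l)) (\<lambda>b. H (- b)) b" by simp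
  qed
  then show ?thesis using qdilog_act_qbinom[OF p b(3), of "nat (- l)"] False by simp
qed

definition dilog :: "real \<Rightarrow> 'v::real_vector \<Rightarrow> 'v \<Rightarrow> real" where
  "dilog p e m = (\<Sum>j | m = real j *\<^sub>R e. qdilog p j)"

lemma dilog_at:
  assumes "e \<noteq> 0"
  shows "dilog p e (real j *\<^sub>R e) = qdilog p j"
proof -
  have "{i. real j *\<^sub>R e = real i *\<^sub>R e} = {j}" using assms by auto
  then show ?thesis by (simp add: dilog_def)
qed

lemma dilog_out: "(\<And>j. m \<noteq> real j *\<^sub>R e) \<Longrightarrow> dilog p e m = 0"
  by (simp add: dilog_def)

lemma dilog_nonzero_iff:
  assumes "e \<noteq> 0" "p > 1"
  shows "dilog p e m \<noteq> 0 \<longleftrightarrow> (\<exists>j. m = real j *\<^sub>R e)"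
  using dilog_at[OF assms(1), of p] dilog_out[of m e p] qdilog_nonzero[OF assms(2)] by metis

context skew_form
begin

text \<open>On a line in direction \<open>e\<close> the product is one of Laurent series in one
  variable. As \<open>\<omega> e e = 0\<close>, its parameter is constant along the line;
  multiplication from the other side inverts it.\<close>

lemma conv_dilog:
  assumes "e \<noteq> 0" "p > 1"
  shows "(h \<star> dilog p e) (n + of_int b *\<^sub>R e) = qdilog_act p (exp (\<omega> n e)) (\<lambda>b. h (n + of_int b *\<^sub>R e)) b"
proof -
  let ?n = "n + of_int b *\<^sub>R e"
  have "(h \<star> dilog p e) ?n = (\<Sum>m\<in>(\<lambda>j. ?n - real j *\<^sub>R e) ` {j. h (?n - real j *\<^sub>R e) \<noteq> 0}.
      exp (\<omega> m ?n) * h m * dilog p e (?n - m))"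
    unfolding conv_def
  proof (rule sum.cong)
    show "{m. h m \<noteq> 0 \<and> dilog p e (?n - m) \<noteq> 0} = (\<lambda>j. ?n - real j *\<^sub>R e) ` {j. h (?n - real j *\<^sub>R e) \<noteq> 0}"
      unfolding dilog_nonzero_iff[OF assms] by (auto simp: image_iff algebra_simps)
  qed simp
  also have "\<dots> = (\<Sum>j | h (?n - real j *\<^sub>R e) \<noteq> 0. exp (real j * \<omega> n e) * h (?n - real j *\<^sub>R e) * qdilog p j)"
    by (subst sum.reindex)
       (use assms skew[of e n] in \<open>auto simp: inj_on_def dilog_at algebra_simps intro!: sum.cong\<close>)
  also have "\<dots> = qdilog_act p (exp (\<omega> n e)) (\<lambda>b. h (n + of_int b *\<^sub>R e)) b"
    unfolding qdilog_act_def by (simp add: exp_of_nat_mult scaleR_diff_left algebra_simps)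
  finally show ?thesis .
qed

lemma dilog_conv:
  assumes "e \<noteq> 0" "p > 1"
  shows "(dilog p e \<star> h) (n + of_int b *\<^sub>R e) = qdilog_act p (exp (- \<omega> n e)) (\<lambda>b. h (n + of_int b *\<^sub>R e)) b"
proof -
  let ?n = "n + of_int b *\<^sub>R e"
  have "(dilog p e \<star> h) ?n = (\<Sum>m\<in>(\<lambda>j. real j *\<^sub>R e) ` {j. h (?n - real j *\<^sub>R e) \<noteq> 0}.
      exp (\<omega> m ?n) * dilog p e m * h (?n - m))"
    unfolding conv_def
  proof (rule sum.cong)
    show "{m. dilog p e m \<noteq> 0 \<and> h (?n - m) \<noteq> 0} = (\<lambda>j. real j *\<^sub>R e) ` {j. h (?n - real j *\<^sub>R e) \<noteq> 0}"
      unfolding dilog_nonzero_iff[OF assms] by auto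
  qed simp
  also have "\<dots> = (\<Sum>j | h (?n - real j *\<^sub>R e) \<noteq> 0. exp (real j * (- \<omega> n e)) * qdilog p j * h (?n - real j *\<^sub>R e))"
    by (subst sum.reindex)
       (use assms skew[of e n] in \<open>auto simp: inj_on_def dilog_at intro!: sum.cong\<close>)
  also have "\<dots> = qdilog_act p (exp (- \<omega> n e)) (\<lambda>b. h (n + of_int b *\<^sub>R e)) b"
    unfolding qdilog_act_def exp_of_nat_mult by (simp add: scaleR_diff_left algebra_simps)
  finally show ?thesis .
qed

end

section \<open>Incoming walls\<close>

context skew_form
begin

lemma linear_form: "linear (\<omega> n)"
  by (rule linearI) auto

lemma conv_supp:
  assumes "(f \<star> g) n \<noteq> 0"
  obtains m where "f m \<noteq> 0" "g (n - m) \<noteq> 0"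
proof -
  have "\<not> (\<forall>m. f m = 0 \<or> g (n - m) = 0)"
  proof
    assume "\<forall>m. f m = 0 \<or> g (n - m) = 0"
    then have "{m. f m \<noteq> 0 \<and> g (n - m) \<noteq> 0} = {}" by blast
    then show False using assms unfolding conv_def by (simp only: sum.empty)
  qed
  then show ?thesis using that by blast
qed

text \<open>The constant term 1 is fixed by conjugation, so only \<open>x - 1\<close> is moved, and
  \<open>N\<close> is stable under adding degrees of \<open>Z\<close>.\<close>

lemma conj_supp:
  assumes P: "graded P ht" and a: "a \<in> unip P" "ai \<in> unip P" "ai \<star> a = one" and x: "x \<in> unip P"
    and aZ: "\<And>n. a n \<noteq> 0 \<Longrightarrow> n \<in> Z" "\<And>n. ai n \<noteq> 0 \<Longrightarrow> n \<in> Z" and xN: "\<And>n. x n \<noteq> 0 \<Longrightarrow> n = 0 \<or> n \<in> N"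
    and ZN: "\<And>m n. m \<in> Z \<Longrightarrow> n \<in> N \<Longrightarrow> m + n \<in> N"
  shows "ai \<star> x \<star> a \<in> unip P" "(ai \<star> x \<star> a) n \<noteq> 0 \<Longrightarrow> n = 0 \<or> n \<in> N"
proof -
  show "ai \<star> x \<star> a \<in> unip P" using conv_unip[OF P] a x by blast
  define y where "y n = (if n = 0 then 0 else x n)" for n
  have y: "y \<in> ser P" using x by (auto simp: y_def unip_def ser_def)
  have o: "one \<in> ser P" using one_unip[OF gradedD(1)[OF P]] by (rule unip_ser)
  have xy: "x = (\<lambda>n. one n + y n)" using x by (auto simp: y_def one_def unip_def)
  note s = a(1,2)[THEN unip_ser]
  have "ai \<star> x = (\<lambda>n. ai n + (ai \<star> y) n)"
    unfolding xy by (subst conv_add(2)[OF P o y s(2)]) simp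
  then have "ai \<star> x \<star> a = (\<lambda>n. (ai \<star> a) n + (ai \<star> y \<star> a) n)"
    using conv_add(1)[OF P s(2) conv_ser[OF P s(2) y] s(1)] by simp
  then have eq: "(ai \<star> x \<star> a) n = one n + (ai \<star> y \<star> a) n" for n by (simp add: a(3))
  assume "(ai \<star> x \<star> a) n \<noteq> 0"
  then consider "n = 0" | "(ai \<star> y \<star> a) n \<noteq> 0" using eq[of n] by (auto simp: one_def split: if_splits)
  then show "n = 0 \<or> n \<in> N"
  proof cases
    case 2
    then obtain m where m: "(ai \<star> y) m \<noteq> 0" "a (n - m) \<noteq> 0" by (rule conv_supp)
    from m(1) obtain l where l: "ai l \<noteq> 0" "y (m - l) \<noteq> 0" by (rule conv_supp)
    have "m - l \<in> N" using l(2) xN[of "m - l"] by (auto simp: y_def split: if_splits)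
    then have "l + (m - l) \<in> N" using ZN aZ(2) l(1) by blast
    then have "(n - m) + m \<in> N" using ZN[of "n - m" m] aZ(1)[OF m(2)] by simp
    then show ?thesis by simp
  qed simp
qed

lemma unip_parts_supp:
  "f \<in> unip (pos_part P \<theta>) \<longleftrightarrow> f \<in> unip P \<and> (\<forall>n. f n \<noteq> 0 \<longrightarrow> n = 0 \<or> \<theta> n > 0)"
  "f \<in> unip (neg_part P \<theta>) \<longleftrightarrow> f \<in> unip P \<and> (\<forall>n. f n \<noteq> 0 \<longrightarrow> n = 0 \<or> \<theta> n < 0)"
  "f \<in> unip (zero_part P \<theta>) \<longleftrightarrow> f \<in> unip P \<and> (\<forall>n. f n \<noteq> 0 \<longrightarrow> \<theta> n = 0)"
  by (auto simp: unip_def ser_def parts_def)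

lemma factors_right_neg:
  assumes P: "graded P ht" and \<theta>: "linear \<theta>" and f: "factors P \<theta> h p z m"
    and a: "a \<in> unip (neg_part P \<theta>)"
  shows "factors P \<theta> (h \<star> a) p z (m \<star> a)"
proof -
  have "a \<in> unip P" using a unip_mono parts_subset by metis
  then have "h \<star> a = p \<star> z \<star> (m \<star> a)"
    using f factors_unip[OF f] conv_ser[OF P] by (simp add: factors_def conv_assoc[OF P] unip_ser)
  then show ?thesis using f a conv_unip[OF graded_parts(3)[OF P \<theta>]] by (simp add: factors_def)
qed

lemma factors_left_pos:
  assumes P: "graded P ht" and \<theta>: "linear \<theta>" and f: "factors P \<theta> h p z m"
    and a: "a \<in> unip (pos_part P \<theta>)"
  shows "factors P \<theta> (a \<star> h) (a \<star> p) z m"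
proof -
  have "a \<in> unip P" using a unip_mono parts_subset by metis
  then have "a \<star> h = a \<star> p \<star> z \<star> m"
    using f factors_unip[OF f] conv_ser[OF P] by (simp add: factors_def conv_assoc[OF P] unip_ser)
  then show ?thesis using f a conv_unip[OF graded_parts(1)[OF P \<theta>]] by (simp add: factors_def)
qed

text \<open>Moving \<open>a\<close> to the left past \<open>m\<close> conjugates \<open>m\<close>.
  Since \<theta> vanishes on the degrees of \<open>a\<close>, those of the conjugate remain
  negative.\<close>

lemma factors_right_zero:
  assumes P: "graded P ht" and \<theta>: "linear \<theta>" and f: "factors P \<theta> h p z m"
    and a: "a \<in> unip (zero_part P \<theta>)" "ai \<in> unip (zero_part P \<theta>)" "a \<star> ai = one" "ai \<star> a = one"
  shows "factors P \<theta> (h \<star> a) p (z \<star> a) (ai \<star> m \<star> a)"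
proof -
  have aP: "a \<in> unip P" "ai \<in> unip P" using a unip_mono parts_subset by metis+
  note u = factors_unip[OF f] aP
  note s = u[THEN unip_ser]
  have "p \<star> (z \<star> a) \<star> (ai \<star> m \<star> a) = p \<star> z \<star> (a \<star> ai) \<star> m \<star> a"
    using s conv_ser[OF P] by (simp add: conv_assoc[OF P])
  then have eq: "h \<star> a = p \<star> (z \<star> a) \<star> (ai \<star> m \<star> a)" using f a by (simp add: factors_def)
  have m: "m \<in> unip (neg_part P \<theta>)" using f by (simp add: factors_def)
  have "ai \<star> m \<star> a \<in> unip (neg_part P \<theta>)"
    unfolding unip_parts_supp(2)
  proof (intro conjI allI impI)
    show "ai \<star> m \<star> a \<in> unip P" using conv_unip[OF P] u by blast
    show "n = 0 \<or> \<theta> n < 0" if "(ai \<star> m \<star> a) n \<noteq> 0" for n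
      using conj_supp(2)[OF P u(4,5) a(4) u(3), where Z = "{n. \<theta> n = 0}" and N = "{n. \<theta> n < 0}" and n = n]
        that a(1,2) m linear_add[OF \<theta>] unfolding unip_parts_supp by auto
  qed
  moreover have "z \<star> a \<in> unip (zero_part P \<theta>)"
    using conv_unip[OF graded_parts(2)[OF P \<theta>]] f a by (simp add: factors_def)
  ultimately show ?thesis using f eq by (simp add: factors_def)
qed

lemma factors_left_zero:
  assumes P: "graded P ht" and \<theta>: "linear \<theta>" and f: "factors P \<theta> h p z m"
    and a: "a \<in> unip (zero_part P \<theta>)" "ai \<in> unip (zero_part P \<theta>)" "a \<star> ai = one" "ai \<star> a = one"
  shows "factors P \<theta> (a \<star> h) (a \<star> p \<star> ai) (a \<star> z) m"
proof -
  have aP: "a \<in> unip P" "ai \<in> unip P" using a unip_mono parts_subset by metis+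
  note u = factors_unip[OF f] aP
  note s = u[THEN unip_ser]
  have "a \<star> p \<star> ai \<star> (a \<star> z) \<star> m = a \<star> (p \<star> (ai \<star> a \<star> (z \<star> m)))"
    using s conv_ser[OF P] by (simp add: conv_assoc[OF P])
  moreover have "a \<star> h = a \<star> (p \<star> (z \<star> m))"
    using s conv_ser[OF P] f by (simp add: conv_assoc[OF P] factors_def)
  ultimately have eq: "a \<star> h = a \<star> p \<star> ai \<star> (a \<star> z) \<star> m" using f a by simp
  have m: "p \<in> unip (pos_part P \<theta>)" using f by (simp add: factors_def)
  have "a \<star> p \<star> ai \<in> unip (pos_part P \<theta>)"
    unfolding unip_parts_supp(1)
  proof (intro conjI allI impI)
    show "a \<star> p \<star> ai \<in> unip P" using conv_unip[OF P] u by blast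
    show "n = 0 \<or> \<theta> n > 0" if "(a \<star> p \<star> ai) n \<noteq> 0" for n
      using conj_supp(2)[OF P u(5,4) a(3) u(1), where Z = "{n. \<theta> n = 0}" and N = "{n. \<theta> n > 0}" and n = n]
        that a(1,2) m linear_add[OF \<theta>] unfolding unip_parts_supp by auto
  qed
  moreover have "a \<star> z \<in> unip (zero_part P \<theta>)"
    using conv_unip[OF graded_parts(2)[OF P \<theta>]] f a by (simp add: factors_def)
  ultimately show ?thesis using f eq by (simp add: factors_def)
qed

text \<open>
  The number \<open>(zi \<star> euler \<delta> z) n\<close> is \<open>\<delta> n\<close> times the coefficient of \<open>log z\<close> in degree \<open>n\<close>. On series
  supported on degrees orthogonal to \<open>n\<close> the coefficient at \<open>n\<close> is a trace, which makes this
  number additive in \<open>z\<close>.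
\<close>

definition traceless :: "'v set \<Rightarrow> 'v \<Rightarrow> ('v \<Rightarrow> real) \<Rightarrow> bool" where
  "traceless P n z \<longleftrightarrow> (\<exists>zi\<in>unip (zero_part P (\<omega> n)). \<exists>\<delta>. linear \<delta> \<and> \<delta> n \<noteq> 0 \<and>
     z \<star> zi = one \<and> zi \<star> z = one \<and> (zi \<star> euler \<delta> z) n = 0)"

text \<open>The condition on incoming walls, that is, their absence: a wall orthogonal to
  \<open>n\<close> is incoming if it contains the functional \<open>\<omega> n\<close>, which is the
  one factored by here.\<close>

definition incoming :: "'v set \<Rightarrow> ('v \<Rightarrow> real) \<Rightarrow> 'v \<Rightarrow> bool" where
  "incoming P g n \<longleftrightarrow> (\<exists>p z m. factors P (\<omega> n) g p z m \<and> traceless P n z)"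

lemma incoming_iff:
  assumes "graded P ht" "factors P (\<omega> n) g p z m"
  shows "incoming P g n \<longleftrightarrow> traceless P n z"
  using factors_unique(2)[OF assms] assms(2) unfolding incoming_def by metis

text \<open>The inverse of \<open>z\<close> found in the smaller monoid is the only one in the
  larger monoid. The condition is thus independent of the monoid and can be carried from the cone of
  one seed to that of another.\<close>

lemma traceless_mono:
  assumes P: "graded P ht" and Q: "graded Q ht'" "Q \<subseteq> P" and z: "z \<in> unip (zero_part Q (\<omega> n))"
  shows "traceless Q n z \<longleftrightarrow> traceless P n z"
proof
  assume "traceless Q n z"
  then show "traceless P n z"
    unfolding traceless_def using unip_mono[OF parts_mono(2)[OF Q(2)]] by blast
next
  assume "traceless P n z"
  then obtain zi \<delta> where zi: "zi \<in> unip (zero_part P (\<omega> n))" "linear \<delta>" "\<delta> n \<noteq> 0" "z \<star> zi = one"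
     "zi \<star> z = one" "(zi \<star> euler \<delta> z) n = 0" unfolding traceless_def by blast
  obtain y where y: "y \<in> unip (zero_part Q (\<omega> n))" "z \<star> y = one"
    using right_inverse_exists[OF graded_parts(2)[OF Q(1) linear_form] z] by blast
  have "z \<in> ser P" "y \<in> ser P" "zi \<in> ser P"
    using z y(1) zi(1) Q(2) by (auto simp: unip_def ser_def parts_def)
  then have "zi = y" using inverse_unique[OF P, of z y zi] y zi by simp
  then show "traceless Q n z" unfolding traceless_def using y zi by blast
qed

lemma traceless_out:
  fixes \<delta> :: "'v \<Rightarrow> real"
  assumes Q: "graded Q ht" and z: "z \<in> unip (zero_part Q (\<omega> n))" and n: "n \<notin> Q" "linear \<delta>" "\<delta> n \<noteq> 0"
  shows "traceless Q n z"
proof -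
  note Z = graded_parts(2)[OF Q linear_form[of n]]
  obtain y where y: "y \<in> unip (zero_part Q (\<omega> n))" "z \<star> y = one" "y \<star> z = one"
    using inverse_exists[OF Z z] by blast
  have "(y \<star> euler \<delta> z) \<in> ser (zero_part Q (\<omega> n))"
    by (rule conv_ser[OF Z]) (use y z in \<open>auto intro: unip_ser euler_ser\<close>)
  then have "(y \<star> euler \<delta> z) n = 0" using n by (auto simp: ser_def parts_def)
  then show ?thesis unfolding traceless_def using y n by blast
qed

lemma log_derivative_off:
  assumes "graded R ht" "a \<in> unip R" "ai \<in> unip R" "n \<notin> R"
  shows "(ai \<star> euler \<delta> a) n = 0"
  using conv_ser[OF assms(1), of ai "euler \<delta> a"] assms euler_ser[of a R] by (simp add: unip_ser ser_out)

text \<open>The logarithmic derivative of \<open>a\<close> lives on \<open>R\<close>, which misses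
  \<open>n\<close>, so by additivity of the trace \<open>a\<close> contributes nothing.\<close>

lemma traceless_mult:
  assumes P: "graded P ht" and R: "graded R ht'" "R \<subseteq> zero_part P (\<omega> n)"
    and a: "a \<in> unip R" "ai \<in> unip R" "a \<star> ai = one" "ai \<star> a = one"
    and z: "z \<in> unip (zero_part P (\<omega> n))" and n: "n \<notin> R"
  shows "traceless P n (z \<star> a) \<longleftrightarrow> traceless P n z" "traceless P n (a \<star> z) \<longleftrightarrow> traceless P n z"
proof -
  note Z = graded_parts(2)[OF P linear_form[of n]]
  obtain zi where zi: "zi \<in> unip (zero_part P (\<omega> n))" "z \<star> zi = one" "zi \<star> z = one"
    using inverse_exists[OF Z z] by blast
  have aZ: "a \<in> unip (zero_part P (\<omega> n))" "ai \<in> unip (zero_part P (\<omega> n))"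
    using a unip_mono[OF R(2)] by auto
  note s = aZ[THEN unip_ser] z[THEN unip_ser] zi(1)[THEN unip_ser]
  have om: "\<omega> m n = 0" if "m \<in> zero_part P (\<omega> n)" for m
    using that skew[of m n] by (simp add: parts_def)
  have off: "(ai \<star> euler \<delta> a) n = 0" for \<delta> by (rule log_derivative_off[OF R(1) a(1,2) n])
  have main: "traceless P n y \<longleftrightarrow> traceless P n z"
    if y: "y \<in> unip (zero_part P (\<omega> n))" "y \<star> yi = one" "yi \<star> y = one" "yi \<in> unip (zero_part P (\<omega> n))"
      and eq: "\<And>\<delta>. linear \<delta> \<Longrightarrow> (yi \<star> euler \<delta> y) n = (zi \<star> euler \<delta> z) n" for y yi
  proof -
    have "traceless P n x \<longleftrightarrow> (\<exists>\<delta>. linear \<delta> \<and> \<delta> n \<noteq> 0 \<and> (xi \<star> euler \<delta> x) n = 0)"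
      if x: "x \<in> unip (zero_part P (\<omega> n))" "xi \<in> unip (zero_part P (\<omega> n))" "x \<star> xi = one" "xi \<star> x = one" for x xi
    proof -
      have "xj = xi" if "xj \<in> unip (zero_part P (\<omega> n))" "xj \<star> x = one" for xj
        using inverse_unique[OF Z, of x xi xj] that x by (simp add: unip_ser)
      then show ?thesis unfolding traceless_def using x by blast
    qed
    from this[of y yi] this[of z zi] show ?thesis using y z zi eq by auto
  qed
  have inv1: "z \<star> a \<star> (ai \<star> zi) = one" "ai \<star> zi \<star> (z \<star> a) = one"
  proof -
    have "z \<star> a \<star> (ai \<star> zi) = z \<star> (a \<star> ai \<star> zi)" "ai \<star> zi \<star> (z \<star> a) = ai \<star> (zi \<star> z \<star> a)"
      using s conv_ser[OF Z] by (simp_all add: conv_assoc[OF Z])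
    then show "z \<star> a \<star> (ai \<star> zi) = one" "ai \<star> zi \<star> (z \<star> a) = one" using a zi by auto
  qed
  have inv2: "a \<star> z \<star> (zi \<star> ai) = one" "zi \<star> ai \<star> (a \<star> z) = one"
  proof -
    have "a \<star> z \<star> (zi \<star> ai) = a \<star> (z \<star> zi \<star> ai)" "zi \<star> ai \<star> (a \<star> z) = zi \<star> (ai \<star> a \<star> z)"
      using s conv_ser[OF Z] by (simp_all add: conv_assoc[OF Z])
    then show "a \<star> z \<star> (zi \<star> ai) = one" "zi \<star> ai \<star> (a \<star> z) = one" using a zi by auto
  qed
  show "traceless P n (z \<star> a) \<longleftrightarrow> traceless P n z"
    by (rule main[OF _ inv1])
       (use conv_unip[OF Z] z zi aZ log_derivative_conv[OF Z _ s(3,1,4,2) zi(3) a(3,4)] om off in auto)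
  show "traceless P n (a \<star> z) \<longleftrightarrow> traceless P n z"
    by (rule main[OF _ inv2])
       (use conv_unip[OF Z] z zi aZ log_derivative_conv[OF Z _ s(1,3,2,4) a(4) zi(2,3)] om off in auto)
qed

definition ray :: "'v \<Rightarrow> 'v set" where
  "ray v = {real j *\<^sub>R v | j. True}"

lemma ray_part:
  assumes "graded P ht" "v \<in> P" "linear \<theta>"
  shows "graded (ray v) ht" "ray v \<subseteq> P" "\<theta> v > 0 \<Longrightarrow> ray v \<subseteq> pos_part P \<theta>"
    "\<theta> v = 0 \<Longrightarrow> ray v \<subseteq> zero_part P \<theta>" "\<theta> v < 0 \<Longrightarrow> ray v \<subseteq> neg_part P \<theta>"
proof -
  have mem: "real j *\<^sub>R v \<in> P" for j
  proof (induction j)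
    case (Suc j)
    then show ?case using gradedD(3)[OF assms(1,2)] by (simp add: scaleR_add_left)
  qed (simp add: gradedD(1)[OF assms(1)])
  then show sub: "ray v \<subseteq> P" by (auto simp: ray_def)
  show "graded (ray v) ht"
  proof (rule graded_subset[OF assms(1) sub])
    show "0 \<in> ray v" by (auto simp: ray_def intro: exI[of _ 0])
    show "m + n \<in> ray v" if "m \<in> ray v" "n \<in> ray v" for m n
      using that by (auto simp: ray_def scaleR_add_left[symmetric] simp flip: of_nat_add)
  qed
  show "\<theta> v > 0 \<Longrightarrow> ray v \<subseteq> pos_part P \<theta>" "\<theta> v = 0 \<Longrightarrow> ray v \<subseteq> zero_part P \<theta>" "\<theta> v < 0 \<Longrightarrow> ray v \<subseteq> neg_part P \<theta>"
    using mem by (auto simp: ray_def parts_def linear_scale[OF assms(3)] zero_less_mult_iff mult_less_0_iff)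
qed

text \<open>The sign of \<open>\<omega> n v\<close> lets \<open>a\<close> be absorbed into the
  negative factor or into the middle one, and neither changes the trace at \<open>n\<close>. A
  factor on the left needs the opposite sign.\<close>

lemma incoming_right:
  assumes P: "graded P ht" and v: "v \<in> P" "\<omega> n v \<le> 0" "n \<notin> ray v"
    and a: "a \<in> unip (ray v)" "ai \<in> unip (ray v)" "a \<star> ai = one" "ai \<star> a = one"
    and f: "factors P (\<omega> n) h p z m"
  shows "incoming P (h \<star> a) n \<longleftrightarrow> traceless P n z"
proof -
  note r = ray_part[OF P v(1) linear_form[of n]]
  have z: "z \<in> unip (zero_part P (\<omega> n))" using f by (simp add: factors_def)
  show ?thesis
  proof (cases "\<omega> n v = 0")
    case True
    have "factors P (\<omega> n) (h \<star> a) p (z \<star> a) (ai \<star> m \<star> a)"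
      by (rule factors_right_zero[OF P linear_form f]) (use unip_mono[OF r(4)[OF True]] a in auto)
    then show ?thesis using incoming_iff[OF P] traceless_mult(1)[OF P r(1) r(4)[OF True] a z v(3)] by simp
  next
    case False
    then have neg: "\<omega> n v < 0" using v by simp
    have "factors P (\<omega> n) (h \<star> a) p z (m \<star> a)"
      by (rule factors_right_neg[OF P linear_form f]) (use unip_mono[OF r(5)[OF neg]] a in auto)
    then show ?thesis using incoming_iff[OF P] by simp
  qed
qed

lemma incoming_left:
  assumes P: "graded P ht" and v: "v \<in> P" "\<omega> n v \<ge> 0" "n \<notin> ray v"
    and a: "a \<in> unip (ray v)" "ai \<in> unip (ray v)" "a \<star> ai = one" "ai \<star> a = one"
    and f: "factors P (\<omega> n) h p z m"
  shows "incoming P (a \<star> h) n \<longleftrightarrow> traceless P n z"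
proof -
  note r = ray_part[OF P v(1) linear_form[of n]]
  have z: "z \<in> unip (zero_part P (\<omega> n))" using f by (simp add: factors_def)
  show ?thesis
  proof (cases "\<omega> n v = 0")
    case True
    have "factors P (\<omega> n) (a \<star> h) (a \<star> p \<star> ai) (a \<star> z) m"
      by (rule factors_left_zero[OF P linear_form f]) (use unip_mono[OF r(4)[OF True]] a in auto)
    then show ?thesis using incoming_iff[OF P] traceless_mult(2)[OF P r(1) r(4)[OF True] a z v(3)] by simp
  next
    case False
    then have neg: "\<omega> n v > 0" using v by simp
    have "factors P (\<omega> n) (a \<star> h) (a \<star> p) z m"
      by (rule factors_left_pos[OF P linear_form f]) (use unip_mono[OF r(3)[OF neg]] a in auto)
    then show ?thesis using incoming_iff[OF P] by simp
  qed
qed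

definition splits :: "'v set \<Rightarrow> ('v \<Rightarrow> real) \<Rightarrow> ('v \<Rightarrow> real) \<Rightarrow> bool" where
  "splits P \<theta> g \<longleftrightarrow> (\<exists>p m. factors P \<theta> g p one m)"

lemma splits_iff:
  assumes "graded P ht" "factors P \<theta> g p z m"
  shows "splits P \<theta> g \<longleftrightarrow> z = one"
  using factors_unique(2)[OF assms] assms(2) unfolding splits_def by metis

end

section \<open>Cluster elements\<close>

locale cluster_form = skew_form \<omega> for \<omega> :: "'v::real_vector \<Rightarrow> 'v \<Rightarrow> real" +
  fixes U :: "'i set" and D :: "'i \<Rightarrow> nat"
  assumes finU: "finite U" and Dpos: "i \<in> U \<Longrightarrow> D i > 0"
begin

text \<open>The functionals live on the whole space although \<open>e\<close> spans only its mutable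
  part; off that span their values are unconstrained apart from linearity.\<close>

definition dual_family :: "('i \<Rightarrow> 'v) \<Rightarrow> ('i \<Rightarrow> 'v \<Rightarrow> real) \<Rightarrow> bool" where
  "dual_family e co \<longleftrightarrow> (\<forall>i\<in>U. linear (co i)) \<and> (\<forall>i\<in>U. \<forall>j\<in>U. co i (e j) = (if i = j then 1 else 0))"

definition integral_family :: "('i \<Rightarrow> 'v) \<Rightarrow> bool" where
  "integral_family e \<longleftrightarrow> (\<forall>i\<in>U. \<forall>j\<in>U. real (D j) * \<omega> (e i) (e j) \<in> \<int>)"

definition ncone :: "('i \<Rightarrow> 'v) \<Rightarrow> 'v set" where
  "ncone e = {\<Sum>i\<in>U. real (a i) *\<^sub>R e i | a. True}"

text \<open>Chosen so that the commutation factor \<open>exp (2 * \<omega> n (e i))\<close> is the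
  power of \<open>par i\<close> with exponent \<open>D i * \<omega> n (e i)\<close>, which is an
  integer on the cone of an integral family.\<close>

definition par :: "'i \<Rightarrow> real" where
  "par i = exp (2 / real (D i))"

lemma par_gt_1: "i \<in> U \<Longrightarrow> par i > 1"
  using Dpos by (simp add: par_def)

definition cluster_element :: "('i \<Rightarrow> 'v) \<Rightarrow> ('v \<Rightarrow> real) \<Rightarrow> bool" where
  "cluster_element e g \<longleftrightarrow> g \<in> unip (ncone e) \<and> (\<forall>i\<in>U. \<forall>j. g (real j *\<^sub>R e i) = qdilog (par i) j) \<and>
     (\<forall>n\<in>ncone e. n \<noteq> 0 \<longrightarrow> (\<forall>i\<in>U. n \<notin> ray (e i)) \<longrightarrow> incoming (ncone e) g n)"

end

locale cluster_basis = cluster_form \<omega> U D for \<omega> :: "'v::real_vector \<Rightarrow> 'v \<Rightarrow> real" and U :: "'i set" and D +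
  fixes e :: "'i \<Rightarrow> 'v" and co :: "'i \<Rightarrow> 'v \<Rightarrow> real"
  assumes dual: "dual_family e co"
begin

lemma co_linear: "i \<in> U \<Longrightarrow> linear (co i)"
  using dual by (simp add: dual_family_def)

lemma co_e: "i \<in> U \<Longrightarrow> j \<in> U \<Longrightarrow> co i (e j) = (if i = j then 1 else 0)"
  using dual by (simp add: dual_family_def)

lemmas co_simps = linear_add[OF co_linear] linear_diff[OF co_linear] linear_scale[OF co_linear] linear_0[OF co_linear]
  linear_neg[OF co_linear]

lemma co_sum: "i \<in> U \<Longrightarrow> co i (\<Sum>j\<in>U. a j *\<^sub>R e j) = a i"
  by (simp add: linear_sum[OF co_linear] co_simps co_e finU if_distrib sum.delta cong: if_cong)

lemma cone_iff: "n \<in> ncone e \<longleftrightarrow> n = (\<Sum>i\<in>U. co i n *\<^sub>R e i) \<and> (\<forall>i\<in>U. co i n \<in> \<nat>)"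
proof
  assume "n \<in> ncone e"
  then obtain a where n: "n = (\<Sum>i\<in>U. real (a i) *\<^sub>R e i)" by (auto simp: ncone_def)
  have "co i n = real (a i)" if "i \<in> U" for i using co_sum[OF that, of "\<lambda>i. real (a i)"] n by simp
  then show "n = (\<Sum>i\<in>U. co i n *\<^sub>R e i) \<and> (\<forall>i\<in>U. co i n \<in> \<nat>)"
    using n by (auto intro: sum.cong)
next
  assume r: "n = (\<Sum>i\<in>U. co i n *\<^sub>R e i) \<and> (\<forall>i\<in>U. co i n \<in> \<nat>)"
  then have "\<forall>i\<in>U. \<exists>a. co i n = real a" by (auto elim: Nats_cases)
  then obtain a where "\<forall>i\<in>U. co i n = real (a i)" by metis
  then have "(\<Sum>i\<in>U. co i n *\<^sub>R e i) = (\<Sum>i\<in>U. real (a i) *\<^sub>R e i)" by (intro sum.cong) auto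
  then show "n \<in> ncone e" using r unfolding ncone_def by auto
qed

lemma cone_co: "n \<in> ncone e \<Longrightarrow> i \<in> U \<Longrightarrow> co i n \<in> \<nat>"
  by (simp add: cone_iff)

lemma cone_co_nonneg: "n \<in> ncone e \<Longrightarrow> i \<in> U \<Longrightarrow> co i n \<ge> 0"
  using cone_co[of n i] by (auto elim: Nats_cases)

lemma cone_expand: "n \<in> ncone e \<Longrightarrow> n = (\<Sum>i\<in>U. co i n *\<^sub>R e i)"
  using cone_iff by blast

definition deg :: "'v \<Rightarrow> real" where
  "deg n = (\<Sum>i\<in>U. co i n)"

definition ht :: "'v \<Rightarrow> nat" where
  "ht n = nat \<lfloor>deg n\<rfloor>"

lemma linear_deg: "linear deg"
  by (rule linearI) (auto simp: deg_def co_simps sum.distrib sum_distrib_left)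

lemma sum_in_Nats: "(\<And>i. i \<in> S \<Longrightarrow> f i \<in> \<nat>) \<Longrightarrow> (\<Sum>i\<in>S. f i :: real) \<in> \<nat>"
  by (induction S rule: infinite_finite_induct) auto

lemma Nats_real_floor: "x \<in> \<nat> \<Longrightarrow> real (nat \<lfloor>x\<rfloor>) = x"
  by (auto elim: Nats_cases)

lemma deg_Nats: "n \<in> ncone e \<Longrightarrow> deg n \<in> \<nat>"
  unfolding deg_def by (rule sum_in_Nats) (rule cone_co)

lemma deg_zero: "n \<in> ncone e \<Longrightarrow> deg n = 0 \<Longrightarrow> n = 0"
proof -
  assume n: "n \<in> ncone e" "deg n = 0"
  then have "\<forall>i\<in>U. co i n = 0"
    using sum_nonneg_eq_0_iff[OF finU, of "\<lambda>i. co i n"] cone_co_nonneg unfolding deg_def by simp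
  then show "n = 0" using cone_expand[OF n(1)] by simp
qed

lemma cone_0: "0 \<in> ncone e"
  by (auto simp: ncone_def intro!: exI[of _ "\<lambda>_. 0"])

lemma cone_add: "m \<in> ncone e \<Longrightarrow> n \<in> ncone e \<Longrightarrow> m + n \<in> ncone e"
proof -
  assume "m \<in> ncone e" "n \<in> ncone e"
  then obtain a b where "m = (\<Sum>i\<in>U. real (a i) *\<^sub>R e i)" "n = (\<Sum>i\<in>U. real (b i) *\<^sub>R e i)"
    by (auto simp: ncone_def)
  then have "m + n = (\<Sum>i\<in>U. real (a i + b i) *\<^sub>R e i)" by (simp add: sum.distrib scaleR_add_left)
  then show ?thesis unfolding ncone_def by (intro CollectI exI[of _ "\<lambda>i. a i + b i"]) simp
qed

lemma cone_e: "i \<in> U \<Longrightarrow> e i \<in> ncone e"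
  unfolding ncone_def
  by (auto intro!: exI[of _ "\<lambda>j. if j = i then 1 else 0"] simp: finU if_distrib if_distribR sum.delta cong: if_cong)

lemma e_nonzero: "i \<in> U \<Longrightarrow> e i \<noteq> 0"
  using co_e[of i i] linear_0[OF co_linear[of i]] by auto

lemma graded_cone: "graded (ncone e) ht"
  unfolding graded_def
proof (intro conjI ballI allI impI)
  show "m + n \<in> ncone e" "ht (m + n) = ht m + ht n" if "m \<in> ncone e" "n \<in> ncone e" for m n
  proof -
    show mn: "m + n \<in> ncone e" using cone_add that by blast
    have "real (ht (m + n)) = real (ht m + ht n)"
      using Nats_real_floor[OF deg_Nats] that mn by (simp add: ht_def linear_add[OF linear_deg, symmetric])
    then show "ht (m + n) = ht m + ht n" by (simp only: of_nat_eq_iff)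
  qed
  show "n = 0" if "n \<in> ncone e" "ht n = 0" for n
    using that Nats_real_floor[OF deg_Nats[OF that(1)]] deg_zero[OF that(1)] by (simp add: ht_def)
  show "finite {m\<in>ncone e. n - m \<in> ncone e}" for n
  proof (rule finite_subset)
    have fin: "finite {x\<in>\<nat>. x \<le> c}" for c :: real
    proof (rule finite_subset)
      show "{x\<in>\<nat>. x \<le> c} \<subseteq> real ` {..nat \<lfloor>c\<rfloor>}"
        by (auto elim!: Nats_cases simp: le_nat_floor)
    qed simp
    then show "finite ((\<lambda>f. \<Sum>i\<in>U. f i *\<^sub>R e i) ` (PiE U (\<lambda>i. {x\<in>\<nat>. x \<le> co i n})))"
      by (intro finite_imageI finite_PiE finU)
    show "{m\<in>ncone e. n - m \<in> ncone e} \<subseteq> (\<lambda>f. \<Sum>i\<in>U. f i *\<^sub>R e i) ` (PiE U (\<lambda>i. {x\<in>\<nat>. x \<le> co i n}))"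
    proof
      fix m assume m: "m \<in> {m\<in>ncone e. n - m \<in> ncone e}"
      have "m = (\<Sum>i\<in>U. restrict (\<lambda>i. co i m) U i *\<^sub>R e i)"
        using cone_expand[of m] m by simp
      moreover have "restrict (\<lambda>i. co i m) U \<in> PiE U (\<lambda>i. {x\<in>\<nat>. x \<le> co i n})"
        using m cone_co[of m] cone_co_nonneg[of "n - m"] by (auto simp: co_simps)
      ultimately show "m \<in> (\<lambda>f. \<Sum>i\<in>U. f i *\<^sub>R e i) ` (PiE U (\<lambda>i. {x\<in>\<nat>. x \<le> co i n}))" by blast
    qed
  qed
qed (rule cone_0)

text \<open>The ray is extremal in the cone: the other coordinates of the two summands are
  nonnegative and add up to zero.\<close>

lemma ray_decomp:
  assumes "i \<in> U" "m \<in> ncone e" "real j *\<^sub>R e i - m \<in> ncone e"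
  shows "\<exists>l\<le>j. m = real l *\<^sub>R e i"
proof -
  have z: "co r m = 0" if "r \<in> U" "r \<noteq> i" for r
    using cone_co_nonneg[OF assms(2) that(1)] cone_co_nonneg[OF assms(3) that(1)] that assms(1)
    by (simp add: co_simps co_e)
  have "m = (\<Sum>r\<in>U. co r m *\<^sub>R e r)" by (rule cone_expand[OF assms(2)])
  also have "\<dots> = (\<Sum>r\<in>U. if r = i then co i m *\<^sub>R e i else 0)" by (rule sum.cong) (auto simp: z)
  finally have m: "m = co i m *\<^sub>R e i" using assms(1) finU by simp
  obtain l where l: "co i m = real l" using cone_co[OF assms(2,1)] by (auto elim: Nats_cases)
  have "real l \<le> real j" using cone_co_nonneg[OF assms(3,1)] assms(1) by (simp add: co_simps co_e l)
  then show ?thesis using m l by (intro exI[of _ l]) auto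
qed

text \<open>The ray is extremal and isotropic, so restriction to it turns the product into the
  ordinary product of power series.\<close>

lemma conv_ray:
  assumes "i \<in> U" "f \<in> ser (ncone e)" "g \<in> ser (ncone e)"
  shows "(f \<star> g) (real j *\<^sub>R e i) = (\<Sum>l\<le>j. f (real l *\<^sub>R e i) * g (real (j - l) *\<^sub>R e i))"
proof -
  let ?n = "real j *\<^sub>R e i"
  have mem: "real l *\<^sub>R e i \<in> ncone e" for l
    using ray_part(2)[OF graded_cone cone_e[OF assms(1)] linear_form[of 0]] by (auto simp: ray_def)
  have diff: "?n - real l *\<^sub>R e i = real (j - l) *\<^sub>R e i" if "l \<le> j" for l
    using that by (simp add: of_nat_diff scaleR_diff_left)
  have "{m\<in>ncone e. ?n - m \<in> ncone e} = (\<lambda>l. real l *\<^sub>R e i) ` {..j}"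
  proof (intro equalityI subsetI)
    fix m assume "m \<in> {m\<in>ncone e. ?n - m \<in> ncone e}"
    then show "m \<in> (\<lambda>l. real l *\<^sub>R e i) ` {..j}" using ray_decomp[OF assms(1), of m j] by blast
  next
    fix m assume "m \<in> (\<lambda>l. real l *\<^sub>R e i) ` {..j}"
    then obtain l where "l \<le> j" "m = real l *\<^sub>R e i" by auto
    then show "m \<in> {m\<in>ncone e. ?n - m \<in> ncone e}" using mem[of l] mem[of "j - l"] diff[of l] by (simp only: mem_Collect_eq)
  qed
  then have "(f \<star> g) ?n = (\<Sum>m\<in>(\<lambda>l. real l *\<^sub>R e i) ` {..j}. exp (\<omega> m ?n) * f m * g (?n - m))"
    by (simp only: conv_eq[OF graded_cone assms(2,3)])
  also have "\<dots> = (\<Sum>l\<le>j. f (real l *\<^sub>R e i) * g (?n - real l *\<^sub>R e i))"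
    by (subst sum.reindex) (use e_nonzero[OF assms(1)] in \<open>auto simp: inj_on_def\<close>)
  also have "\<dots> = (\<Sum>l\<le>j. f (real l *\<^sub>R e i) * g (real (j - l) *\<^sub>R e i))"
    by (intro sum.cong) (auto simp: diff)
  finally show ?thesis .
qed

lemma conv_ray_left:
  assumes "i \<in> U" "f \<in> ser (ncone e)" "g \<in> unip (ncone e)" "\<And>l. l > 0 \<Longrightarrow> g (real l *\<^sub>R e i) = 0"
  shows "(f \<star> g) (real j *\<^sub>R e i) = f (real j *\<^sub>R e i)"
proof -
  have "(f \<star> g) (real j *\<^sub>R e i) = (\<Sum>l\<le>j. if l = j then f (real j *\<^sub>R e i) else 0)"
    unfolding conv_ray[OF assms(1,2) unip_ser[OF assms(3)]]
    using assms(4) unip_0[OF assms(3)] by (intro sum.cong) (auto simp del: of_nat_diff)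
  then show ?thesis by simp
qed

lemma conv_ray_right:
  assumes "i \<in> U" "f \<in> unip (ncone e)" "g \<in> ser (ncone e)" "\<And>l. l > 0 \<Longrightarrow> f (real l *\<^sub>R e i) = 0"
  shows "(f \<star> g) (real j *\<^sub>R e i) = g (real j *\<^sub>R e i)"
proof -
  have "(f \<star> g) (real j *\<^sub>R e i) = (\<Sum>l\<le>j. if l = 0 then g (real j *\<^sub>R e i) else 0)"
    unfolding conv_ray[OF assms(1) unip_ser[OF assms(2)] assms(3)]
    using assms(4) unip_0[OF assms(2)] by (intro sum.cong) auto
  then show ?thesis by simp
qed

lemma dilog_unip: "i \<in> U \<Longrightarrow> dilog p (e i) \<in> unip (ray (e i))"
  using dilog_at[OF e_nonzero, of i p 0] dilog_out[of _ "e i" p]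
  by (auto simp: unip_def ser_def ray_def)

text \<open>The coefficients are determined by height. On the rays they are prescribed; elsewhere
  the trace at \<open>n\<close> is an affine function of the coefficient at \<open>n\<close> with
  slope \<open>deg n \<noteq> 0\<close>, so one value makes it vanish.\<close>

lemma cluster_element_exists: "\<exists>g. cluster_element e g"
proof -
  let ?P = "ncone e"
  note P = graded_cone
  define nm where "nm x m = (if m = 0 then 1 else if m \<in> ?P then x m else (0::real))" for x m
  have nm: "nm x \<in> unip ?P" for x using cone_0 by (auto simp: unip_def ser_def nm_def)
  define good where "good x n y \<longleftrightarrow> (\<exists>p z m zi. factors ?P (\<omega> n) x p z m \<and> zi \<in> unip (zero_part ?P (\<omega> n)) \<and>
     z \<star> zi = one \<and> zi \<star> z = one \<and> y = (zi \<star> euler deg z) n)" for x n y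
  have ex: "\<exists>y. good x n y" if "x \<in> unip ?P" for x n
  proof -
    obtain p z m where f: "factors ?P (\<omega> n) x p z m"
      using factors_exist[OF P linear_form \<open>x \<in> unip ?P\<close>, of n] by blast
    then have "z \<in> unip (zero_part ?P (\<omega> n))" by (simp add: factors_def)
    from inverse_exists[OF graded_parts(2)[OF P linear_form] this] f show ?thesis
      unfolding good_def by blast
  qed
  define \<Lambda> where "\<Lambda> x n = (SOME y. good x n y)" for x n
  have \<Lambda>: "good x n (\<Lambda> x n)" if "x \<in> unip ?P" for x n
    unfolding \<Lambda>_def using someI_ex[OF ex[OF that]] .
  have diff: "\<Lambda> x n - \<Lambda> y n = deg n * (x n - y n)"
    if xy: "x \<in> unip ?P" "y \<in> unip ?P" and n: "n \<in> ?P" "n \<noteq> 0"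
      and ag: "\<And>m. m \<in> ?P \<Longrightarrow> ht m < ht n \<Longrightarrow> x m = y m" for x y n
  proof -
    obtain p z m zi where x: "factors ?P (\<omega> n) x p z m" "zi \<in> unip (zero_part ?P (\<omega> n))"
        "z \<star> zi = one" "\<Lambda> x n = (zi \<star> euler deg z) n"
      using \<Lambda>[OF xy(1), of n] unfolding good_def by blast
    obtain p' z' m' zi' where y: "factors ?P (\<omega> n) y p' z' m'" "zi' \<in> unip (zero_part ?P (\<omega> n))"
        "z' \<star> zi' = one" "\<Lambda> y n = (zi' \<star> euler deg z') n"
      using \<Lambda>[OF xy(2), of n] unfolding good_def by blast
    have lower: "p l = p' l \<and> z l = z' l \<and> m l = m' l" if "l \<in> ?P" "ht l < ht n" for l
      by (rule factors_agree[OF P x(1) y(1), where N = "ht n"]) (use ag that in auto)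
    have "x n - y n = (p n - p' n) + (z n - z' n) + (m n - m' n)"
      by (rule factors_diff[OF P x(1) y(1)]) (use lower n in auto)
    \<comment> \<open>As \<open>\<omega> n n = 0\<close>, the degree \<open>n\<close> belongs to the
      zero part for \<open>\<omega> n\<close>, and a change at \<open>n\<close> affects the middle
      factor only.\<close>
    then have zn: "x n - y n = z n - z' n"
      using factors_single[OF x(1) n(2)] factors_single[OF y(1) n(2)] by simp
    have zs: "z \<in> unip ?P" "z' \<in> unip ?P" using factors_unip[OF x(1)] factors_unip[OF y(1)] by auto
    have zis: "zi \<in> unip ?P" "zi' \<in> unip ?P" using x(2) y(2) unip_mono[OF parts_subset(2)] by auto
    note s = zs[THEN unip_ser] zis[THEN unip_ser]
    have zil: "zi l = zi' l" if "l \<in> ?P" "ht l < ht n" for l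
      using that
    proof (induction "ht l" arbitrary: l rule: less_induct)
      case less
      show ?case
      proof (cases "l = 0")
        case False
        have "(z \<star> zi) l - (z' \<star> zi') l = z 0 * (zi l - zi' l) + (z l - z' l) * zi 0"
          by (rule conv_diff[OF P]) (use s less lower False in auto)
        then show ?thesis using x(3) y(3) lower less zs by (simp add: unip_0)
      qed (simp add: zis[THEN unip_0])
    qed
    have "(zi \<star> euler deg z) n - (zi' \<star> euler deg z') n
      = zi 0 * (euler deg z n - euler deg z' n) + (zi n - zi' n) * euler deg z 0"
      by (rule conv_diff[OF P]) (use s n lower zil in \<open>auto intro!: euler_ser simp: euler_def\<close>)
    also have "\<dots> = deg n * (z n - z' n)"
      using zis linear_0[OF linear_deg] by (simp add: euler_def unip_0 algebra_simps)
    finally show ?thesis using x(4) y(4) zn by simp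
  qed
  have degn: "deg n \<noteq> 0" if "n \<in> ?P" "n \<noteq> 0" for n using deg_zero that by blast
  define spec where "spec n \<longleftrightarrow> (\<exists>i\<in>U. n \<in> ray (e i))" for n
  define val where "val n = (\<Sum>i\<in>U. dilog (par i) (e i) n)" for n
  \<comment> \<open>Dividing by the slope of \<Lambda> makes the last case independent of
    \<open>x n\<close>, and its fixed points are the zeros of \<Lambda>.\<close>
  define \<Phi> where "\<Phi> x n = (if n = 0 then 1 else if n \<notin> ?P then 0 else if spec n then val n
      else x n - \<Lambda> (nm x) n / deg n)" for x n
  have "\<exists>x. \<Phi> x = x"
  proof (rule graded_fixpoint[where ht = ht])
    fix x y n assume ag: "\<And>m. ht m < ht n \<Longrightarrow> x m = (y m :: real)"
    show "\<Phi> x n = \<Phi> y n"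
    proof (cases "n = 0 \<or> n \<notin> ?P")
      case False
      have "\<Lambda> (nm x) n - \<Lambda> (nm y) n = deg n * (nm x n - nm y n)"
        by (rule diff) (use nm False ag in \<open>auto simp: nm_def\<close>)
      also have "\<dots> = deg n * (x n - y n)" using False by (simp add: nm_def)
      finally have "(\<Lambda> (nm x) n - \<Lambda> (nm y) n) / deg n = x n - y n" using degn[of n] False by simp
      then show ?thesis using False by (simp add: \<Phi>_def diff_divide_distrib)
    qed (auto simp: \<Phi>_def)
  qed
  then obtain g where g: "\<Phi> g = g" by blast
  have gn: "nm g = g"
  proof
    fix n show "nm g n = g n" using fun_cong[OF g, of n] by (auto simp: \<Phi>_def nm_def split: if_splits)
  qed
  then have gu: "g \<in> unip ?P" using nm[of g] by simp
  have "g (real j *\<^sub>R e i) = qdilog (par i) j" if i: "i \<in> U" for i j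
  proof (cases "j = 0")
    case False
    let ?n = "real j *\<^sub>R e i"
    have sp: "?n \<noteq> 0" "?n \<in> ?P" "spec ?n"
      using False e_nonzero[OF i] i ray_part(2)[OF graded_cone cone_e[OF i] linear_form[of 0]]
      by (auto simp: spec_def ray_def)
    have "dilog (par r) (e r) ?n = (if r = i then qdilog (par i) j else 0)" if r: "r \<in> U" for r
    proof (cases "r = i")
      case True
      then show ?thesis using dilog_at[OF e_nonzero[OF i]] by simp
    next
      case ri: False
      have "?n \<noteq> real l *\<^sub>R e r" for l
      proof
        assume "?n = real l *\<^sub>R e r"
        then have "co i ?n = co i (real l *\<^sub>R e r)" by simp
        then show False using i r ri False by (simp add: co_simps co_e)
      qed
      then show ?thesis using dilog_out ri by metis
    qed
    then have "val ?n = (\<Sum>r\<in>U. if r = i then qdilog (par i) j else 0)"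
      unfolding val_def by (intro sum.cong) auto
    then have "val ?n = qdilog (par i) j" using i finU by simp
    then show ?thesis using fun_cong[OF g, of ?n] sp by (simp add: \<Phi>_def)
  qed (simp add: unip_0[OF gu])
  moreover have "incoming ?P g n" if n: "n \<in> ?P" "\<forall>i\<in>U. n \<notin> ray (e i)" and n0: "n \<noteq> 0" for n
  proof -
    have "\<Lambda> g n = 0" using fun_cong[OF g, of n] n n0 degn[of n] gn by (simp add: \<Phi>_def spec_def)
    then show ?thesis
      using \<Lambda>[OF gu, of n] degn[OF n(1) n0] linear_deg unfolding good_def incoming_def traceless_def
      by metis
  qed
  ultimately show ?thesis using gu unfolding cluster_element_def by blast
qed

end

section \<open>Mutation of cluster elements\<close>

lemma Ints_max_0: "x \<in> \<int> \<Longrightarrow> max 0 x \<in> \<int>" for x :: real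
  by (simp add: max_def)

locale cluster_mutation = cluster_basis \<omega> U D e co
  for \<omega> :: "'v::real_vector \<Rightarrow> 'v \<Rightarrow> real" and U :: "'i set" and D e co +
  fixes k :: 'i and g :: "'v \<Rightarrow> real"
  assumes kU: "k \<in> U" and int: "integral_family e" and g: "cluster_element e g"
begin

abbreviation N :: "'v set" where "N \<equiv> ncone e"

definition eps :: "'i \<Rightarrow> real" where "eps i = real (D k) * \<omega> (e i) (e k)"
definition ell :: "'v \<Rightarrow> real" where "ell n = real (D k) * \<omega> n (e k)"
definition Bp :: "'v \<Rightarrow> real" where "Bp n = (\<Sum>i\<in>U-{k}. max 0 (eps i) * co i n)"
definition Bm :: "'v \<Rightarrow> real" where "Bm n = (\<Sum>i\<in>U-{k}. max 0 (- eps i) * co i n)"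
definition \<kappa> :: "'v \<Rightarrow> real" where "\<kappa> n = (\<Sum>i\<in>U-{k}. co i n)"
text \<open>The passage between the two sign conventions for mutation: for
  \<open>i \<noteq> k\<close> it carries \<open>e i + max 0 (- eps i) *\<^sub>R e k\<close> to
  \<open>e' i\<close>, and it fixes \<open>e k\<close>.\<close>

definition shear :: "'v \<Rightarrow> 'v" where "shear n = n + ell n *\<^sub>R e k"
definition unshear :: "'v \<Rightarrow> 'v" where "unshear n = n - ell n *\<^sub>R e k"
definition e' :: "'i \<Rightarrow> 'v" where
  "e' i = (if i = k then - e k else e i + max 0 (eps i) *\<^sub>R e k)"
abbreviation N' :: "'v set" where "N' \<equiv> ncone e'"

definition co' :: "'i \<Rightarrow> 'v \<Rightarrow> real" where
  "co' i n = (if i = k then Bp n - co k n else co i n)"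
text \<open>\<open>Bp n - co k n\<close> is the coordinate at \<open>k\<close> for the mutated seed,
  so these are the degrees common to both cones. \<open>Q'\<close> plays the same role for the
  mutation of opposite sign, whose cone \<open>shear\<close> carries to \<open>N'\<close>.\<close>

definition Q :: "'v set" where "Q = {n\<in>N. co k n \<le> Bp n}"
definition Q' :: "'v set" where "Q' = {n\<in>N. co k n \<le> Bm n}"

lemma Dk: "real (D k) > 0" using Dpos[OF kU] by simp

lemma eps_Ints: "i \<in> U \<Longrightarrow> eps i \<in> \<int>"
  using int kU by (simp add: eps_def integral_family_def)

lemma linear_maps: "linear ell" "linear Bp" "linear Bm" "linear \<kappa>"
  by (rule linearI; simp add: ell_def Bp_def Bm_def \<kappa>_def co_simps sum.distrib sum_distrib_left algebra_simps)+

lemma Bp_e: "i \<in> U \<Longrightarrow> Bp (e i) = (if i = k then 0 else max 0 (eps i))"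
proof -
  assume i: "i \<in> U"
  have "Bp (e i) = (\<Sum>j\<in>U-{k}. if j = i then max 0 (eps i) else 0)"
    unfolding Bp_def using i by (intro sum.cong) (auto simp: co_e)
  then show ?thesis using i finU by simp
qed

lemma kappa_ek: "\<kappa> (e k) = 0" "Bp (e k) = 0" "Bm (e k) = 0" "ell (e k) = 0"
  using kU by (auto simp: \<kappa>_def Bp_def Bm_def ell_def co_e intro!: sum.neutral)

lemma dual': "dual_family e' co'"
  unfolding dual_family_def
proof (intro conjI ballI)
  fix i assume i: "i \<in> U"
  show "linear (co' i)"
  proof (cases "i = k")
    case True
    have "co' k = (\<lambda>n. Bp n - co k n)" by (auto simp: co'_def)
    then show ?thesis using True linear_compose_sub[OF linear_maps(2) co_linear[OF kU]] by simp
  next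
    case False
    then have "co' i = co i" by (auto simp: co'_def)
    then show ?thesis using co_linear[OF i] by simp
  qed
  fix j assume j: "j \<in> U"
  show "co' i (e' j) = (if i = j then 1 else 0)"
    using i j kU by (auto simp: co'_def e'_def co_simps co_e linear_add[OF linear_maps(2)] linear_neg[OF linear_maps(2)]
        linear_scale[OF linear_maps(2)] Bp_e)
qed

sublocale mut: cluster_basis \<omega> U D e' co'
  by unfold_locales (rule dual')

lemma integral': "integral_family e'"
proof -
  have I: "real (D j) * \<omega> (e i) (e j) \<in> \<int>" if "i \<in> U" "j \<in> U" for i j
    using int that by (simp add: integral_family_def)
  have left: "real (D j) * \<omega> (e' i) (e j) \<in> \<int>" if "i \<in> U" "j \<in> U" for i j
  proof -
    have "real (D j) * \<omega> (e' i) (e j) = (if i = k then - (real (D j) * \<omega> (e k) (e j))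
        else real (D j) * \<omega> (e i) (e j) + max 0 (eps i) * (real (D j) * \<omega> (e k) (e j)))"
      by (simp add: e'_def algebra_simps)
    then show ?thesis using I that kU eps_Ints Ints_max_0 by (simp add: Ints_mult)
  qed
  have "real (D j) * \<omega> (e' i) (e' j) \<in> \<int>" if i: "i \<in> U" and j: "j \<in> U" for i j
  proof (cases "j = k")
    case True
    then show ?thesis using left[OF i kU] by (simp add: e'_def)
  next
    case False
    \<comment> \<open>The correction term contains \<open>D j\<close> and, through
      \<open>eps j\<close>, also \<open>D k\<close>. Taking the positive part of the form itself
      frees \<open>D k\<close> for the other factor, so that both factors are integral.\<close>
    have "real (D j) * max 0 (\<omega> (e j) (e k)) \<in> \<int>"
    proof -
      have "real (D j) * \<omega> (e j) (e k) \<in> \<int>" using I[OF kU j] skew[of "e j" "e k"] by simp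
      then have "max 0 (real (D j) * \<omega> (e j) (e k)) \<in> \<int>" by (rule Ints_max_0)
      then show ?thesis by (simp add: max_mult_distrib_left)
    qed
    moreover have "eps j = real (D k) * \<omega> (e j) (e k)" by (simp add: eps_def)
    then have "max 0 (eps j) = real (D k) * max 0 (\<omega> (e j) (e k))"
      by (simp add: max_mult_distrib_left)
    then have "real (D j) * \<omega> (e' i) (e' j) = real (D j) * \<omega> (e' i) (e j)
        + (real (D j) * max 0 (\<omega> (e j) (e k))) * (real (D k) * \<omega> (e' i) (e k))"
      using False by (simp add: e'_def[of j] algebra_simps)
    ultimately show ?thesis using left[OF i j] left[OF i kU] by (simp add: Ints_mult)
  qed
  then show ?thesis by (simp add: integral_family_def)
qed

lemma sum_remove_k: "(\<Sum>i\<in>U. f i) = f k + (\<Sum>i\<in>U-{k}. f i)" for f :: "'i \<Rightarrow> 'a::comm_monoid_add"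
  using sum.remove[OF finU kU] .

lemma ell_cone:
  assumes "n \<in> N"
  shows "ell n = Bp n - Bm n" "ell n \<in> \<int>"
proof -
  have "ell n = ell (\<Sum>i\<in>U. co i n *\<^sub>R e i)" using cone_expand[OF assms] by simp
  also have "\<dots> = (\<Sum>i\<in>U. co i n * eps i)"
    by (simp add: linear_sum[OF linear_maps(1)] linear_scale[OF linear_maps(1)]) (simp add: ell_def eps_def)
  finally have *: "ell n = (\<Sum>i\<in>U. co i n * eps i)" .
  have "eps k = 0" by (simp add: eps_def)
  then have "ell n = (\<Sum>i\<in>U-{k}. co i n * eps i)" by (simp add: * sum_remove_k)
  also have "\<dots> = Bp n - Bm n"
    unfolding Bp_def Bm_def sum_subtractf[symmetric] by (rule sum.cong) (auto simp: max_def algebra_simps)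
  finally show "ell n = Bp n - Bm n" .
  have "co i n \<in> \<int>" if "i \<in> U" for i using cone_co[OF assms that] Nats_subset_Ints by blast
  then show "ell n \<in> \<int>" unfolding * using eps_Ints by (intro Ints_sum Ints_mult) auto
qed

lemma cone'I:
  assumes n: "n = (\<Sum>i\<in>U. c i *\<^sub>R e i)" and c: "\<And>i. i \<in> U - {k} \<Longrightarrow> c i \<in> \<nat>" "c k \<in> \<int>"
    and b: "c k \<le> (\<Sum>i\<in>U-{k}. max 0 (eps i) * c i)"
  shows "n \<in> N'"
proof -
  have co: "co i n = c i" if "i \<in> U" for i unfolding n by (rule co_sum[OF that])
  have Bn: "Bp n = (\<Sum>i\<in>U-{k}. max 0 (eps i) * c i)"
    unfolding Bp_def by (rule sum.cong) (auto simp: co)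
  have "(\<Sum>i\<in>U. co' i n *\<^sub>R e' i) = co' k n *\<^sub>R e' k + (\<Sum>i\<in>U-{k}. co' i n *\<^sub>R e' i)" by (rule sum_remove_k)
  also have "(\<Sum>i\<in>U-{k}. co' i n *\<^sub>R e' i) = (\<Sum>i\<in>U-{k}. c i *\<^sub>R e i + (max 0 (eps i) * c i) *\<^sub>R e k)"
    by (rule sum.cong) (auto simp: co'_def e'_def co algebra_simps)
  also have "\<dots> = (\<Sum>i\<in>U-{k}. c i *\<^sub>R e i) + Bp n *\<^sub>R e k"
    by (simp add: sum.distrib scaleR_sum_left Bn)
  also have "co' k n *\<^sub>R e' k = (c k - Bp n) *\<^sub>R e k" using kU by (simp add: co'_def e'_def co algebra_simps)
  finally have "(\<Sum>i\<in>U. co' i n *\<^sub>R e' i) = c k *\<^sub>R e k + (\<Sum>i\<in>U-{k}. c i *\<^sub>R e i)" by (simp add: algebra_simps)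
  also have "\<dots> = n" by (simp add: n sum_remove_k)
  finally have "n = (\<Sum>i\<in>U. co' i n *\<^sub>R e' i)" ..
  moreover have "co' i n \<in> \<nat>" if i: "i \<in> U" for i
  proof (cases "i = k")
    case True
    have "Bp n \<in> \<int>" unfolding Bn using c(1) Nats_subset_Ints eps_Ints Ints_max_0
      by (intro Ints_sum Ints_mult) auto
    then have "co' k n \<in> \<int>" using c(2) by (simp add: co'_def co kU)
    moreover have "co' k n \<ge> 0" using b by (simp add: co'_def co kU Bn)
    ultimately show ?thesis using True by (simp add: Nats_altdef2)
  next
    case False
    then show ?thesis using i c(1) by (simp add: co'_def co)
  qed
  ultimately show ?thesis using mut.cone_iff by blast
qed

lemma Q_sub: "Q \<subseteq> N" "Q \<subseteq> N'" "Q' \<subseteq> N"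
proof -
  show "Q \<subseteq> N" "Q' \<subseteq> N" by (auto simp: Q_def Q'_def)
  show "Q \<subseteq> N'"
  proof
    fix n assume n: "n \<in> Q"
    show "n \<in> N'"
      by (rule cone'I[where c = "\<lambda>i. co i n"])
         (use n cone_expand cone_co kU Nats_subset_Ints in \<open>auto simp: Q_def Bp_def\<close>)
  qed
qed

lemma shear_Q': "shear ` Q' \<subseteq> N'"
proof
  fix m assume "m \<in> shear ` Q'"
  then obtain n where n: "n \<in> Q'" and m: "m = shear n" by blast
  have nc: "n \<in> N" using n by (simp add: Q'_def)
  define c where "c i = (if i = k then co k n + ell n else co i n)" for i
  have "(\<Sum>i\<in>U. c i *\<^sub>R e i) = (co k n + ell n) *\<^sub>R e k + (\<Sum>i\<in>U-{k}. co i n *\<^sub>R e i)"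
    by (simp add: sum_remove_k c_def)
  also have "\<dots> = shear n"
  proof -
    have "n = co k n *\<^sub>R e k + (\<Sum>i\<in>U-{k}. co i n *\<^sub>R e i)"
      by (rule trans[OF cone_expand[OF nc] sum_remove_k])
    then have S: "(\<Sum>i\<in>U-{k}. co i n *\<^sub>R e i) = n - co k n *\<^sub>R e k" by (metis add_diff_cancel_left')
    show ?thesis unfolding S by (simp add: shear_def algebra_simps)
  qed
  finally have me: "m = (\<Sum>i\<in>U. c i *\<^sub>R e i)" using m by simp
  have "(\<Sum>i\<in>U-{k}. max 0 (eps i) * c i) = Bp n" unfolding Bp_def by (rule sum.cong) (auto simp: c_def)
  then have b: "c k \<le> (\<Sum>i\<in>U-{k}. max 0 (eps i) * c i)"
    using n ell_cone(1)[OF nc] by (simp add: c_def Q'_def)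
  have "c k \<in> \<int>" using cone_co[OF nc kU] ell_cone(2)[OF nc] Nats_subset_Ints by (auto simp: c_def)
  then show "m \<in> N'" using cone'I[OF me _ _ b] cone_co[OF nc] by (auto simp: c_def)
qed

lemma unshear_shear [simp]: "unshear (shear n) = n" "shear (unshear n) = n"
  by (simp_all add: shear_def unshear_def ell_def)

lemma linear_shear: "linear shear" "linear unshear"
  by (rule linearI; simp add: shear_def unshear_def linear_add[OF linear_maps(1)] linear_scale[OF linear_maps(1)] algebra_simps)+

text \<open>\<open>shear\<close> is a transvection along \<open>e k\<close> built from \<omega>
  itself, and such maps preserve the alternating form.\<close>

lemma form_shear: "\<omega> (shear m) (shear n) = \<omega> m n" "\<omega> (unshear m) (unshear n) = \<omega> m n"
  using skew[of "e k"] by (simp_all add: shear_def unshear_def ell_def algebra_simps)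

lemma graded_Q: "graded Q ht" "graded Q' ht" "graded (shear ` Q') mut.ht"
proof -
  show "graded Q ht"
    by (rule graded_subset[OF graded_cone])
       (auto simp: Q_def cone_0 cone_add co_simps kU linear_add[OF linear_maps(2)] linear_0[OF linear_maps(2)])
  show gQ': "graded Q' ht"
    by (rule graded_subset[OF graded_cone])
       (auto simp: Q'_def cone_0 cone_add co_simps kU linear_add[OF linear_maps(3)] linear_0[OF linear_maps(3)])
  show "graded (shear ` Q') mut.ht"
  proof (rule graded_subset[OF mut.graded_cone shear_Q'])
    show "0 \<in> shear ` Q'" using gradedD(1)[OF gQ'] linear_0[OF linear_shear(1)] by force
    show "m + n \<in> shear ` Q'" if "m \<in> shear ` Q'" "n \<in> shear ` Q'" for m n
      using that gradedD(3)[OF gQ'] by (auto simp: linear_add[OF linear_shear(1), symmetric])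
  qed
qed

definition E :: "'v \<Rightarrow> real" where "E = dilog (par k) (e k)"
definition E' :: "'v \<Rightarrow> real" where "E' = dilog (par k) (- e k)"

lemma ek_cone: "e k \<in> N" "- e k \<in> N'"
  using cone_e[OF kU] mut.cone_e[OF kU] by (auto simp: e'_def)

lemma E_unip: "E \<in> unip (ray (e k))" "E' \<in> unip (ray (- e k))"
  using dilog_unip[OF kU] mut.dilog_unip[OF kU] by (auto simp: E_def E'_def e'_def)

lemma ray_cone: "ray (e k) \<subseteq> N" "ray (- e k) \<subseteq> N'"
  "graded (ray (e k)) ht" "graded (ray (- e k)) mut.ht"
  using ray_part(1,2)[OF graded_cone ek_cone(1) linear_form[of 0]]
    ray_part(1,2)[OF mut.graded_cone ek_cone(2) linear_form[of 0]] by auto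

definition Ei :: "'v \<Rightarrow> real" where
  "Ei = (SOME f. f \<in> unip (ray (e k)) \<and> E \<star> f = one \<and> f \<star> E = one)"
definition Ei' :: "'v \<Rightarrow> real" where
  "Ei' = (SOME f. f \<in> unip (ray (- e k)) \<and> E' \<star> f = one \<and> f \<star> E' = one)"

lemma Ei: "Ei \<in> unip (ray (e k))" "E \<star> Ei = one" "Ei \<star> E = one"
  and Ei': "Ei' \<in> unip (ray (- e k))" "E' \<star> Ei' = one" "Ei' \<star> E' = one"
  using someI_ex[OF inverse_exists[OF ray_cone(3) E_unip(1), unfolded Bex_def], folded Ei_def]
    someI_ex[OF inverse_exists[OF ray_cone(4) E_unip(2), unfolded Bex_def], folded Ei'_def] by auto

definition h :: "'v \<Rightarrow> real" where "h = g \<star> Ei"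
definition h' :: "'v \<Rightarrow> real" where "h' = Ei \<star> g"

lemma gD: "g \<in> unip N" "i \<in> U \<Longrightarrow> g (real j *\<^sub>R e i) = qdilog (par i) j"
  "n \<in> N \<Longrightarrow> n \<noteq> 0 \<Longrightarrow> (\<And>i. i \<in> U \<Longrightarrow> n \<notin> ray (e i)) \<Longrightarrow> incoming N g n"
  using g by (auto simp: cluster_element_def)

lemma EC: "E \<in> unip N" "Ei \<in> unip N" "E' \<in> unip N'" "Ei' \<in> unip N'"
  using unip_mono[OF ray_cone(1)] unip_mono[OF ray_cone(2)] E_unip Ei Ei' by auto

lemma hC: "h \<in> unip N" "h' \<in> unip N"
  using conv_unip[OF graded_cone] gD(1) EC by (auto simp: h_def h'_def)

lemma g_eq: "g = h \<star> E" "g = E \<star> h'"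
  using conv_assoc[OF graded_cone, of g Ei E] conv_assoc[OF graded_cone, of E Ei g] gD(1) EC Ei
  by (auto simp: h_def h'_def unip_ser)

lemma E_ray: "E (real j *\<^sub>R e k) = qdilog (par k) j"
  unfolding E_def by (rule dilog_at[OF e_nonzero[OF kU]])

text \<open>Products along the extremal ray of \<open>e k\<close> involve only the values on it, and
  there \<open>g\<close> and \<open>E\<close> agree.\<close>

lemma h_ray: "j > 0 \<Longrightarrow> h (real j *\<^sub>R e k) = 0" and h'_ray: "j > 0 \<Longrightarrow> h' (real j *\<^sub>R e k) = 0"
proof -
  note C = gD(1)[THEN unip_ser] EC(1,2)[THEN unip_ser]
  assume "j > 0"
  then have "one (real j *\<^sub>R e k) = 0" using e_nonzero[OF kU] by (simp add: one_def)
  moreover have "h (real j *\<^sub>R e k) = (E \<star> Ei) (real j *\<^sub>R e k)" "h' (real j *\<^sub>R e k) = (Ei \<star> E) (real j *\<^sub>R e k)"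
    unfolding h_def h'_def by (simp_all only: conv_ray[OF kU] C gD(2)[OF kU] E_ray)
  ultimately show "h (real j *\<^sub>R e k) = 0" "h' (real j *\<^sub>R e k) = 0" by (simp_all add: Ei)
qed

text \<open>By \<open>kappa_zero\<close> only nonzero multiples of \<open>e k\<close> are removed
  from the cone. On the rest \<kappa> is positive away from 0 and carries the induction.\<close>

definition R :: "'v set" where "R = {n\<in>N. \<kappa> n = 0 \<longrightarrow> n = 0}"

lemma kappa_Nats: "n \<in> N \<Longrightarrow> \<kappa> n \<in> \<nat>"
  unfolding \<kappa>_def by (rule sum_in_Nats) (simp add: cone_co)

lemma kappa_zero: "n \<in> N \<Longrightarrow> \<kappa> n = 0 \<Longrightarrow> n \<in> ray (e k)"
proof -
  assume n: "n \<in> N" "\<kappa> n = 0"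
  then have "\<forall>i\<in>U-{k}. co i n = 0"
    using sum_nonneg_eq_0_iff[of "U-{k}" "\<lambda>i. co i n"] finU cone_co_nonneg unfolding \<kappa>_def by simp
  then have "n = co k n *\<^sub>R e k"
    using cone_expand[OF n(1)] by (simp add: sum_remove_k)
  then show ?thesis using cone_co[OF n(1) kU] by (auto simp: ray_def elim: Nats_cases)
qed

lemma h_R: "h \<in> unip R" "h' \<in> unip R"
proof -
  have "f \<in> unip R" if f: "f \<in> unip N" "\<And>j. j > 0 \<Longrightarrow> f (real j *\<^sub>R e k) = 0" for f
  proof -
    have "f n = 0" if "n \<notin> R" for n
    proof (cases "n \<in> N")
      case True
      then have "\<kappa> n = 0" "n \<noteq> 0" using that by (auto simp: R_def)
      then obtain j where "n = real j *\<^sub>R e k" "j > 0" using kappa_zero[OF True] by (auto simp: ray_def)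
      then show ?thesis using f(2) by simp
    qed (rule unip_out[OF f(1)])
    then show ?thesis using f(1) by (simp add: unip_def ser_def)
  qed
  then show "h \<in> unip R" "h' \<in> unip R" using hC h_ray h'_ray by auto
qed

text \<open>
  By induction on the degree modulo \<open>e k\<close> the series \<open>f\<close> is supported on a monoid in which \<open>n\<close> is
  indecomposable, so its coefficient at \<open>n\<close> is the logarithmic one.
\<close>

lemma vanish:
  assumes f: "f \<in> unip R" and K: "0 \<in> K" "\<And>m n. m \<in> K \<Longrightarrow> n \<in> K \<Longrightarrow> m + n \<in> K"
    and IH: "\<And>m. \<kappa> m < \<kappa> n \<Longrightarrow> f m \<noteq> 0 \<Longrightarrow> m \<in> K"
    and n: "n \<notin> K"
    and tr: "\<And>p z m. factors N (\<omega> n) f p z m \<Longrightarrow> traceless N n z"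
  shows "f n = 0"
proof -
  define P' where "P' = {m\<in>R. \<kappa> m < \<kappa> n \<longrightarrow> m \<in> K}"
  have n0: "n \<noteq> 0" using n K by auto
  have k0: "\<kappa> m \<ge> 0" if "m \<in> R" for m using kappa_Nats that by (force simp: R_def elim: Nats_cases)
  have k1: "\<kappa> m > 0" if "m \<in> R" "m \<noteq> 0" for m using k0[OF that(1)] that by (auto simp: R_def)
  note kadd = linear_add[OF linear_maps(4)]
  have sub: "P' \<subseteq> N" by (auto simp: P'_def R_def)
  have P': "graded P' ht"
  proof (rule graded_subset[OF graded_cone sub])
    show "0 \<in> P'" using cone_0 K by (auto simp: P'_def R_def)
    show "a + b \<in> P'" if "a \<in> P'" "b \<in> P'" for a b
    proof -
      have ab: "a \<in> R" "b \<in> R" using that by (auto simp: P'_def)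
      have "a + b \<in> R"
        using ab cone_add k0[OF ab(1)] k0[OF ab(2)] by (auto simp: R_def kadd)
      moreover have "a + b \<in> K" if "\<kappa> (a + b) < \<kappa> n"
        using that \<open>a \<in> P'\<close> \<open>b \<in> P'\<close> k0[OF ab(1)] k0[OF ab(2)] K by (auto simp: P'_def kadd)
      ultimately show ?thesis by (simp add: P'_def)
    qed
  qed
  have fP: "f \<in> unip P'"
  proof -
    have "f m = 0" if "m \<notin> P'" for m
    proof (cases "m \<in> R")
      case True
      then show ?thesis using that IH[of m] by (auto simp: P'_def)
    qed (rule unip_out[OF f])
    then show ?thesis using f by (simp add: unip_def ser_def)
  qed
  have indec: "m = 0 \<or> m = n" if "m \<in> P'" "n - m \<in> P'" for m
  proof (rule ccontr)
    assume c: "\<not> (m = 0 \<or> m = n)"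
    have R: "m \<in> R" "n - m \<in> R" using that by (auto simp: P'_def)
    have "\<kappa> n = \<kappa> m + \<kappa> (n - m)" by (simp add: kadd[symmetric])
    then have "\<kappa> m < \<kappa> n" "\<kappa> (n - m) < \<kappa> n" using k1[OF R(1)] k1[OF R(2)] c by auto
    then have "m + (n - m) \<in> K" using that K unfolding P'_def by blast
    then show False using n by simp
  qed
  obtain p z m where fac: "factors P' (\<omega> n) f p z m" using factors_exist[OF P' linear_form fP] by blast
  note u = factors_unip[OF fac]
  note s = u[THEN unip_ser] and u0 = u[THEN unip_0]
  have fn: "f n = z n"
  proof -
    have "f n = (p \<star> z) 0 * m n + (p \<star> z) n * m 0"
      using fac conv_indecomposable[OF P' conv_ser[OF P' s(1,2)] s(3) n0 indec] by (simp add: factors_def)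
    also have "\<dots> = z n"
      using conv_indecomposable[OF P' s(1,2) n0 indec] conv_at_0[OF P' s(1,2)] u0 factors_single[OF fac n0] by simp
    finally show ?thesis .
  qed
  have zz: "z \<in> unip (zero_part P' (\<omega> n))" using fac by (simp add: factors_def)
  \<comment> \<open>The condition is known in \<open>N\<close> but evaluated in \<open>P'\<close>,
    where \<open>n\<close> is indecomposable and the trace reduces to the coefficient of
    \<open>z\<close>.\<close>
  have "traceless P' n z"
    using tr[OF factors_mono[OF sub fac]] traceless_mono[OF graded_cone P' sub zz] by simp
  then obtain zi \<delta> where zi: "zi \<in> unip (zero_part P' (\<omega> n))" "linear \<delta>" "\<delta> n \<noteq> 0" "(zi \<star> euler \<delta> z) n = 0"
    unfolding traceless_def by blast
  have "zi \<in> unip P'" using zi(1) unip_mono[OF parts_subset(2)] by blast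
  then have "(zi \<star> euler \<delta> z) n = zi 0 * euler \<delta> z n + zi n * euler \<delta> z 0"
    by (intro conv_indecomposable[OF P' _ _ n0 indec]) (auto intro: unip_ser euler_ser s)
  then show ?thesis
    using zi fn linear_0[OF zi(2)] unip_0[OF \<open>zi \<in> unip P'\<close>] by (simp add: euler_def)
qed

end

context cluster_basis
begin

text \<open>With \<open>\<theta> (e i) = 0\<close> the coefficient at the extremal degree
  \<open>e i\<close> can come from the middle factor only, and it is the nonzero first coefficient
  of the dilogarithm.\<close>

lemma not_splits:
  assumes g: "cluster_element e g" and i: "i \<in> U" and \<theta>: "\<theta> (e i) = 0"
  shows "\<not> splits (ncone e) \<theta> g"
proof
  assume "splits (ncone e) \<theta> g"
  then obtain p m where f: "factors (ncone e) \<theta> g p one m" by (auto simp: splits_def)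
  note u = factors_unip[OF f]
  have "g (real 1 *\<^sub>R e i) = (\<Sum>l\<le>1. p (real l *\<^sub>R e i) * m (real (1 - l) *\<^sub>R e i))"
    using conv_ray[OF i unip_ser[OF u(1)] unip_ser[OF u(3)], of 1] f by (simp add: factors_def)
  also have "\<dots> = p 0 * m (e i) + p (e i) * m 0" by (simp add: numeral_eq_Suc)
  finally have "g (real 1 *\<^sub>R e i) = 0" using factors_single[OF f e_nonzero[OF i]] \<theta> by simp
  moreover have "g (real 1 *\<^sub>R e i) = qdilog (par i) 1" using g i unfolding cluster_element_def by blast
  ultimately have "qdilog (par i) 1 = 0" by (simp only:)
  then show False using qdilog_nonzero[OF par_gt_1[OF i]] by blast
qed

text \<open>All nonzero degrees of the cone are positive for \<theta>, so \<open>g\<close> is its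
  own positive factor.\<close>

lemma splits_pos:
  assumes g: "cluster_element e g" and \<theta>: "linear \<theta>" "\<And>i. i \<in> U \<Longrightarrow> \<theta> (e i) > 0"
  shows "splits (ncone e) \<theta> g"
proof -
  have gu: "g \<in> unip (ncone e)" using g by (simp add: cluster_element_def)
  have pos: "\<theta> n > 0" if n: "n \<in> ncone e" "n \<noteq> 0" for n
  proof -
    have "\<theta> n = \<theta> (\<Sum>i\<in>U. co i n *\<^sub>R e i)" using cone_expand[OF n(1)] by simp
    also have "\<dots> = (\<Sum>i\<in>U. co i n * \<theta> (e i))"
      by (simp add: linear_sum[OF \<theta>(1)] linear_scale[OF \<theta>(1)])
    finally have eq: "\<theta> n = (\<Sum>i\<in>U. co i n * \<theta> (e i))" .
    have "\<exists>i\<in>U. co i n \<noteq> 0" using cone_expand[OF n(1)] n(2) by (metis (no_types, lifting) scale_zero_left sum.neutral)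
    then obtain i where i: "i \<in> U" "co i n \<noteq> 0" by blast
    then have "co i n * \<theta> (e i) > 0" using cone_co_nonneg[OF n(1) i(1)] \<theta>(2) by simp
    moreover have "\<forall>j\<in>U. co j n * \<theta> (e j) \<ge> 0"
      using cone_co_nonneg[OF n(1)] \<theta>(2) by (simp add: less_imp_le)
    ultimately show ?thesis unfolding eq using i finU by (intro sum_pos2[of _ i]) auto
  qed
  have "g \<in> unip (pos_part (ncone e) \<theta>)"
    unfolding unip_parts_supp using gu pos unip_out[OF gu] by blast
  moreover have "one \<in> unip (zero_part (ncone e) \<theta>)" "one \<in> unip (neg_part (ncone e) \<theta>)"
    by (rule one_unip, simp add: parts_def cone_0 linear_0[OF \<theta>(1)])+
  ultimately have "factors (ncone e) \<theta> g g one one" by (simp add: factors_def)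
  then show ?thesis by (auto simp: splits_def)
qed

end

section \<open>Support bounds along lines in direction \<open>e k\<close>\<close>

context cluster_mutation
begin

lemma par_powr: "ell n = of_int l \<Longrightarrow> par k powr (of_int l / 2) = exp (\<omega> n (e k))"
  "ell n = of_int l \<Longrightarrow> par k powr (- of_int l / 2) = exp (- \<omega> n (e k))"
  using Dk by (auto simp: par_def powr_def ell_def field_simps)

text \<open>This is \<open>h \<star> E = E \<star> h'\<close> read on one line in direction
  \<open>e k\<close>.\<close>

lemma ray_mutual:
  assumes "ell n = of_int l"
  shows "qdilog_act (par k) (par k powr (of_int l / 2)) (\<lambda>b. h (n + of_int b *\<^sub>R e k))
    = qdilog_act (par k) (par k powr (- of_int l / 2)) (\<lambda>b. h' (n + of_int b *\<^sub>R e k))"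
  unfolding par_powr[OF assms]
  by (rule ext, subst conv_dilog[symmetric, OF e_nonzero[OF kU] par_gt_1[OF kU]],
      subst dilog_conv[symmetric, OF e_nonzero[OF kU] par_gt_1[OF kU]])
     (simp add: g_eq(1)[unfolded E_def, symmetric] g_eq(2)[unfolded E_def, symmetric])

lemma bounded_below_cone:
  assumes "f \<in> unip N"
  shows "bounded_below (\<lambda>b. f (n + of_int b *\<^sub>R e k))"
  unfolding bounded_below_def
proof (intro exI[of _ "\<lfloor>- co k n\<rfloor>"] allI impI)
  fix b assume "b < \<lfloor>- co k n\<rfloor>"
  then have "of_int b < - co k n" by linarith
  then have "co k (n + of_int b *\<^sub>R e k) < 0" using kU by (simp add: co_simps co_e)
  then have "n + of_int b *\<^sub>R e k \<notin> N" using cone_co_nonneg kU by force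
  then show "f (n + of_int b *\<^sub>R e k) = 0" by (rule unip_out[OF assms])
qed

lemma ray_Q: "i \<in> U \<Longrightarrow> i \<noteq> k \<Longrightarrow> n \<in> ray (e i) \<Longrightarrow> n \<in> Q \<and> n \<in> Q'"
proof -
  assume i: "i \<in> U" "i \<noteq> k" "n \<in> ray (e i)"
  then obtain j where j: "n = real j *\<^sub>R e i" by (auto simp: ray_def)
  have n: "n \<in> N" using i(3) ray_part(2)[OF graded_cone cone_e[OF i(1)] linear_form[of 0]] by blast
  have "co k n = 0" using j i kU by (simp add: co_simps co_e)
  moreover have "Bp n \<ge> 0" "Bm n \<ge> 0"
    unfolding Bp_def Bm_def using cone_co_nonneg[OF n] by (auto intro!: sum_nonneg)
  ultimately show ?thesis using n by (simp add: Q_def Q'_def)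
qed

text \<open>The sign of \<open>\<omega> n (e k)\<close> decides at which end of \<open>g\<close> the
  dilogarithm can be split off without affecting the trace at \<open>n\<close>.\<close>

lemma ray_incoming:
  assumes "n \<in> N" "n \<noteq> 0" "\<And>i. i \<in> U \<Longrightarrow> n \<notin> ray (e i)"
  shows "\<omega> n (e k) \<le> 0 \<Longrightarrow> factors N (\<omega> n) h p z m \<Longrightarrow> traceless N n z"
    "\<omega> n (e k) \<ge> 0 \<Longrightarrow> factors N (\<omega> n) h' p z m \<Longrightarrow> traceless N n z"
proof -
  assume "\<omega> n (e k) \<le> 0" "factors N (\<omega> n) h p z m"
  then have "incoming N (h \<star> E) n \<longleftrightarrow> traceless N n z"
    by (rule incoming_right[OF graded_cone ek_cone(1) _ assms(3)[OF kU] E_unip(1) Ei])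
  then show "traceless N n z" using gD(3)[OF assms] by (simp only: g_eq(1)[symmetric])
next
  assume "\<omega> n (e k) \<ge> 0" "factors N (\<omega> n) h' p z m"
  then have "incoming N (E \<star> h') n \<longleftrightarrow> traceless N n z"
    by (rule incoming_left[OF graded_cone ek_cone(1) _ assms(3)[OF kU] E_unip(1) Ei])
  then show "traceless N n z" using gD(3)[OF assms] by (simp only: g_eq(2)[symmetric])
qed

lemma Q_monoid: "0 \<in> Q" "m \<in> Q \<Longrightarrow> n \<in> Q \<Longrightarrow> m + n \<in> Q" "0 \<in> Q'" "m \<in> Q' \<Longrightarrow> n \<in> Q' \<Longrightarrow> m + n \<in> Q'"
  using gradedD(1,3)[OF graded_Q(1)] gradedD(1,3)[OF graded_Q(2)] by auto

text \<open>
  The incoming condition bounds \<open>h\<close> if \<open>ell n \<le> 0\<close> and \<open>h'\<close> if \<open>ell n \<ge> 0\<close>. In each case the other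
  series arises by multiplication with a polynomial in \<open>e k\<close> of degree \<open>\<bar>ell n\<bar>\<close>.
\<close>

lemma bounds: "(h n \<noteq> 0 \<longrightarrow> n \<in> Q) \<and> (h' n \<noteq> 0 \<longrightarrow> n \<in> Q')"
proof (induction "nat \<lfloor>\<kappa> n\<rfloor>" arbitrary: n rule: less_induct)
  case less
  show ?case
  proof (cases "n \<in> N")
    case False
    then show ?thesis using hC by (simp add: unip_out)
  next
    case nc: True
    have IH: "(h m \<noteq> 0 \<longrightarrow> m \<in> Q) \<and> (h' m \<noteq> 0 \<longrightarrow> m \<in> Q')" if "\<kappa> m < \<kappa> n" for m
    proof (cases "m \<in> N")
      case False
      then show ?thesis using hC by (simp add: unip_out)
    next
      case True
      have "real (nat \<lfloor>\<kappa> m\<rfloor>) < real (nat \<lfloor>\<kappa> n\<rfloor>)"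
        using Nats_real_floor[OF kappa_Nats[OF True]] Nats_real_floor[OF kappa_Nats[OF nc]] that by (simp only:)
      then show ?thesis by (intro less) simp
    qed
    \<comment> \<open>The rays of the other basis vectors lie in both \<open>Q\<close> and
      \<open>Q'\<close>, and \<open>h\<close>, \<open>h'\<close> vanish on the ray of
      \<open>e k\<close> away from 0. The incoming condition is therefore available at every degree
      violating a bound.\<close>
    have rayx: "m \<notin> ray (e i)" if "m \<notin> Q \<or> m \<notin> Q'" "h m \<noteq> 0 \<or> h' m \<noteq> 0" "i \<in> U" for m i
    proof
      assume r: "m \<in> ray (e i)"
      then have "i = k" using ray_Q[OF that(3)] that(1) by blast
      then obtain j where j: "m = real j *\<^sub>R e k" using r by (auto simp: ray_def)
      have "m \<noteq> 0" using that(1) Q_monoid by auto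
      then have "j > 0" using j by (cases j) auto
      then show False using that(2) h_ray h'_ray j by auto
    qed
    \<comment> \<open>Formulated for the whole level of \<open>n\<close>, because the case of the
      other sign of \<open>ell\<close> applies it to a translate of \<open>n\<close> along
      \<open>e k\<close>.\<close>
    have A1: "m \<in> Q" if m: "\<kappa> m = \<kappa> n" "ell m \<le> 0" "h m \<noteq> 0" for m
    proof (rule ccontr)
      assume mQ: "m \<notin> Q"
      have "m \<in> N" using unip_out[OF hC(1)] m(3) by blast
      moreover have "m \<noteq> 0" using mQ Q_monoid by auto
      moreover have "\<omega> m (e k) \<le> 0" using m(2) Dk by (simp add: ell_def mult_le_0_iff)
      ultimately have "h m = 0"
        by (intro vanish[OF h_R(1) Q_monoid(1,2) _ mQ] ray_incoming(1)) (use IH m mQ rayx in auto)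
      then show False using m(3) by simp
    qed
    have A2: "m \<in> Q'" if m: "\<kappa> m = \<kappa> n" "ell m \<ge> 0" "h' m \<noteq> 0" for m
    proof (rule ccontr)
      assume mQ: "m \<notin> Q'"
      have "m \<in> N" using unip_out[OF hC(2)] m(3) by blast
      moreover have "m \<noteq> 0" using mQ Q_monoid by auto
      moreover have "\<omega> m (e k) \<ge> 0" using m(2) Dk by (simp add: ell_def zero_le_mult_iff)
      ultimately have "h' m = 0"
        by (intro vanish[OF h_R(2) Q_monoid(3,4) _ mQ] ray_incoming(2)) (use IH m mQ rayx in auto)
      then show False using m(3) by simp
    qed
    obtain l where l: "ell n = of_int l" using ell_cone(2)[OF nc] by (auto elim: Ints_cases)
    note supp = qdilog_intertwine_supp[OF par_gt_1[OF kU] bounded_below_cone[OF hC(1)] bounded_below_cone[OF hC(2)] ray_mutual[OF l], of 0]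
    note lin = linear_maps[THEN linear_diff] linear_maps[THEN linear_scale] linear_maps[THEN linear_add]
    have same: "\<kappa> (n - c *\<^sub>R e k) = \<kappa> n" "ell (n - c *\<^sub>R e k) = ell n" "Bp (n - c *\<^sub>R e k) = Bp n"
      "Bm (n - c *\<^sub>R e k) = Bm n" "co k (n - c *\<^sub>R e k) = co k n - c" for c
      using kU by (simp_all add: lin kappa_ek co_simps co_e)
    have "n \<in> Q" if hn: "h n \<noteq> 0"
    proof (cases "ell n \<le> 0")
      case False
      \<comment> \<open>A coefficient of \<open>h\<close> arises from one of \<open>h'\<close> at
        most \<open>l = Bp n - Bm n\<close> steps below, which turns the bound \<open>Bm\<close> for
        \<open>h'\<close> into the bound \<open>Bp\<close> for \<open>h\<close>.\<close>
      obtain i where i: "0 \<le> i" "i \<le> l" "h' (n - of_int i *\<^sub>R e k) \<noteq> 0"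
        using supp(1) hn False l by auto
      have "n - of_int i *\<^sub>R e k \<in> Q'" by (rule A2) (use i False same in auto)
      then have "co k n - of_int i \<le> Bm n" by (simp add: Q'_def same)
      moreover have "of_int i \<le> ell n" using i l by simp
      ultimately show ?thesis using nc ell_cone(1)[OF nc] by (simp add: Q_def)
    qed (use A1 hn in auto)
    moreover have "n \<in> Q'" if hn: "h' n \<noteq> 0"
    proof (cases "ell n \<ge> 0")
      case False
      obtain i where i: "0 \<le> i" "i \<le> - l" "h (n - of_int i *\<^sub>R e k) \<noteq> 0"
        using supp(2) hn False l by auto
      have "n - of_int i *\<^sub>R e k \<in> Q" by (rule A1) (use i False same in auto)
      then have "co k n - of_int i \<le> Bp n" by (simp add: Q_def same)
      moreover have "of_int i \<le> - ell n" using i l by simp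
      ultimately show ?thesis using nc ell_cone(1)[OF nc] by (simp add: Q'_def)
    qed (use A2 hn in auto)
    ultimately show ?thesis by blast
  qed
qed

lemma h_Q: "h \<in> unip Q" "h' \<in> unip Q'"
  using bounds unip_0[OF hC(1)] unip_0[OF hC(2)] by (auto simp: unip_def ser_def)

section \<open>The series of the mutated seed\<close>

definition push :: "('v \<Rightarrow> real) \<Rightarrow> 'v \<Rightarrow> real" where
  "push f n = f (unshear n)"

lemma push_conv: "push (f1 \<star> f2) = push f1 \<star> push f2"
proof
  fix n
  show "push (f1 \<star> f2) n = (push f1 \<star> push f2) n"
    unfolding push_def conv_def
    by (rule sum.reindex_bij_witness[where i = unshear and j = shear])
       (auto simp: linear_diff[OF linear_shear(2)], metis form_shear(1) unshear_shear(2))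
qed

lemma push_unip: "f \<in> unip X \<Longrightarrow> push f \<in> unip (shear ` X)"
proof -
  assume f: "f \<in> unip X"
  have "push f n = 0" if "n \<notin> shear ` X" for n
  proof -
    have "unshear n \<notin> X" using that by (metis imageI unshear_shear(2))
    then show ?thesis using unip_out[OF f] by (simp add: push_def)
  qed
  then show ?thesis using unip_0[OF f] linear_0[OF linear_shear(2)] by (simp add: unip_def ser_def push_def)
qed

lemma push_one_iff: "push z = one \<longleftrightarrow> z = one"
proof -
  have "unshear n = 0 \<longleftrightarrow> n = 0" for n
    by (metis linear_0[OF linear_shear(1)] linear_0[OF linear_shear(2)] unshear_shear(2))
  then have po: "push one = one" by (auto simp: push_def one_def fun_eq_iff)
  have "z = w" if "push z = push w" for z w
    using fun_cong[OF that] unfolding push_def by (metis ext unshear_shear(1))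
  then show ?thesis using po by metis
qed

lemma push_factors:
  assumes "factors X \<theta> f p z m"
  shows "factors (shear ` X) (\<lambda>n. \<theta> (unshear n)) (push f) (push p) (push z) (push m)"
proof -
  have "shear ` pos_part X \<theta> \<subseteq> pos_part (shear ` X) (\<lambda>n. \<theta> (unshear n))"
    "shear ` zero_part X \<theta> \<subseteq> zero_part (shear ` X) (\<lambda>n. \<theta> (unshear n))"
    "shear ` neg_part X \<theta> \<subseteq> neg_part (shear ` X) (\<lambda>n. \<theta> (unshear n))"
    using linear_0[OF linear_shear(1)] by (auto simp: parts_def)
  then show ?thesis using assms unfolding factors_def
    by (auto simp: push_conv intro: unip_mono push_unip)
qed

lemma swap: "E' \<star> h = push h' \<star> E'"
proof
  fix n
  have mk: "- e k \<noteq> 0" using e_nonzero[OF kU] by simp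
  have L: "(E' \<star> h) n = qdilog_act (par k) (exp (\<omega> n (e k))) (\<lambda>b. h (n + of_int (- b) *\<^sub>R e k)) 0"
    using dilog_conv[OF mk par_gt_1[OF kU], of h n 0] by (simp add: E'_def)
  \<comment> \<open>The shear moves the line by \<open>ell n\<close>, the same shift that
    palindromicity produces in \<open>qdilog_intertwine_flip\<close>.\<close>
  have sh: "unshear (n + of_int b *\<^sub>R (- e k)) = n + (- of_int b - ell n) *\<^sub>R e k" for b
    by (simp add: unshear_def ell_def algebra_simps)
  have R: "(push h' \<star> E') n = qdilog_act (par k) (exp (- \<omega> n (e k))) (\<lambda>b. h' (n + (- of_int b - ell n) *\<^sub>R e k)) 0"
    using conv_dilog[OF mk par_gt_1[OF kU], of "push h'" n 0] by (simp add: E'_def push_def sh del: scaleR_minus_right)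
  show "(E' \<star> h) n = (push h' \<star> E') n"
  proof (cases "\<exists>b. n + b *\<^sub>R e k \<in> N")
    case False
    then have "h (n + b *\<^sub>R e k) = 0" "h' (n + b *\<^sub>R e k) = 0" for b using unip_out hC by blast+
    then show ?thesis unfolding L R by (simp add: qdilog_act_def)
  next
    case True
    then obtain b where "n + b *\<^sub>R e k \<in> N" by blast
    then have "ell n \<in> \<int>" using ell_cone(2)[of "n + b *\<^sub>R e k"] by (simp add: ell_def)
    then obtain l where l: "ell n = of_int l" by (auto elim: Ints_cases)
    define H where "H b = h (n + of_int b *\<^sub>R e k)" for b
    define G where "G b = h' (n + of_int b *\<^sub>R e k)" for b
    note lin = linear_maps[THEN linear_scale] linear_maps[THEN linear_add]
    have same: "Bp (n + c *\<^sub>R e k) = Bp n"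
      "Bm (n + c *\<^sub>R e k) = Bm n" "co k (n + c *\<^sub>R e k) = co k n + c" for c
      using kU by (simp_all add: lin kappa_ek co_simps co_e)
    \<comment> \<open>The upper bounds on \<open>co k\<close> in \<open>Q\<close> and
      \<open>Q'\<close> are lower bounds for the reversed direction. The absence of incoming walls
      enters here.\<close>
    have b1: "bounded_below (\<lambda>b. H (- b))"
      unfolding bounded_below_def
    proof (intro exI[of _ "\<lfloor>co k n - Bp n\<rfloor>"] allI impI)
      fix b assume "b < \<lfloor>co k n - Bp n\<rfloor>"
      then have "of_int b < co k n - Bp n" by linarith
      then have "n + of_int (- b) *\<^sub>R e k \<notin> Q" unfolding Q_def by (simp only: same mem_Collect_eq) simp
      then show "H (- b) = 0" unfolding H_def by (rule unip_out[OF h_Q(1)])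
    qed
    have b2: "bounded_below (\<lambda>b. G (- b - l))"
      unfolding bounded_below_def
    proof (intro exI[of _ "\<lfloor>co k n - of_int l - Bm n\<rfloor>"] allI impI)
      fix b assume "b < \<lfloor>co k n - of_int l - Bm n\<rfloor>"
      then have "of_int b < co k n - of_int l - Bm n" by linarith
      then have "n + of_int (- b - l) *\<^sub>R e k \<notin> Q'" unfolding Q'_def by (simp only: same mem_Collect_eq) simp
      then show "G (- b - l) = 0" unfolding G_def by (rule unip_out[OF h_Q(2)])
    qed
    have "qdilog_act (par k) (par k powr (of_int l / 2)) (\<lambda>b. H (- b))
        = qdilog_act (par k) (par k powr (- of_int l / 2)) (\<lambda>b. G (- b - l))"
      by (rule qdilog_intertwine_flip[OF par_gt_1[OF kU] _ _ b1 b2])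
         (use bounded_below_cone[OF hC(1)] bounded_below_cone[OF hC(2)] ray_mutual[OF l] in \<open>auto simp: H_def G_def\<close>)
    then show ?thesis unfolding L R par_powr[OF l] H_def G_def by (simp add: l)
  qed
qed

definition g' :: "'v \<Rightarrow> real" where "g' = E' \<star> h"

lemma g'_eq: "g' = E' \<star> h" "g' = push h' \<star> E'"
  using swap by (auto simp: g'_def)

lemma hC': "h \<in> unip N'" "push h' \<in> unip N'" "push h' \<in> unip (shear ` Q')"
  using unip_mono[OF Q_sub(2)] h_Q push_unip[OF h_Q(2)] unip_mono[OF shear_Q'] by auto

lemma g'_unip: "g' \<in> unip N'"
  unfolding g'_def by (rule conv_unip[OF mut.graded_cone EC(3) hC'(1)])

lemma dilog_other:
  assumes "i \<in> U" "i \<noteq> k" "l > 0"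
  shows "E (real l *\<^sub>R e i) = 0" "E' (real l *\<^sub>R e' i) = 0"
proof -
  have "real l *\<^sub>R e i \<noteq> real j *\<^sub>R e k" for j
  proof
    assume "real l *\<^sub>R e i = real j *\<^sub>R e k"
    then have "co i (real l *\<^sub>R e i) = co i (real j *\<^sub>R e k)" by simp
    then show False using assms kU by (simp add: co_simps co_e)
  qed
  then show "E (real l *\<^sub>R e i) = 0" unfolding E_def by (rule dilog_out)
  have "real l *\<^sub>R e' i \<noteq> real j *\<^sub>R (- e k)" for j
  proof
    assume "real l *\<^sub>R e' i = real j *\<^sub>R (- e k)"
    then have "co i (real l *\<^sub>R e' i) = co i (real j *\<^sub>R (- e k))" by simp
    then show False using assms kU by (simp add: co_simps co_e e'_def)
  qed
  then show "E' (real l *\<^sub>R e' i) = 0" unfolding E'_def by (rule dilog_out)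
qed

lemma shear_e: "i \<in> U \<Longrightarrow> i \<noteq> k \<Longrightarrow> eps i \<ge> 0 \<Longrightarrow> shear (real j *\<^sub>R e i) = real j *\<^sub>R e' i"
  by (simp add: shear_def e'_def ell_def eps_def algebra_simps)

lemma e'_same: "i \<noteq> k \<Longrightarrow> eps i \<le> 0 \<Longrightarrow> e' i = e i"
  by (simp add: e'_def)

text \<open>Each expression for \<open>g'\<close> serves one sign: if \<open>eps i \<le> 0\<close>,
  the vector is unchanged and \<open>h\<close> has the values of \<open>g\<close> on its ray; if
  \<open>eps i \<ge> 0\<close>, the vector is sheared and \<open>push h'\<close> carries them along.
  On the ray of \<open>- e k\<close> only \<open>E'\<close> contributes.\<close>

lemma g'_ray:
  assumes i: "i \<in> U"
  shows "g' (real j *\<^sub>R e' i) = qdilog (par i) j"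
proof -
  note C = EC[THEN unip_ser] hC[THEN unip_ser] hC'(1,2)[THEN unip_ser]
  consider "i = k" | "i \<noteq> k" "eps i \<le> 0" | "i \<noteq> k" "eps i \<ge> 0" by linarith
  then show ?thesis
  proof cases
    case 1
    have "h (real l *\<^sub>R e' k) = 0" if "l > 0" for l
    proof -
      have "co k (real l *\<^sub>R e' k) < 0" using that kU by (simp add: e'_def co_simps co_e)
      then have "real l *\<^sub>R e' k \<notin> N" using cone_co_nonneg kU by force
      then show ?thesis by (rule unip_out[OF hC(1)])
    qed
    then have "g' (real j *\<^sub>R e' k) = E' (real j *\<^sub>R e' k)"
      unfolding g'_eq(1) by (intro mut.conv_ray_left kU C hC')
    also have "\<dots> = qdilog (par k) j"
      using dilog_at[of "- e k" "par k" j] e_nonzero[OF kU] by (simp add: E'_def e'_def)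
    finally show ?thesis using 1 by simp
  next
    case 2
    have "g' (real j *\<^sub>R e' i) = h (real j *\<^sub>R e' i)"
      unfolding g'_eq(1) by (rule mut.conv_ray_right[OF i EC(3) C(7)]) (rule dilog_other(2)[OF i 2(1)])
    also have "\<dots> = h (real j *\<^sub>R e i)" by (simp add: e'_same 2)
    also have "\<dots> = g (real j *\<^sub>R e i)"
      by (subst g_eq(1), rule conv_ray_left[symmetric, OF i C(5) EC(1)]) (rule dilog_other(1)[OF i 2(1)])
    finally show ?thesis using gD(2)[OF i] by simp
  next
    case 3
    have "g' (real j *\<^sub>R e' i) = push h' (real j *\<^sub>R e' i)"
      unfolding g'_eq(2) by (rule mut.conv_ray_left[OF i C(8) EC(3)]) (rule dilog_other(2)[OF i 3(1)])
    also have "\<dots> = h' (real j *\<^sub>R e i)"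
      using shear_e[OF i 3, of j] by (metis push_def unshear_shear(1))
    also have "\<dots> = g (real j *\<^sub>R e i)"
      by (subst g_eq(2), rule conv_ray_right[symmetric, OF i EC(1) C(6)]) (rule dilog_other(1)[OF i 3(1)])
    finally show ?thesis using gD(2)[OF i] by simp
  qed
qed

lemma push_traceless:
  assumes z: "z \<in> unip (zero_part Q' (\<omega> (unshear n)))" and t: "traceless Q' (unshear n) z"
  shows "traceless (shear ` Q') n (push z)"
proof -
  obtain zi \<delta> where zi: "zi \<in> unip (zero_part Q' (\<omega> (unshear n)))" "linear \<delta>" "\<delta> (unshear n) \<noteq> 0"
     "z \<star> zi = one" "zi \<star> z = one" "(zi \<star> euler \<delta> z) (unshear n) = 0"
    using t unfolding traceless_def by blast
  have sub: "shear ` zero_part Q' (\<omega> (unshear n)) \<subseteq> zero_part (shear ` Q') (\<omega> n)"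
  proof
    fix x assume "x \<in> shear ` zero_part Q' (\<omega> (unshear n))"
    then obtain y where y: "x = shear y" "y \<in> Q'" "\<omega> (unshear n) y = 0" by (auto simp: parts_def)
    have "\<omega> n x = \<omega> (unshear n) y" using form_shear(1)[of "unshear n" y] y by simp
    then show "x \<in> zero_part (shear ` Q') (\<omega> n)" using y by (auto simp: parts_def)
  qed
  have eu: "euler (\<lambda>n. \<delta> (unshear n)) (push z) = push (euler \<delta> z)"
    by (auto simp: euler_def push_def)
  show ?thesis unfolding traceless_def
  proof (intro bexI[of _ "push zi"] exI[of _ "\<lambda>n. \<delta> (unshear n)"] conjI)
    show "linear (\<lambda>n. \<delta> (unshear n))" using linear_compose[OF linear_shear(2) zi(2)] by (simp add: o_def)
    show "push z \<star> push zi = one" "push zi \<star> push z = one"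
      using zi push_one_iff by (simp_all add: push_conv[symmetric])
    show "(push zi \<star> euler (\<lambda>n. \<delta> (unshear n)) (push z)) n = 0"
      unfolding eu push_conv[symmetric] using zi by (simp add: push_def)
    show "push zi \<in> unip (zero_part (shear ` Q') (\<omega> n))"
      by (rule unip_mono[OF sub push_unip[OF zi(1)]])
  qed (use zi in auto)
qed

lemma g'_incoming:
  assumes n: "n \<in> N'" "n \<noteq> 0" "\<And>i. i \<in> U \<Longrightarrow> n \<notin> ray (e' i)"
  shows "incoming N' g' n"
proof -
  have nk: "n \<notin> ray (- e k)" using n(3)[OF kU] by (simp add: e'_def)
  have degn: "mut.deg n \<noteq> 0" using mut.deg_zero n by blast
  show ?thesis
  proof (cases "\<omega> n (e k) \<le> 0")
    case True
    obtain p z m where f: "factors Q (\<omega> n) h p z m"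
      using factors_exist[OF graded_Q(1) linear_form h_Q(1)] by blast
    have z: "z \<in> unip (zero_part Q (\<omega> n))" using f by (simp add: factors_def)
    have "traceless Q n z"
    proof (cases "n \<in> Q")
      case False
      then show ?thesis using traceless_out[OF graded_Q(1) z _ mut.linear_deg degn] by simp
    next
      case nQ: True
      have "n \<notin> ray (e i)" if i: "i \<in> U" for i
      proof
        assume r: "n \<in> ray (e i)"
        then obtain j where j: "n = real j *\<^sub>R e i" by (auto simp: ray_def)
        then have j0: "j > 0" using n(2) by (cases j) auto
        show False
        proof (cases "i = k")
          case True
          \<comment> \<open>Positive multiples of \<open>e k\<close> have a negative new coordinate
            at \<open>k\<close> and hence lie outside \<open>N'\<close>.\<close>
          have "co' k n \<ge> 0" using mut.cone_co_nonneg[OF n(1) kU] .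
          then show False using j j0 True kU
            by (simp add: co'_def co_simps co_e linear_scale[OF linear_maps(2)] kappa_ek)
        next
          case False
          show False
          proof (cases "eps i \<le> 0")
            case True
            then show False using n(3)[OF i] r e'_same[OF False] by simp
          next
            case pos: False
            then have "\<omega> (e i) (e k) > 0" using Dk unfolding eps_def not_le zero_less_mult_iff by linarith
            then have "\<omega> n (e k) > 0" using j j0 by simp
            then show False using True \<open>\<omega> n (e k) \<le> 0\<close> by simp
          qed
        qed
      qed
      then have "traceless N n z"
        using ray_incoming(1)[OF _ n(2) _ True factors_mono[OF Q_sub(1) f]] nQ Q_sub(1) by blast
      then show ?thesis using traceless_mono[OF graded_cone graded_Q(1) Q_sub(1) z] by simp
    qed
    then have "traceless N' n z"
      using traceless_mono[OF mut.graded_cone graded_Q(1) Q_sub(2) z] by simp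
    then show ?thesis
      using incoming_left[OF mut.graded_cone ek_cone(2) _ nk E_unip(2) Ei' factors_mono[OF Q_sub(2) f]] True
      by (simp add: g'_eq(1))
  next
    case False
    let ?n = "unshear n"
    have ok: "\<omega> ?n (e k) = \<omega> n (e k)" by (simp add: unshear_def)
    have n0: "?n \<noteq> 0" using n(2) by (metis linear_0[OF linear_shear(1)] unshear_shear(2))
    obtain p z m where f: "factors Q' (\<omega> ?n) h' p z m"
      using factors_exist[OF graded_Q(2) linear_form h_Q(2)] by blast
    have z: "z \<in> unip (zero_part Q' (\<omega> ?n))" using f by (simp add: factors_def)
    have om: "(\<lambda>m. \<omega> ?n (unshear m)) = \<omega> n" by (simp add: form_shear)
    have f': "factors (shear ` Q') (\<omega> n) (push h') (push p) (push z) (push m)"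
      using push_factors[OF f] by (simp only: om)
    have pz: "push z \<in> unip (zero_part (shear ` Q') (\<omega> n))" using f' by (simp add: factors_def)
    have "traceless Q' ?n z"
    proof (cases "?n \<in> Q'")
      case False
      have "linear (\<lambda>n. mut.deg (shear n))"
        using linear_compose[OF linear_shear(1) mut.linear_deg] by (simp add: o_def)
      then show ?thesis using traceless_out[OF graded_Q(2) z False] degn by simp
    next
      case nQ: True
      have "?n \<notin> ray (e i)" if i: "i \<in> U" for i
      proof
        assume r: "?n \<in> ray (e i)"
        then obtain j where j: "?n = real j *\<^sub>R e i" by (auto simp: ray_def)
        then have "real j * \<omega> (e i) (e k) > 0" using False ok by simp
        then have pos: "\<omega> (e i) (e k) > 0" by (simp add: zero_less_mult_iff)
        then have ik: "i \<noteq> k" "eps i \<ge> 0" using Dk by (auto simp: eps_def)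
        have "n = real j *\<^sub>R e' i" using shear_e[OF i ik, of j] j by (metis unshear_shear(2))
        then show False using n(3)[OF i] by (auto simp: ray_def)
      qed
      then have "traceless N ?n z"
        using ray_incoming(2)[OF _ n0 _ _ factors_mono[OF Q_sub(3) f]] nQ Q_sub(3) False ok
        by (metis linorder_le_cases subsetD)
      then show ?thesis using traceless_mono[OF graded_cone graded_Q(2) Q_sub(3) z] by simp
    qed
    then have "traceless N' n (push z)"
      using traceless_mono[OF mut.graded_cone graded_Q(3) shear_Q' pz] push_traceless[OF z] by simp
    then show ?thesis
      using incoming_right[OF mut.graded_cone ek_cone(2) _ nk E_unip(2) Ei' factors_mono[OF shear_Q' f']] False
      by (simp add: g'_eq(2))
  qed
qed

lemma cluster_element_mutation: "cluster_element e' g'"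
  unfolding cluster_element_def using g'_unip g'_ray g'_incoming by blast

text \<open>Off the hyperplane of \<open>e k\<close> the dilogarithms are absorbed into the outer
  factors of \<open>g\<close> and \<open>g'\<close>. The middle factors are then both that of
  \<open>h\<close>, or that of \<open>h'\<close> and its shear, depending on the side. On the
  hyperplane neither series splits.\<close>

lemma splits_mutation:
  assumes \<theta>: "linear \<theta>"
  shows "splits N \<theta> g \<longleftrightarrow>
    splits N' (\<lambda>n. if \<theta> (e k) \<ge> 0 then \<theta> (unshear n) else \<theta> n) g'"
proof -
  have \<theta>': "linear (\<lambda>n. \<theta> (unshear n))" using linear_compose[OF linear_shear(2) \<theta>] by (simp add: o_def)
  consider "\<theta> (e k) = 0" | "\<theta> (e k) < 0" | "\<theta> (e k) > 0" by linarith
  then show ?thesis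
  proof cases
    case 1
    have "\<theta> (unshear (e' k)) = 0"
      using 1 by (simp add: e'_def unshear_def ell_def linear_neg[OF \<theta>])
    then show ?thesis
      using not_splits[OF g kU, of \<theta>] mut.not_splits[OF cluster_element_mutation kU, of "\<lambda>n. \<theta> (unshear n)"] 1 by simp
  next
    case 2
    obtain p z m where f: "factors Q \<theta> h p z m" using factors_exist[OF graded_Q(1) \<theta> h_Q(1)] by blast
    have "E \<in> unip (neg_part N \<theta>)"
      using unip_mono[OF ray_part(5)[OF graded_cone ek_cone(1) \<theta> 2] E_unip(1)] .
    from splits_iff[OF graded_cone factors_right_neg[OF graded_cone \<theta> factors_mono[OF Q_sub(1) f] this]]
    have A: "splits N \<theta> g \<longleftrightarrow> z = one" using g_eq(1) by simp
    have "\<theta> (- e k) > 0" using 2 by (simp add: linear_neg[OF \<theta>])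
    then have "E' \<in> unip (pos_part N' \<theta>)"
      using unip_mono[OF ray_part(3)[OF mut.graded_cone ek_cone(2) \<theta>] E_unip(2)] by simp
    from splits_iff[OF mut.graded_cone factors_left_pos[OF mut.graded_cone \<theta> factors_mono[OF Q_sub(2) f] this]]
    have "splits N' \<theta> g' \<longleftrightarrow> z = one" using g'_eq(1) by simp
    then show ?thesis using A 2 by simp
  next
    case 3
    obtain p z m where f: "factors Q' \<theta> h' p z m" using factors_exist[OF graded_Q(2) \<theta> h_Q(2)] by blast
    have "E \<in> unip (pos_part N \<theta>)"
      using unip_mono[OF ray_part(3)[OF graded_cone ek_cone(1) \<theta> 3] E_unip(1)] .
    from splits_iff[OF graded_cone factors_left_pos[OF graded_cone \<theta> factors_mono[OF Q_sub(3) f] this]]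
    have A: "splits N \<theta> g \<longleftrightarrow> z = one" using g_eq(2) by simp
    have "\<theta> (unshear (- e k)) < 0" using 3 by (simp add: unshear_def ell_def linear_neg[OF \<theta>])
    then have "E' \<in> unip (neg_part N' (\<lambda>n. \<theta> (unshear n)))"
      using unip_mono[OF ray_part(5)[OF mut.graded_cone ek_cone(2) \<theta>'] E_unip(2)] by simp
    from splits_iff[OF mut.graded_cone factors_right_neg[OF mut.graded_cone \<theta>' factors_mono[OF shear_Q' push_factors[OF f]] this]]
    have "splits N' (\<lambda>n. \<theta> (unshear n)) g' \<longleftrightarrow> z = one" using g'_eq(2) push_one_iff by simp
    then show ?thesis using A 3 by simp
  qed
qed

end

section \<open>The wall sets of all seeds\<close>

text \<open>The result with all objects of the mutation locale written out or quantified, so that it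
  can be iterated along words.\<close>

lemma (in cluster_form) mutation_step:
  assumes "dual_family e co" "integral_family e" "cluster_element e g" "k \<in> U"
    and f: "f = (\<lambda>i. if i = k then - e k else e i + max 0 (real (D k) * \<omega> (e i) (e k)) *\<^sub>R e k)"
  shows "\<exists>co'. dual_family f co'" "integral_family f"
    "\<exists>g'. cluster_element f g' \<and> (\<forall>\<theta>. linear \<theta> \<longrightarrow> (splits (ncone e) \<theta> g \<longleftrightarrow>
       splits (ncone f) (\<lambda>n. if \<theta> (e k) \<ge> 0 then \<theta> (n - (real (D k) * \<omega> n (e k)) *\<^sub>R e k) else \<theta> n) g'))"
proof -
  interpret cluster_mutation \<omega> U D e co k g
    by unfold_locales (use assms in auto)
  have fe: "f = e'" by (auto simp: f e'_def eps_def)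
  show "\<exists>co'. dual_family f co'" "integral_family f" using dual' integral' fe by auto
  show "\<exists>g'. cluster_element f g' \<and> (\<forall>\<theta>. linear \<theta> \<longrightarrow> (splits (ncone e) \<theta> g \<longleftrightarrow>
       splits (ncone f) (\<lambda>n. if \<theta> (e k) \<ge> 0 then \<theta> (n - (real (D k) * \<omega> n (e k)) *\<^sub>R e k) else \<theta> n) g'))"
    using cluster_element_mutation splits_mutation unfolding fe unshear_def ell_def by blast
qed

lemma linear_blinfun_apply: "linear (blinfun_apply x)"
  by (rule bounded_linear.linear[OF blinfun.bounded_linear_right])

definition weight :: "('v::euclidean_space, 'i::finite, 'c) fixed_data \<Rightarrow> 'i \<Rightarrow> nat" where
  "weight \<Gamma> i = rdeg \<Gamma> i * mult \<Gamma> i"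

text \<open>Skew-symmetry is given on the lattice; a basis of the lattice spans the space, and
  bilinearity extends the identity.\<close>

lemma fixed_data_skew:
  assumes "generalized_fixed_data \<Gamma>"
  shows "form \<Gamma> x y = - form \<Gamma> y x"
proof -
  have bil: "bilinear (form \<Gamma>)" using assms by (simp add: generalized_fixed_data_def)
  have bil': "bilinear (\<lambda>x y. - form \<Gamma> y x)"
    unfolding bilinear_def
  proof (intro conjI allI)
    show "linear (\<lambda>y. - form \<Gamma> y x)" "linear (\<lambda>x. - form \<Gamma> y x)" for x y
      by (rule linear_compose_neg, use bil in \<open>simp add: bilinear_def\<close>)+
  qed
  have "full_lattice (lat \<Gamma>)" using assms by (simp add: generalized_fixed_data_def)
  then obtain B where B: "span B = UNIV" "group_closure B = lat \<Gamma>"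
    by (auto simp: full_lattice_def)
  have "B \<subseteq> lat \<Gamma>" using B(2) by (auto intro: group_closure.base)
  then have "form \<Gamma> x y = - form \<Gamma> y x" if "x \<in> B" "y \<in> B" for x y
    using assms that unfolding generalized_fixed_data_def by blast
  from bilinear_eq[OF bil bil', where S = UNIV and T = UNIV, OF _ _ _ _ this] show ?thesis
    using B(1) by blast
qed

lemma cluster_form_fixed_data:
  assumes "generalized_fixed_data \<Gamma>"
  shows "cluster_form (form \<Gamma>) (idx_uf \<Gamma>) (weight \<Gamma>)"
proof
  show "form \<Gamma> x y = - form \<Gamma> y x" for x y by (rule fixed_data_skew[OF assms])
  show "bilinear (form \<Gamma>)" using assms by (simp add: generalized_fixed_data_def)
  show "weight \<Gamma> i > 0" if "i \<in> idx_uf \<Gamma>" for i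
    using assms that by (simp add: generalized_fixed_data_def weight_def)
qed simp

text \<open>Integrality comes from the integrality of the form between \<open>lat_uf\<close> and
  \<open>lat_circ\<close>, applied to \<open>e\<^sub>i\<close> and
  \<open>d\<^sub>j e\<^sub>j\<close> and multiplied by \<open>r\<^sub>j\<close>.\<close>

lemma torus_seed_family:
  assumes \<Gamma>: "generalized_fixed_data \<Gamma>" and s: "torus_seed \<Gamma> s"
  shows "\<exists>co. cluster_form.dual_family (idx_uf \<Gamma>) (vec s) co"
    "cluster_form.integral_family (form \<Gamma>) (idx_uf \<Gamma>) (weight \<Gamma>) (vec s)"
proof -
  interpret cluster_form "form \<Gamma>" "idx_uf \<Gamma>" "weight \<Gamma>" by (rule cluster_form_fixed_data[OF \<Gamma>])
  have b: "inj_on (vec s) (idx_uf \<Gamma>)" "independent (vec s ` idx_uf \<Gamma>)" "group_closure (vec s ` idx_uf \<Gamma>) = lat_uf \<Gamma>"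
    using s by (auto simp: torus_seed_def lattice_basis_on_def)
  have "\<exists>f. linear f \<and> (\<forall>x\<in>vec s ` idx_uf \<Gamma>. f x = (if x = vec s i then 1 else 0 :: real))" for i
    using linear_independent_extend[OF b(2), of "\<lambda>x. if x = vec s i then 1 else 0"] .
  then obtain co where co: "\<And>i. linear (co i)" "\<And>i x. x \<in> vec s ` idx_uf \<Gamma> \<Longrightarrow> co i x = (if x = vec s i then 1 else 0 :: real)"
    by metis
  have "dual_family (vec s) co"
    unfolding dual_family_def using co b(1) by (auto simp: inj_on_def)
  then show "\<exists>co. dual_family (vec s) co" by blast
  show "integral_family (vec s)"
    unfolding integral_family_def
  proof (intro ballI)
    fix i j assume i: "i \<in> idx_uf \<Gamma>" and j: "j \<in> idx_uf \<Gamma>"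
    have "vec s i \<in> lat_uf \<Gamma>" using b(3) i by (auto intro: group_closure.base)
    moreover have "group_closure ((\<lambda>i. real (mult \<Gamma> i) *\<^sub>R vec s i) ` UNIV) = lat_circ \<Gamma>"
      using s by (simp add: torus_seed_def lattice_basis_on_def)
    then have "real (mult \<Gamma> j) *\<^sub>R vec s j \<in> lat_circ \<Gamma>" by (auto intro: group_closure.base)
    ultimately have "form \<Gamma> (vec s i) (real (mult \<Gamma> j) *\<^sub>R vec s j) \<in> \<int>"
      using \<Gamma> unfolding generalized_fixed_data_def by blast
    then have "real (rdeg \<Gamma> j) * form \<Gamma> (vec s i) (real (mult \<Gamma> j) *\<^sub>R vec s j) \<in> \<int>"
      by (rule Ints_mult[OF Ints_of_nat])
    then show "real (weight \<Gamma> j) * form \<Gamma> (vec s i) (vec s j) \<in> \<int>" by (simp add: weight_def mult.assoc)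
  qed
qed

lemma seed_at_snoc: "seed_at \<Gamma> s (w @ [k]) = mutate \<Gamma> k (seed_at \<Gamma> s w)"
  by (simp add: seed_at_def)

lemma vec_mutate:
  "vec (mutate \<Gamma> k s) = (\<lambda>i. if i = k then - vec s k
     else vec s i + max 0 (real (weight \<Gamma> k) * form \<Gamma> (vec s i) (vec s k)) *\<^sub>R vec s k)"
proof -
  have "real (rdeg \<Gamma> k) * max 0 (exch \<Gamma> s i k) = max 0 (real (weight \<Gamma> k) * form \<Gamma> (vec s i) (vec s k))" for i
    by (simp add: max_mult_distrib_left exch_def weight_def mult_ac)
  then show ?thesis by (auto simp: mutate_def)
qed

lemma vdual_apply:
  assumes "generalized_fixed_data \<Gamma>"
  shows "blinfun_apply (vdual \<Gamma> s k) n = form \<Gamma> (vec s k) n"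
proof -
  have "bilinear (form \<Gamma>)" using assms by (simp add: generalized_fixed_data_def)
  then have "linear (form \<Gamma> (vec s k))" by (simp add: bilinear_def)
  then show ?thesis
    by (simp add: vdual_def bounded_linear_Blinfun_apply linear_conv_bounded_linear)
qed

text \<open>By skew-symmetry the tropical mutation is, on its half space, precomposition with the
  unshearing map. This is the form in which \<open>splits_mutation\<close> transports
  functionals.\<close>

lemma trop_mutation_apply:
  assumes "generalized_fixed_data \<Gamma>"
  shows "blinfun_apply (trop_mutation \<Gamma> s k x) = (\<lambda>n. if blinfun_apply x (vec s k) \<ge> 0
    then blinfun_apply x (n - (real (weight \<Gamma> k) * form \<Gamma> n (vec s k)) *\<^sub>R vec s k) else blinfun_apply x n)"
  using fixed_data_skew[OF assms, of _ "vec s k"]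
  by (auto simp: trop_mutation_def blinfun.add_left blinfun.scaleR_left blinfun.scaleR_right blinfun.diff_right blinfun.add_right
      vdual_apply[OF assms] weight_def fun_eq_iff)

text \<open>This is everything that the fan argument takes from the scattering diagrams.\<close>

definition wall_family :: "('v::euclidean_space, 'i::finite, 'c) fixed_data \<Rightarrow> ('v, 'i, 'c) seed \<Rightarrow>
    ('i list \<Rightarrow> ('v \<Rightarrow>\<^sub>L real) set) \<Rightarrow> bool" where
  "wall_family \<Gamma> s S \<longleftrightarrow> (\<forall>w\<in>lists (idx_uf \<Gamma>).
    (\<forall>x. (\<forall>i\<in>idx_uf \<Gamma>. blinfun_apply x (vec (seed_at \<Gamma> s w) i) > 0) \<longrightarrow> x \<notin> S w) \<and>
    (\<forall>x. \<forall>i\<in>idx_uf \<Gamma>. blinfun_apply x (vec (seed_at \<Gamma> s w) i) = 0 \<longrightarrow> x \<in> S w) \<and>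
    (\<forall>k\<in>idx_uf \<Gamma>. \<forall>x. x \<in> S w \<longleftrightarrow> trop_mutation \<Gamma> (seed_at \<Gamma> s w) k x \<in> S (w @ [k])))"

lemma wall_family_exists:
  assumes \<Gamma>: "generalized_fixed_data \<Gamma>" and s: "torus_seed \<Gamma> s"
  shows "\<exists>S. wall_family \<Gamma> s S" (is ?thesis1)
    "\<forall>w\<in>lists (idx_uf \<Gamma>). \<exists>co. cluster_form.dual_family (idx_uf \<Gamma>) (vec (seed_at \<Gamma> s w)) co" (is ?thesis2)
proof -
  interpret cluster_form "form \<Gamma>" "idx_uf \<Gamma>" "weight \<Gamma>" by (rule cluster_form_fixed_data[OF \<Gamma>])
  define e where "e w = vec (seed_at \<Gamma> s w)" for w
  define step where "step w k g g' \<longleftrightarrow> cluster_element (e (w @ [k])) g' \<and> (\<forall>x. splits (ncone (e w)) (blinfun_apply x) g \<longleftrightarrow>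
      splits (ncone (e (w @ [k]))) (blinfun_apply (trop_mutation \<Gamma> (seed_at \<Gamma> s w) k x)) g')" for w k g g'
  have e_snoc: "e (w @ [k]) = (\<lambda>i. if i = k then - e w k
     else e w i + max 0 (real (weight \<Gamma> k) * form \<Gamma> (e w i) (e w k)) *\<^sub>R e w k)" for w k
    unfolding e_def seed_at_snoc vec_mutate ..
  have basis: "(\<exists>co. dual_family (e w) co) \<and> integral_family (e w)" if "w \<in> lists (idx_uf \<Gamma>)" for w
    using that
  proof (induction w rule: rev_induct)
    case Nil
    then show ?case using torus_seed_family[OF \<Gamma> s] by (simp add: e_def seed_at_def)
  next
    case (snoc k w)
    then obtain co where co: "dual_family (e w) co" "integral_family (e w)" and k: "k \<in> idx_uf \<Gamma>" by auto
    interpret cluster_basis "form \<Gamma>" "idx_uf \<Gamma>" "weight \<Gamma>" "e w" co by unfold_locales (rule co)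
    obtain g where "cluster_element (e w) g" using cluster_element_exists by blast
    from mutation_step(1,2)[OF co this k e_snoc] show ?case by blast
  qed
  then show ?thesis2 by (simp add: e_def)
  have step_ex: "\<exists>g'. step w k g g'" if w: "w \<in> lists (idx_uf \<Gamma>)" "k \<in> idx_uf \<Gamma>" "cluster_element (e w) g" for w k g
  proof -
    obtain co where co: "dual_family (e w) co" "integral_family (e w)" using basis[OF w(1)] by blast
    from mutation_step(3)[OF co w(3,2) e_snoc]
    obtain g' where g': "cluster_element (e (w @ [k])) g'" "\<And>\<theta>. linear \<theta> \<Longrightarrow> (splits (ncone (e w)) \<theta> g \<longleftrightarrow>
       splits (ncone (e (w @ [k]))) (\<lambda>n. if \<theta> (e w k) \<ge> 0 then \<theta> (n - (real (weight \<Gamma> k) * form \<Gamma> n (e w k)) *\<^sub>R e w k) else \<theta> n) g')"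
      by blast
    have "step w k g g'"
      unfolding step_def
    proof (intro conjI allI)
      fix x :: "'a \<Rightarrow>\<^sub>L real"
      show "splits (ncone (e w)) (blinfun_apply x) g \<longleftrightarrow>
        splits (ncone (e (w @ [k]))) (blinfun_apply (trop_mutation \<Gamma> (seed_at \<Gamma> s w) k x)) g'"
        unfolding trop_mutation_apply[OF \<Gamma>]
        using g'(2)[OF linear_blinfun_apply, of x] unfolding e_def .
    qed (rule g'(1))
    then show ?thesis by blast
  qed
  obtain co where "dual_family (e []) co" using basis[of "[]"] by auto
  then interpret init: cluster_basis "form \<Gamma>" "idx_uf \<Gamma>" "weight \<Gamma>" "e []" co by unfold_locales
  obtain g0 where g0: "cluster_element (e []) g0" using init.cluster_element_exists by blast
  \<comment> \<open>\<open>mutation_step\<close> pairs a given series with some series of the next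
    seed, so the series are chosen successively from one at the root. Words grow at their end, hence
    the recursion over the reversed word.\<close>
  define G where "G = rec_list g0 (\<lambda>k r g. SOME g'. step (rev r) k g g')"
  have GS: "G (k # r) = (SOME g'. step (rev r) k (G r) g')" for k r by (simp add: G_def)
  have G: "cluster_element (e (rev r)) (G r)" if "r \<in> lists (idx_uf \<Gamma>)" for r
    using that
  proof (induction r)
    case Nil
    then show ?case using g0 by (simp add: G_def)
  next
    case (Cons k r)
    then have "step (rev r) k (G r) (G (k # r))"
      unfolding GS by (intro someI_ex[OF step_ex]) auto
    then show ?case by (simp add: step_def)
  qed
  have Gstep: "step w k (G (rev w)) (G (rev (w @ [k])))" if "w \<in> lists (idx_uf \<Gamma>)" "k \<in> idx_uf \<Gamma>" for w k
  proof -
    have "cluster_element (e w) (G (rev w))" using G[of "rev w"] that by (simp add: in_lists_conv_set)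
    from someI_ex[OF step_ex[OF that this]] show ?thesis by (simp add: GS)
  qed
  define S where "S w = {x. \<not> splits (ncone (e w)) (blinfun_apply x) (G (rev w))}" for w
  show ?thesis1
    unfolding wall_family_def
  proof (intro exI[of _ S] ballI conjI allI impI)
    fix w assume w: "w \<in> lists (idx_uf \<Gamma>)"
    obtain co where "dual_family (e w) co" using basis[OF w] by auto
    then interpret cluster_basis "form \<Gamma>" "idx_uf \<Gamma>" "weight \<Gamma>" "e w" co by unfold_locales
    have Gw: "cluster_element (e w) (G (rev w))" using G[of "rev w"] w by (simp add: in_lists_conv_set)
    show "x \<notin> S w" if "\<forall>i\<in>idx_uf \<Gamma>. blinfun_apply x (vec (seed_at \<Gamma> s w) i) > 0" for x
      using splits_pos[OF Gw, of "blinfun_apply x"] that by (simp add: S_def e_def linear_blinfun_apply)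
    show "x \<in> S w" if "i \<in> idx_uf \<Gamma>" "blinfun_apply x (vec (seed_at \<Gamma> s w) i) = 0" for x i
      using not_splits[OF Gw that(1), of "blinfun_apply x"] that(2) by (simp add: S_def e_def)
    show "x \<in> S w \<longleftrightarrow> trop_mutation \<Gamma> (seed_at \<Gamma> s w) k x \<in> S (w @ [k])" if "k \<in> idx_uf \<Gamma>" for k x
      using Gstep[OF w that] by (simp add: S_def step_def)
  qed
qed

section \<open>Faces of simplicial cones\<close>

definition orthant_face :: "'i set \<Rightarrow> ('i \<Rightarrow> 'a::real_vector \<Rightarrow> real) \<Rightarrow> 'i set \<Rightarrow> 'a set" where
  "orthant_face U f J = {x. (\<forall>i\<in>U. f i x \<ge> 0) \<and> (\<forall>i\<in>J. f i x = 0)}"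

text \<open>A linear functional of constant sign that vanishes inside a segment of \<open>C\<close>
  vanishes at both of its ends.\<close>

lemma zero_set_face:
  fixes f :: "'j \<Rightarrow> 'a::real_vector \<Rightarrow> real"
  assumes C: "convex C" and f: "\<And>i. i \<in> N \<Longrightarrow> linear (f i)"
    and sgn: "\<And>i. i \<in> N \<Longrightarrow> (\<forall>x\<in>C. f i x \<ge> 0) \<or> (\<forall>x\<in>C. f i x \<le> 0)"
  shows "{x\<in>C. \<forall>i\<in>N. f i x = 0} face_of C"
proof -
  have "{x\<in>C. f i x = 0} face_of C" if i: "i \<in> N" for i
    unfolding face_of_def
  proof (intro conjI ballI impI)
    show "convex {x\<in>C. f i x = 0}"
      using C unfolding convex_def by (auto simp: linear_add[OF f[OF i]] linear_scale[OF f[OF i]])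
    fix a b x assume ab: "a \<in> C" "b \<in> C" and x: "x \<in> {x\<in>C. f i x = 0}" and seg: "x \<in> open_segment a b"
    obtain u where u: "0 < u" "u < 1" "x = (1 - u) *\<^sub>R a + u *\<^sub>R b" using seg by (auto simp: in_segment)
    have eq: "(1 - u) * f i a + u * f i b = 0"
      using x u(3) by (simp add: linear_add[OF f[OF i]] linear_scale[OF f[OF i]])
    from sgn[OF i] have "f i a = 0 \<and> f i b = 0"
    proof
      assume "\<forall>x\<in>C. f i x \<ge> 0"
      then have "(1 - u) * f i a \<ge> 0" "u * f i b \<ge> 0" using ab u by auto
      then have "(1 - u) * f i a = 0" "u * f i b = 0" using eq by linarith+
      then show ?thesis using u by auto
    next
      assume "\<forall>x\<in>C. f i x \<le> 0"
      then have "(1 - u) * f i a \<le> 0" "u * f i b \<le> 0" using ab u by (auto simp: mult_le_0_iff)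
      then have "(1 - u) * f i a = 0" "u * f i b = 0" using eq by linarith+
      then show ?thesis using u by auto
    qed
    then show "a \<in> {x\<in>C. f i x = 0}" "b \<in> {x\<in>C. f i x = 0}" using ab by auto
  qed auto
  note one = this
  show ?thesis
  proof (cases "N = {}")
    case True
    then show ?thesis using face_of_refl[OF C] by simp
  next
    case False
    then have "{x\<in>C. \<forall>i\<in>N. f i x = 0} = \<Inter> ((\<lambda>i. {x\<in>C. f i x = 0}) ` N)" by auto
    then show ?thesis using face_of_Inter[of "(\<lambda>i. {x\<in>C. f i x = 0}) ` N" C] one False by auto
  qed
qed

lemma convex_orthant:
  fixes f :: "'i \<Rightarrow> 'a::real_vector \<Rightarrow> real"
  assumes "J \<subseteq> U" "\<And>i. i \<in> U \<Longrightarrow> linear (f i)"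
  shows "convex (orthant_face U f J)"
  unfolding convex_def orthant_face_def
proof (intro ballI allI impI CollectI conjI)
  fix x y and u v :: real and i
  assume a: "x \<in> {x. (\<forall>i\<in>U. f i x \<ge> 0) \<and> (\<forall>i\<in>J. f i x = 0)}" "y \<in> {x. (\<forall>i\<in>U. f i x \<ge> 0) \<and> (\<forall>i\<in>J. f i x = 0)}"
    "0 \<le> u" "0 \<le> v"
  have *: "f i (u *\<^sub>R x + v *\<^sub>R y) = u * f i x + v * f i y" if "i \<in> U" for i
    by (simp add: linear_add[OF assms(2)[OF that]] linear_scale[OF assms(2)[OF that]])
  show "i \<in> U \<Longrightarrow> f i (u *\<^sub>R x + v *\<^sub>R y) \<ge> 0" "i \<in> J \<Longrightarrow> f i (u *\<^sub>R x + v *\<^sub>R y) = 0"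
    using a * assms(1) by auto
qed

lemma orthant_face_face:
  fixes f :: "'i \<Rightarrow> 'a::real_vector \<Rightarrow> real"
  assumes "J \<subseteq> U" "\<And>i. i \<in> U \<Longrightarrow> linear (f i)"
  shows "orthant_face U f J face_of orthant_face U f {}"
proof -
  have "orthant_face U f J = {x\<in>orthant_face U f {}. \<forall>i\<in>J. f i x = 0}"
    by (auto simp: orthant_face_def)
  moreover have "\<dots> face_of orthant_face U f {}"
    by (rule zero_set_face[OF convex_orthant]) (use assms in \<open>auto simp: orthant_face_def\<close>)
  ultimately show ?thesis by simp
qed

lemma small_scale:
  assumes "finite V" "\<And>i. i \<in> V \<Longrightarrow> a i > (0::real)"
  shows "\<exists>\<epsilon>>0. \<forall>i\<in>V. \<epsilon> * b i \<le> a i"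
proof -
  have "\<forall>\<^sub>F \<epsilon> in at_right 0. \<epsilon> * b i < a i" if "i \<in> V" for i
    by (rule order_tendstoD(2)[of _ 0]) (use assms(2)[OF that] in \<open>auto intro!: tendsto_eq_intros\<close>)
  then have "\<forall>\<^sub>F \<epsilon> in at_right 0. \<epsilon> > 0 \<and> (\<forall>i\<in>V. \<epsilon> * b i < a i)"
    using assms(1) by (simp add: eventually_conj_iff eventually_ball_finite_distrib eventually_at_right_less)
  from eventually_happens[OF this] show ?thesis by (auto intro: less_imp_le)
qed

text \<open>Let \<open>J'\<close> collect the functionals vanishing on \<open>G\<close>. Averaging
  yields a point of \<open>G\<close> at which all others are positive; it is relatively interior to
  the face cut out by \<open>J'\<close>, so \<open>G\<close> contains that whole face.\<close>

lemma faces_of_orthant_face: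
  fixes f :: "'i \<Rightarrow> 'a::real_vector \<Rightarrow> real"
  assumes U: "finite U" "J \<subseteq> U" and f: "\<And>i. i \<in> U \<Longrightarrow> linear (f i)"
    and G: "G face_of orthant_face U f J" "G \<noteq> {}"
  shows "\<exists>J'. J \<subseteq> J' \<and> J' \<subseteq> U \<and> G = orthant_face U f J'"
proof -
  let ?C = "orthant_face U f J"
  define J' where "J' = {i\<in>U. \<forall>x\<in>G. f i x = 0}"
  have sub: "G \<subseteq> ?C" using face_of_imp_subset[OF G(1)] .
  have JJ: "J \<subseteq> J'" "J' \<subseteq> U" using sub U by (auto simp: J'_def orthant_face_def)
  have cG: "convex G" using face_of_imp_convex[OF G(1)] .
  have "\<exists>y\<in>G. \<forall>i\<in>V. f i y > 0" if "finite V" "V \<subseteq> U - J'" for V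
    using that
  proof (induction V)
    case empty
    then show ?case using G(2) by auto
  next
    case (insert i V)
    then obtain y where y: "y \<in> G" "\<forall>i\<in>V. f i y > 0" by auto
    have "i \<in> U" "i \<notin> J'" using insert by auto
    then obtain x where x: "x \<in> G" "f i x \<noteq> 0" by (auto simp: J'_def)
    have "f i x > 0" using x sub \<open>i \<in> U\<close> by (force simp: orthant_face_def)
    let ?z = "(1/2) *\<^sub>R y + (1/2) *\<^sub>R x"
    have "?z \<in> G" using convexD[OF cG y(1) x(1), of "1/2" "1/2"] by simp
    moreover have "f j ?z > 0" if "j \<in> insert i V" for j
    proof -
      have jU: "j \<in> U" using that insert by auto
      have "f j ?z = f j y / 2 + f j x / 2"
        by (simp add: linear_add[OF f[OF jU]] linear_scale[OF f[OF jU]])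
      moreover have "f j y \<ge> 0" "f j x \<ge> 0" using sub y x jU by (auto simp: orthant_face_def)
      moreover have "f j y > 0 \<or> f j x > 0" using that y \<open>f i x > 0\<close> by auto
      ultimately show ?thesis by linarith
    qed
    ultimately show ?case by blast
  qed
  from this[of "U - J'"] U(1) obtain y where y: "y \<in> G" "\<And>i. i \<in> U - J' \<Longrightarrow> f i y > 0" by auto
  have "z \<in> G" if z: "z \<in> orthant_face U f J'" for z
  proof (cases "z = y")
    case False
    obtain \<epsilon> where \<epsilon>: "\<epsilon> > 0" "\<forall>i\<in>U - J'. \<epsilon> * f i z \<le> f i y"
      using small_scale[of "U - J'" "\<lambda>i. f i y" "\<lambda>i. f i z"] U(1) y(2) by auto
    \<comment> \<open>The segment from \<open>z\<close> to \<open>y\<close> is prolonged a little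
      beyond \<open>y\<close>. For small \<epsilon> it stays in the cone, and the face property at
      \<open>y\<close> gives \<open>z \<in> G\<close>.\<close>
    define z' where "z' = y + \<epsilon> *\<^sub>R (y - z)"
    have val: "f i z' = (1 + \<epsilon>) * f i y - \<epsilon> * f i z" if "i \<in> U" for i
      by (simp add: z'_def linear_add[OF f[OF that]] linear_scale[OF f[OF that]] linear_diff[OF f[OF that]] algebra_simps)
    have zero: "f i z' = 0" if "i \<in> J'" for i
      using that z y(1) val[of i] by (auto simp: J'_def orthant_face_def)
    have "f i z' \<ge> 0" if "i \<in> U" for i
    proof (cases "i \<in> J'")
      case True
      then show ?thesis using zero by simp
    next
      case False
      have "f i y > 0" using y(2) False that by auto
      then have "\<epsilon> * f i y > 0" using \<epsilon>(1) by simp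
      moreover have "\<epsilon> * f i z \<le> f i y" using \<epsilon>(2) False that by auto
      ultimately show ?thesis using val[OF that] by (simp add: algebra_simps)
    qed
    then have z'C: "z' \<in> ?C" using zero JJ by (auto simp: orthant_face_def)
    have zC: "z \<in> ?C" using z JJ by (auto simp: orthant_face_def)
    have "y \<in> open_segment z z'"
      unfolding in_segment
    proof (intro conjI exI[of _ "1 / (1 + \<epsilon>)"])
      show "z \<noteq> z'"
      proof
        assume "z = z'"
        then have "(1 + \<epsilon>) *\<^sub>R (y - z) = 0" by (simp add: z'_def algebra_simps)
        then show False using False \<epsilon>(1) by simp
      qed
      have s: "1 - 1 / (1 + \<epsilon>) = \<epsilon> / (1 + \<epsilon>)" using \<epsilon>(1) by (simp add: field_simps)
      have "(1 + \<epsilon>) *\<^sub>R y = \<epsilon> *\<^sub>R z + z'" by (simp add: z'_def algebra_simps)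
      then have "(1 / (1 + \<epsilon>)) *\<^sub>R ((1 + \<epsilon>) *\<^sub>R y) = (1 / (1 + \<epsilon>)) *\<^sub>R (\<epsilon> *\<^sub>R z + z')" by (simp only:)
      then show "y = (1 - 1 / (1 + \<epsilon>)) *\<^sub>R z + (1 / (1 + \<epsilon>)) *\<^sub>R z'"
        unfolding s using \<epsilon>(1) by (simp add: scaleR_add_right)
    qed (use \<epsilon>(1) in auto)
    then show ?thesis using G(1) zC z'C y(1) unfolding face_of_def by blast
  qed (use y in simp)
  then have "orthant_face U f J' \<subseteq> G" by blast
  moreover have "G \<subseteq> orthant_face U f J'"
  proof
    fix x assume x: "x \<in> G"
    then have "x \<in> ?C" using sub by blast
    then show "x \<in> orthant_face U f J'" using x by (simp add: orthant_face_def J'_def)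
  qed
  ultimately show ?thesis using JJ by blast
qed

text \<open>The linear part is the common kernel of all functionals, and the dual vectors with index
  outside \<open>J\<close> are the generators modulo it.\<close>

lemma simplicial_orthant_face:
  fixes f :: "'i \<Rightarrow> 'a::real_vector \<Rightarrow> real"
  assumes U: "finite U" "J \<subseteq> U" and f: "\<And>i. i \<in> U \<Longrightarrow> linear (f i)"
    and b: "\<And>i j. i \<in> U \<Longrightarrow> j \<in> U \<Longrightarrow> f i (b j) = (if i = j then 1 else 0)"
  shows "simplicial_cone (orthant_face U f J)"
proof -
  define L where "L = {x. \<forall>i\<in>U. f i x = 0}"
  let ?V = "U - J"
  have inj: "inj_on b ?V"
  proof (rule inj_onI, rule ccontr)
    fix i j assume ij: "i \<in> ?V" "j \<in> ?V" "b i = b j" "i \<noteq> j"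
    then have "f i (b i) = 1" "f i (b j) = 0" using b[of i i] b[of i j] by auto
    then show False using ij(3) by simp
  qed
  have fs: "f i (\<Sum>x\<in>b ` ?V. c x *\<^sub>R x) = (if i \<in> ?V then c (b i) else 0)" if i: "i \<in> U" for i c
  proof -
    have "f i (\<Sum>x\<in>b ` ?V. c x *\<^sub>R x) = (\<Sum>j\<in>?V. c (b j) * f i (b j))"
      by (simp add: sum.reindex[OF inj] linear_sum[OF f[OF i]] linear_scale[OF f[OF i]])
    also have "\<dots> = (\<Sum>j\<in>?V. if j = i then c (b i) else 0)"
      by (rule sum.cong) (use b i in auto)
    finally show ?thesis using U(1) by simp
  qed
  have sub: "subspace L"
    unfolding subspace_def L_def by (auto simp: linear_add[OF f] linear_scale[OF f] linear_0[OF f])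
  have "orthant_face U f J = {l + (\<Sum>x\<in>b ` ?V. c x *\<^sub>R x) |l c. l \<in> L \<and> (\<forall>x\<in>b ` ?V. c x \<ge> 0)}" (is "_ = ?R")
  proof (intro equalityI subsetI)
    fix x assume x: "x \<in> orthant_face U f J"
    define c where "c y = f (the_inv_into ?V b y) x" for y
    have cb: "c (b i) = f i x" if "i \<in> ?V" for i
      using the_inv_into_f_f[OF inj that] by (simp add: c_def)
    define l where "l = x - (\<Sum>y\<in>b ` ?V. c y *\<^sub>R y)"
    have "f i l = 0" if i: "i \<in> U" for i
      using x i cb[of i] by (auto simp: l_def linear_diff[OF f[OF i]] fs[OF i] orthant_face_def)
    then have "l \<in> L" by (simp add: L_def)
    moreover have "\<forall>y\<in>b ` ?V. c y \<ge> 0" using cb x by (auto simp: orthant_face_def)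
    moreover have "x = l + (\<Sum>y\<in>b ` ?V. c y *\<^sub>R y)" by (simp add: l_def)
    ultimately show "x \<in> ?R" by blast
  next
    fix x assume "x \<in> ?R"
    then obtain l c where x: "x = l + (\<Sum>x\<in>b ` ?V. c x *\<^sub>R x)" "l \<in> L" "\<forall>x\<in>b ` ?V. c x \<ge> 0" by blast
    have "f i x = (if i \<in> ?V then c (b i) else 0)" if i: "i \<in> U" for i
      using x i by (simp only: x(1) linear_add[OF f[OF i]] fs[OF i]) (simp add: L_def)
    then show "x \<in> orthant_face U f J" using x(3) U(2) by (auto simp: orthant_face_def)
  qed
  moreover have "\<forall>c. (\<Sum>x\<in>b ` ?V. c x *\<^sub>R x) \<in> L \<longrightarrow> (\<forall>x\<in>b ` ?V. c x = 0)"
    using fs by (auto simp: L_def)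
  ultimately show ?thesis
    unfolding simplicial_cone_def using sub U(1) by (intro exI[of _ L] exI[of _ "b ` ?V"]) auto
qed

text \<open>The intersection axiom of a fan thus has to be checked for the chambers only, and passes
  to all of their faces.\<close>

lemma face_Int_faces:
  assumes "F face_of C" "G face_of D" "(C \<inter> D) face_of C" "(C \<inter> D) face_of D"
  shows "(F \<inter> G) face_of F"
proof -
  have F: "F \<subseteq> C" and G: "G \<subseteq> D" using assms face_of_imp_subset by auto
  have "(C \<inter> D) \<inter> G face_of D" using face_of_Int assms(2,4) by blast
  then have "(C \<inter> D) \<inter> G face_of (C \<inter> D)" by (rule face_of_subset) auto
  then have "(C \<inter> D) \<inter> G face_of C" using face_of_trans assms(3) by blast
  then have "F \<inter> ((C \<inter> D) \<inter> G) face_of C" using face_of_Int assms(1) by blast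
  then have "F \<inter> ((C \<inter> D) \<inter> G) face_of F" by (rule face_of_subset) (use F in auto)
  moreover have "F \<inter> ((C \<inter> D) \<inter> G) = F \<inter> G" using F G by auto
  ultimately show ?thesis by simp
qed

section \<open>The cluster fan\<close>

locale cluster_fan =
  fixes \<Gamma> :: "('v::euclidean_space, 'i::finite, 'c) fixed_data" and s :: "('v, 'i, 'c) seed"
    and S :: "'i list \<Rightarrow> ('v \<Rightarrow>\<^sub>L real) set" and U and e
  defines "U \<equiv> idx_uf \<Gamma>" and "e w \<equiv> vec (seed_at \<Gamma> s w)"
  assumes \<Gamma>: "generalized_fixed_data \<Gamma>"
    and walls: "wall_family \<Gamma> s S"
    and dual_exists: "\<And>w. w \<in> lists U \<Longrightarrow> \<exists>co. cluster_form.dual_family U (e w) co"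
begin

lemma wall_pos: "w \<in> lists U \<Longrightarrow> (\<And>i. i \<in> U \<Longrightarrow> blinfun_apply x (e w i) > 0) \<Longrightarrow> x \<notin> S w"
  and wall_zero: "w \<in> lists U \<Longrightarrow> i \<in> U \<Longrightarrow> blinfun_apply x (e w i) = 0 \<Longrightarrow> x \<in> S w"
  and wall_mut: "w \<in> lists U \<Longrightarrow> k \<in> U \<Longrightarrow> x \<in> S w \<longleftrightarrow> trop_mutation \<Gamma> (seed_at \<Gamma> s w) k x \<in> S (w @ [k])"
  using walls unfolding wall_family_def U_def e_def by blast+

abbreviation "pt \<equiv> trop_point \<Gamma> s"

abbreviation T :: "'i list \<Rightarrow> 'i \<Rightarrow> ('v \<Rightarrow>\<^sub>L real) \<Rightarrow> ('v \<Rightarrow>\<^sub>L real)" where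
  "T w k \<equiv> trop_mutation \<Gamma> (seed_at \<Gamma> s w) k"

definition ev :: "'i list \<Rightarrow> 'i \<Rightarrow> ('v \<Rightarrow>\<^sub>L real) \<Rightarrow> real" where
  "ev w i x = blinfun_apply x (e w i)"

lemma ev_linear: "linear (ev w i)"
  by (rule linearI) (auto simp: ev_def blinfun.add_left blinfun.scaleR_left)

lemma finU: "finite U" by simp

text \<open>For \<open>c = 1\<close> this is the linear map that the tropical mutation follows on
  its bent side, for \<open>c = -1\<close> the inverse of that map.\<close>

definition bend :: "real \<Rightarrow> 'i list \<Rightarrow> 'i \<Rightarrow> ('v \<Rightarrow>\<^sub>L real) \<Rightarrow> ('v \<Rightarrow>\<^sub>L real)" where
  "bend c w k x = x + (c * real (weight \<Gamma> k) * ev w k x) *\<^sub>R vdual \<Gamma> (seed_at \<Gamma> s w) k"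

lemma bend_linear: "linear (bend c w k)"
  by (rule linearI)
     (simp_all add: bend_def linear_add[OF ev_linear] linear_scale[OF ev_linear] algebra_simps)

lemma bend_ev [simp]: "ev w k (bend c w k x) = ev w k x"
  using fixed_data_skew[OF \<Gamma>, of "e w k" "e w k"]
  by (simp add: bend_def ev_def e_def vdual_apply[OF \<Gamma>] blinfun.add_left blinfun.scaleR_left)

lemma bend_bend [simp]: "bend 1 w k (bend (-1) w k x) = x" "bend (-1) w k (bend 1 w k x) = x"
  by (simp_all add: bend_def[of _ w k "bend _ w k x"]) (simp_all add: bend_def)

lemma bend_bij: "bij (bend 1 w k)" "bij (bend (-1) w k)"
  by (rule o_bij[where g = "bend (-1) w k"], auto simp: fun_eq_iff)
     (rule o_bij[where g = "bend 1 w k"], auto simp: fun_eq_iff)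

lemma bend_0: "ev w k x = 0 \<Longrightarrow> bend c w k x = x"
  by (simp add: bend_def)

lemma T_bend: "T w k x = (if ev w k x \<ge> 0 then bend 1 w k x else x)"
  by (simp add: trop_mutation_def bend_def ev_def e_def weight_def blinfun.scaleR_right mult.assoc)

lemma T_bij: "bij (T w k)"
  by (rule o_bij[where g = "\<lambda>x. if ev w k x \<ge> 0 then bend (-1) w k x else x"])
     (auto simp: fun_eq_iff T_bend)

section \<open>Coordinate changes between the copies\<close>

definition chart :: "'i list \<Rightarrow> ('v \<Rightarrow>\<^sub>L real) \<Rightarrow> ('v \<Rightarrow>\<^sub>L real)" where
  "chart w = rec_list id (\<lambda>k r f. T (rev r) k \<circ> f) (rev w)"

lemma chart_Nil: "chart [] x = x" and chart_snoc: "chart (w @ [k]) x = T w k (chart w x)"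
  by (simp_all add: chart_def)

lemma chart_bij: "bij (chart w)"
proof (induction w rule: rev_induct)
  case Nil
  have "chart [] = id" by (auto simp: chart_Nil)
  then show ?case using bij_id by (simp only:)
next
  case (snoc k w)
  have "chart (w @ [k]) = T w k \<circ> chart w" by (auto simp: chart_snoc)
  then show ?case using bij_comp[OF snoc T_bij] by (simp only:)
qed

lemmas chart_inv = surj_f_inv_f[OF bij_is_surj[OF chart_bij]]

definition trans :: "'i list \<Rightarrow> 'i list \<Rightarrow> ('v \<Rightarrow>\<^sub>L real) \<Rightarrow> ('v \<Rightarrow>\<^sub>L real)" where
  "trans w v x = chart v (inv (chart w) x)"

lemma trans_comp: "trans v u (trans w v x) = trans w u x"
  by (simp add: trans_def inv_f_f[OF bij_is_inj[OF chart_bij]])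

lemma trans_self: "trans w w x = x"
  by (simp add: trans_def chart_inv)

lemma trans_iff: "trans w u x = trans v u y \<longleftrightarrow> y = trans w v x"
  by (metis trans_comp trans_self)

lemma trans_snoc: "trans w (v @ [k]) x = T v k (trans w v x)"
  by (simp add: trans_def chart_snoc)

text \<open>The point of the root copy under a point is invariant under gluing. As the words form a
  tree, there is one composite map per word and nothing else is identified. The alternative
  \<open>p = q\<close> accounts for words outside \<open>lists U\<close>.\<close>

lemma glue_chart:
  assumes "equivclp (glue \<Gamma> s) p q"
  shows "p = q \<or> (fst p \<in> lists U \<and> fst q \<in> lists U \<and> inv (chart (fst p)) (snd p) = inv (chart (fst q)) (snd q))"
  using assms
proof (induction rule: equivclp_induct)
  case base
  then show ?case by simp
next
  case (step y z)
  have *: "fst a \<in> lists U \<and> fst b \<in> lists U \<and> inv (chart (fst a)) (snd a) = inv (chart (fst b)) (snd b)"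
    if "glue \<Gamma> s a b" for a b
    using that
  proof cases
    case (1 w k m)
    have "inv (chart (w @ [k])) (T w k m) = inv (chart w) m"
    proof (rule inv_f_eq[OF bij_is_inj[OF chart_bij]])
      show "chart (w @ [k]) (inv (chart w) m) = T w k m"
        by (simp add: chart_snoc chart_inv)
    qed
    then show ?thesis using 1 by (simp add: U_def)
  qed
  from step(2) have "fst y \<in> lists U \<and> fst z \<in> lists U \<and> inv (chart (fst y)) (snd y) = inv (chart (fst z)) (snd z)"
    using *[of y z] *[of z y] by auto
  then show ?case using step(3) by auto
qed

lemma equiv_chart: "w \<in> lists U \<Longrightarrow> equivclp (glue \<Gamma> s) ([], x) (w, chart w x)"
proof (induction w rule: rev_induct)
  case Nil
  then show ?case by (simp add: chart_Nil)
next
  case (snoc k w)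
  have "glue \<Gamma> s (w, chart w x) (w @ [k], T w k (chart w x))"
    using snoc.prems by (intro glue.intros) (auto simp: U_def)
  then have "equivclp (glue \<Gamma> s) (w, chart w x) (w @ [k], chart (w @ [k]) x)"
    unfolding chart_snoc by (rule r_into_equivclp)
  then show ?case using snoc equivclp_trans by fastforce
qed

lemma equiv_iff:
  assumes "w \<in> lists U" "v \<in> lists U"
  shows "equivclp (glue \<Gamma> s) (w, x) (v, y) \<longleftrightarrow> y = trans w v x"
proof
  assume "equivclp (glue \<Gamma> s) (w, x) (v, y)"
  from glue_chart[OF this] show "y = trans w v x"
  proof
    assume "(w, x) = (v, y)"
    then show ?thesis by (simp add: trans_self)
  next
    assume "fst (w, x) \<in> lists U \<and> fst (v, y) \<in> lists U \<and> inv (chart (fst (w, x))) (snd (w, x)) = inv (chart (fst (v, y))) (snd (v, y))"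
    then show ?thesis by (simp add: trans_def chart_inv)
  qed
next
  assume y: "y = trans w v x"
  have "equivclp (glue \<Gamma> s) ([], inv (chart w) x) (w, x)" "equivclp (glue \<Gamma> s) ([], inv (chart w) x) (v, y)"
    using equiv_chart[OF assms(1), of "inv (chart w) x"] equiv_chart[OF assms(2), of "inv (chart w) x"]
    by (simp_all add: y trans_def chart_inv)
  then show "equivclp (glue \<Gamma> s) (w, x) (v, y)" by (meson equivclp_sym equivclp_trans)
qed

lemma trop_point_eq_iff:
  assumes "w \<in> lists U" "v \<in> lists U"
  shows "pt w x = pt v y \<longleftrightarrow> y = trans w v x"
proof -
  have "pt w x = pt v y \<longleftrightarrow> equivclp (glue \<Gamma> s) (w, x) (v, y)"
  proof
    assume "pt w x = pt v y"
    moreover have "(v, y) \<in> pt v y" by (simp add: trop_point_def)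
    ultimately have "(v, y) \<in> pt w x" by (simp only:)
    then show "equivclp (glue \<Gamma> s) (w, x) (v, y)" by (simp add: trop_point_def)
  next
    assume "equivclp (glue \<Gamma> s) (w, x) (v, y)"
    then show "pt w x = pt v y"
      unfolding trop_point_def by (auto intro: equivclp_trans dest: equivclp_sym)
  qed
  then show ?thesis using equiv_iff[OF assms] by simp
qed

lemma vimage_trop_point:
  assumes "w \<in> lists U" "v \<in> lists U"
  shows "pt v -` (pt w ` X) = trans w v ` X"
  using trop_point_eq_iff[OF assms] by (auto simp: image_iff)

lemma trop_point_in_space: "w \<in> lists U \<Longrightarrow> pt w x \<in> trop_space \<Gamma> s"
  unfolding trop_space_def trop_point_def quotient_def U_def by auto

lemma S_trans:
  assumes "w \<in> lists U" "v \<in> lists U"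
  shows "trans w v x \<in> S v \<longleftrightarrow> x \<in> S w"
proof -
  have "chart u y \<in> S u \<longleftrightarrow> y \<in> S []" if "u \<in> lists U" for u y
    using that
  proof (induction u rule: rev_induct)
    case (snoc k u)
    then show ?case using wall_mut[of u k "chart u y"] by (simp add: chart_snoc)
  qed (simp add: chart_Nil)
  from this[OF assms(1), of "inv (chart w) x"] this[OF assms(2), of "inv (chart w) x"]
  show ?thesis by (simp add: trans_def chart_inv)
qed

abbreviation cface :: "'i list \<Rightarrow> 'i set \<Rightarrow> ('v \<Rightarrow>\<^sub>L real) set" where
  "cface w J \<equiv> orthant_face U (ev w) J"

abbreviation C :: "'i list \<Rightarrow> ('v \<Rightarrow>\<^sub>L real) set" where
  "C w \<equiv> cface w {}"

lemma dual_vectors: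
  assumes "w \<in> lists U"
  obtains b where "\<And>i j. i \<in> U \<Longrightarrow> j \<in> U \<Longrightarrow> ev w i (b j) = (if i = j then 1 else 0)"
proof -
  interpret cluster_form "form \<Gamma>" U "weight \<Gamma>" unfolding U_def by (rule cluster_form_fixed_data[OF \<Gamma>])
  obtain co where co: "dual_family (e w) co" using dual_exists[OF assms] by blast
  have "blinfun_apply (Blinfun (co j)) n = co j n" if "j \<in> U" for j n
    using co that by (simp add: dual_family_def bounded_linear_Blinfun_apply linear_conv_bounded_linear)
  then show thesis using co by (intro that[of "\<lambda>j. Blinfun (co j)"]) (auto simp: ev_def dual_family_def)
qed

lemma interior_point:
  assumes "w \<in> lists U"
  obtains x where "\<And>i. i \<in> U \<Longrightarrow> ev w i x > 0"
proof -
  obtain b where b: "\<And>i j. i \<in> U \<Longrightarrow> j \<in> U \<Longrightarrow> ev w i (b j) = (if i = j then 1 else 0)"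
    using dual_vectors[OF assms] by blast
  have "ev w i (\<Sum>j\<in>U. b j) > 0" if i: "i \<in> U" for i
  proof -
    have "ev w i (\<Sum>j\<in>U. b j) = (\<Sum>j\<in>U. if j = i then 1 else 0)"
      unfolding linear_sum[OF ev_linear] by (rule sum.cong) (use b i in auto)
    then show ?thesis using i by simp
  qed
  then show thesis by (rule that)
qed

text \<open>The open chamber avoids the wall set while the hyperplane is contained in it, so the
  functional has no zero on the open chamber. Linearity of the coordinate change and convexity then
  fix its sign.\<close>

lemma same_side:
  assumes w: "w \<in> lists U" and v: "v \<in> lists U" and i: "i \<in> U"
    and L: "linear L" "\<And>x. x \<in> C w \<Longrightarrow> trans w v x = L x"
  shows "(\<forall>x\<in>C w. ev v i (L x) \<ge> 0) \<or> (\<forall>x\<in>C w. ev v i (L x) \<le> 0)"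
proof -
  define f where "f x = ev v i (L x)" for x
  have f: "linear f" using linear_compose[OF L(1) ev_linear[of v i]] by (simp add: f_def[abs_def] o_def)
  have ne: "f x \<noteq> 0" if x: "\<And>j. j \<in> U \<Longrightarrow> ev w j x > 0" for x
  proof
    assume "f x = 0"
    have xC: "x \<in> C w" using x by (auto simp: orthant_face_def intro: less_imp_le)
    have "x \<notin> S w" by (rule wall_pos[OF w]) (use x in \<open>simp add: ev_def\<close>)
    then have "L x \<notin> S v" using S_trans[OF w v, of x] L(2)[OF xC] by simp
    then show False using wall_zero[OF v i, of "L x"] \<open>f x = 0\<close> by (simp add: f_def ev_def)
  qed
  obtain x0 where x0: "\<And>j. j \<in> U \<Longrightarrow> ev w j x0 > 0" using interior_point[OF w] by blast
  have mix: "f x * f x0 \<ge> 0" if x: "x \<in> C w" for x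
  proof (rule ccontr)
    assume "\<not> f x * f x0 \<ge> 0"
    then have opp: "(f x < 0 \<and> f x0 > 0) \<or> (f x > 0 \<and> f x0 < 0)"
      by (auto simp: not_le mult_less_0_iff)
    \<comment> \<open>The zero of \<open>f\<close> on the segment from \<open>x0\<close> to
      \<open>x\<close>. Since \<open>x0\<close> has a positive share in it, it is a point of the
      open chamber.\<close>
    define t where "t = f x0 / (f x0 - f x)"
    have t: "0 < t" "t < 1" "(1 - t) * f x0 + t * f x = 0"
      using opp by (auto simp: t_def field_simps)
    have "ev w j ((1 - t) *\<^sub>R x0 + t *\<^sub>R x) > 0" if j: "j \<in> U" for j
    proof -
      have "(1 - t) * ev w j x0 > 0" using t x0[OF j] by simp
      moreover have "t * ev w j x \<ge> 0" using t x j by (simp add: orthant_face_def)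
      ultimately show ?thesis by (simp add: linear_add[OF ev_linear] linear_scale[OF ev_linear])
    qed
    from ne[OF this] show False using t(3) by (simp add: linear_add[OF f] linear_scale[OF f])
  qed
  show ?thesis
  proof (cases "f x0 > 0")
    case True
    then show ?thesis using mix unfolding f_def by (auto simp: zero_le_mult_iff)
  next
    case False
    then have "f x0 < 0" using ne[OF x0] by force
    then show ?thesis using mix unfolding f_def by (auto simp: zero_le_mult_iff)
  qed
qed

text \<open>
  A chamber is carried from its own chart to the root of the mutation tree and from there to the
  chart \<open>v\<close>. No step bends it, as it stays on one side of the hyperplane where the step bends.
\<close>

lemma trans_linear:
  assumes w: "w \<in> lists U" and v: "v \<in> lists U"
  shows "\<exists>L. linear L \<and> bij L \<and> (\<forall>x\<in>C w. trans w v x = L x)"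
proof -
  define P where "P u \<longleftrightarrow> (\<exists>L. linear L \<and> bij L \<and> (\<forall>x\<in>C w. trans w u x = L x))" for u
  have bent: "P u" if "linear L" "bij L" "\<forall>x\<in>C w. trans w u x = bend c u' k (L x)" "bij (bend c u' k)" for L u u' k c
    unfolding P_def using linear_compose[OF that(1) bend_linear[of c u' k]] bij_comp[OF that(2,4)] that(3)
    by (intro exI[of _ "bend c u' k \<circ> L"]) simp
  have up: "P (u @ [k])" if u: "u \<in> lists U" "k \<in> U" "P u" for u k
  proof -
    obtain L where L: "linear L" "bij L" "\<And>x. x \<in> C w \<Longrightarrow> trans w u x = L x" using u(3) by (auto simp: P_def)
    from same_side[OF w u(1,2) L(1,3)] show "P (u @ [k])"
    proof
      assume "\<forall>x\<in>C w. ev u k (L x) \<ge> 0"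
      then show ?thesis by (intro bent[OF L(1,2) _ bend_bij(1)[of u k]]) (simp add: trans_snoc L(3) T_bend)
    next
      assume neg: "\<forall>x\<in>C w. ev u k (L x) \<le> 0"
      have "trans w (u @ [k]) x = L x" if x: "x \<in> C w" for x
        using neg[rule_format, OF x] bend_0[of u k "L x"] by (simp add: trans_snoc L(3)[OF x] T_bend)
      then show ?thesis unfolding P_def using L by blast
    qed
  qed
  have down: "P u" if u: "u \<in> lists U" "k \<in> U" "P (u @ [k])" for u k
  proof -
    obtain L where L: "linear L" "bij L" "\<And>x. x \<in> C w \<Longrightarrow> trans w (u @ [k]) x = L x" using u(3) by (auto simp: P_def)
    \<comment> \<open>Mutation negates the vector at \<open>k\<close>, so the side needed for
      inverting the step can be read off in the chart \<open>u @ [k]\<close>, where linearity is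
      already known.\<close>
    have flip: "ev (u @ [k]) k y = - ev u k y" for y
      by (simp add: ev_def e_def seed_at_snoc mutate_def blinfun.minus_right)
    have inv: "trans w u x = (if ev u k (L x) \<ge> 0 then bend (-1) u k (L x) else L x)" if x: "x \<in> C w" for x
    proof -
      have "T u k (trans w u x) = L x" using L(3)[OF x] by (simp add: trans_snoc)
      moreover have "T u k (if ev u k (L x) \<ge> 0 then bend (-1) u k (L x) else L x) = L x" by (simp add: T_bend)
      ultimately show ?thesis using injD[OF bij_is_inj[OF T_bij]] by metis
    qed
    have uk: "u @ [k] \<in> lists U" using u by auto
    from same_side[OF w uk u(2) L(1,3)] show "P u"
    proof
      assume "\<forall>x\<in>C w. ev (u @ [k]) k (L x) \<ge> 0"
      then have "\<forall>x\<in>C w. trans w u x = L x" using inv bend_0 by (auto simp: flip)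
      then show ?thesis unfolding P_def using L by blast
    next
      assume "\<forall>x\<in>C w. ev (u @ [k]) k (L x) \<le> 0"
      then show ?thesis by (intro bent[OF L(1,2) _ bend_bij(2)[of u k]]) (simp add: inv flip)
    qed
  qed
  have "P w" unfolding P_def by (intro exI[of _ id]) (auto simp: trans_self linear_id)
  have "u \<in> lists U \<Longrightarrow> P u \<Longrightarrow> P []" for u
  proof (induction u rule: rev_induct)
    case (snoc k u)
    then show ?case using down[of u k] by auto
  qed
  from this[OF w \<open>P w\<close>] have P0: "P []" .
  have "u \<in> lists U \<Longrightarrow> P u" for u
  proof (induction u rule: rev_induct)
    case (snoc k u)
    then show ?case using up[of u k] by auto
  qed (rule P0)
  then show ?thesis using v by (simp add: P_def)
qed

text \<open>By \<open>same_side\<close> every coordinate of the chart \<open>v\<close> has a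
  constant sign on the chamber. Those that are not nonnegative must vanish at a point of
  \<open>C v\<close>, and their zero set is a face.\<close>

lemma meet_face:
  assumes w: "w \<in> lists U" and v: "v \<in> lists U"
  shows "{x\<in>C w. trans w v x \<in> C v} face_of C w"
proof -
  obtain L where L: "linear L" "\<And>x. x \<in> C w \<Longrightarrow> trans w v x = L x" using trans_linear[OF w v] by blast
  define N where "N = {i\<in>U. \<not> (\<forall>x\<in>C w. ev v i (L x) \<ge> 0)}"
  have N: "\<forall>x\<in>C w. ev v i (L x) \<le> 0" if "i \<in> N" for i
    using same_side[OF w v _ L] that by (auto simp: N_def)
  have "{x\<in>C w. trans w v x \<in> C v} = {x\<in>C w. \<forall>i\<in>N. ev v i (L x) = 0}"
  proof (intro equalityI subsetI)
    fix x assume x: "x \<in> {x\<in>C w. trans w v x \<in> C v}"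
    then have "L x \<in> C v" using L(2) by auto
    then have "ev v i (L x) \<ge> 0" if "i \<in> N" for i using that by (simp add: orthant_face_def N_def)
    moreover have "ev v i (L x) \<le> 0" if "i \<in> N" for i using N[OF that] x by blast
    ultimately have "ev v i (L x) = 0" if "i \<in> N" for i using that by (meson order_antisym)
    then show "x \<in> {x\<in>C w. \<forall>i\<in>N. ev v i (L x) = 0}" using x by auto
  next
    fix x assume x: "x \<in> {x\<in>C w. \<forall>i\<in>N. ev v i (L x) = 0}"
    then have "ev v i (L x) \<ge> 0" if "i \<in> U" for i using that by (cases "i \<in> N") (auto simp: N_def)
    then show "x \<in> {x\<in>C w. trans w v x \<in> C v}" using x L(2) by (auto simp: orthant_face_def)
  qed
  moreover have "\<dots> face_of C w"
  proof (rule zero_set_face)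
    show "convex (C w)" by (rule convex_orthant) (auto intro: ev_linear)
    show "linear (\<lambda>x. ev v i (L x))" for i using linear_compose[OF L(1) ev_linear[of v i]] by (simp add: o_def)
    show "(\<forall>x\<in>C w. ev v i (L x) \<ge> 0) \<or> (\<forall>x\<in>C w. ev v i (L x) \<le> 0)" if "i \<in> N" for i
      using N[OF that] by blast
  qed
  ultimately show ?thesis by simp
qed

section \<open>The fan of all faces of chambers\<close>

definition fan :: "('i list \<times> ('v \<Rightarrow>\<^sub>L real)) set set set" where
  "fan = {pt w ` cface w J | w J. w \<in> lists U \<and> J \<subseteq> U}"

lemma cface_sub: "J \<subseteq> J' \<Longrightarrow> cface w J' \<subseteq> cface w J"
  by (auto simp: orthant_face_def)

lemma chamber_eq: "fg_chamber \<Gamma> s w = pt w ` C w"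
  by (simp add: fg_chamber_def orthant_face_def ev_def e_def U_def)

text \<open>The coordinate change agrees on the chamber with a linear bijection, so one system of
  functionals with dual vectors describes the chamber and all of its faces in the chart
  \<open>v\<close>.\<close>

lemma chart_cone:
  assumes w: "w \<in> lists U" and v: "v \<in> lists U"
  obtains \<phi> b where "\<And>i. linear (\<phi> i)" "\<And>J. trans w v ` cface w J = orthant_face U \<phi> J"
    "\<And>i j. i \<in> U \<Longrightarrow> j \<in> U \<Longrightarrow> \<phi> i (b j) = (if i = j then 1 else 0 :: real)"
proof -
  obtain L where L: "linear L" "bij L" "\<And>x. x \<in> C w \<Longrightarrow> trans w v x = L x" using trans_linear[OF w v] by blast
  obtain b where b: "\<And>i j. i \<in> U \<Longrightarrow> j \<in> U \<Longrightarrow> ev w i (b j) = (if i = j then 1 else 0)"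
    using dual_vectors[OF w] by blast
  have invL: "L (inv L x) = x" "inv L (L x) = x" for x
    using L(2) by (simp_all add: bij_is_surj bij_is_inj surj_f_inv_f)
  have "linear (inv L)"
    by (rule linearI; rule injD[OF bij_is_inj[OF L(2)]]; simp add: invL linear_add[OF L(1)] linear_scale[OF L(1)])
  then have "linear (\<lambda>x. ev w i (inv L x))" for i
    using linear_compose[OF _ ev_linear[of w i]] by (simp add: o_def)
  moreover have "trans w v ` cface w J = orthant_face U (\<lambda>i x. ev w i (inv L x)) J" for J
  proof -
    have "trans w v ` cface w J = L ` cface w J"
      using L(3) cface_sub[of "{}" J w] by (auto intro!: image_cong)
    also have "\<dots> = {x. inv L x \<in> cface w J}"
    proof (intro equalityI subsetI)
      fix x assume "x \<in> {x. inv L x \<in> cface w J}"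
      then have "L (inv L x) \<in> L ` cface w J" by blast
      then show "x \<in> L ` cface w J" by (simp only: invL)
    qed (auto simp: invL)
    finally show ?thesis by (simp add: orthant_face_def)
  qed
  ultimately show thesis using b invL by (intro that[of "\<lambda>i x. ev w i (inv L x)" "\<lambda>j. L (b j)"]) auto
qed

text \<open>\<open>meet_face\<close> lives in the chart of one of the chambers. The face it yields
  is some \<open>cface u K\<close>, which the coordinate change carries to a face of the chamber in
  the chart \<open>v\<close>.\<close>

lemma cone_faces:
  assumes v: "v \<in> lists U" and w: "w \<in> lists U" and w': "w' \<in> lists U" and J: "J \<subseteq> U" "J' \<subseteq> U"
  shows "(trans w v ` cface w J \<inter> trans w' v ` cface w' J') face_of trans w v ` cface w J"
proof -
  have top: "trans u v ` cface u K face_of trans u v ` C u" if u: "u \<in> lists U" "K \<subseteq> U" for u K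
    by (rule chart_cone[OF u(1) v]) (simp add: orthant_face_face[OF u(2)])
  have meet: "(trans u v ` C u \<inter> trans u' v ` C u') face_of trans u v ` C u"
    if u: "u \<in> lists U" "u' \<in> lists U" for u u'
  proof -
    let ?M = "{x\<in>C u. trans u u' x \<in> C u'}"
    obtain K where K: "K \<subseteq> U" "?M = {} \<or> ?M = cface u K"
      using faces_of_orthant_face[OF finU _ _ meet_face[OF u]] ev_linear by blast
    have M: "trans u v ` C u \<inter> trans u' v ` C u' = trans u v ` ?M"
    proof (intro equalityI subsetI)
      fix y assume "y \<in> trans u v ` C u \<inter> trans u' v ` C u'"
      then obtain x x' where x: "x \<in> C u" "y = trans u v x" "x' \<in> C u'" "y = trans u' v x'" by blast
      then have "x' = trans u u' x" using trans_iff[of u v x u' x'] by simp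
      then show "y \<in> trans u v ` ?M" using x by blast
    next
      fix y assume "y \<in> trans u v ` ?M"
      then obtain x where x: "x \<in> C u" "trans u u' x \<in> C u'" "y = trans u v x" by blast
      moreover have "y = trans u' v (trans u u' x)" using x(3) trans_comp by simp
      ultimately show "y \<in> trans u v ` C u \<inter> trans u' v ` C u'" by blast
    qed
    from K(2) show ?thesis
    proof
      assume "?M = {}"
      then have "trans u v ` ?M = {}" by (simp only: image_empty)
      then show ?thesis unfolding M by (simp only: empty_face_of)
    next
      assume "?M = cface u K"
      then show ?thesis unfolding M using top[OF u(1) K(1)] by (simp only:)
    qed
  qed
  show ?thesis
    by (rule face_Int_faces[OF top[OF w J(1)] top[OF w' J(2)] meet[OF w w']])
       (use meet[OF w' w] in \<open>simp add: Int_commute\<close>)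
qed

lemma fan_simplicial: "trop_simplicial_fan \<Gamma> s fan"
  unfolding trop_simplicial_fan_def
proof (intro conjI ballI)
  show "fan \<subseteq> Pow (trop_space \<Gamma> s)" using trop_point_in_space by (auto simp: fan_def)
  fix v assume "v \<in> lists (idx_uf \<Gamma>)"
  then have v: "v \<in> lists U" by (simp add: U_def)
  let ?F = "(\<lambda>F. pt v -` F) ` fan"
  have FF: "?F = {trans w v ` cface w J | w J. w \<in> lists U \<and> J \<subseteq> U}" (is "_ = ?K")
  proof -
    have "?F = {pt v -` (pt w ` cface w J) | w J. w \<in> lists U \<and> J \<subseteq> U}"
      by (auto simp: fan_def)
    also have "\<dots> = ?K"
      by (intro Collect_cong ex_cong1 iffI; elim conjE; intro conjI; simp only: vimage_trop_point[OF _ v])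
    finally show ?thesis .
  qed
  show "simplicial_fan ?F"
    unfolding simplicial_fan_def FF
  proof (intro conjI ballI allI impI)
    fix F assume "F \<in> ?K"
    then obtain w J where F: "F = trans w v ` cface w J" and w: "w \<in> lists U" and J: "J \<subseteq> U" by blast
    obtain \<phi> b where \<phi>: "\<And>i. linear (\<phi> i)" "\<And>J. trans w v ` cface w J = orthant_face U \<phi> J"
      "\<And>i j. i \<in> U \<Longrightarrow> j \<in> U \<Longrightarrow> \<phi> i (b j) = (if i = j then 1 else 0)"
      using chart_cone[OF w v] by blast
    show "simplicial_cone F"
      unfolding F \<phi>(2) by (rule simplicial_orthant_face[OF finU J \<phi>(1,3)])
    show "G \<in> ?K" if G: "G face_of F \<and> G \<noteq> {}" for G
    proof -
      obtain J' where "J' \<subseteq> U" "G = trans w v ` cface w J'"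
        using faces_of_orthant_face[of U J \<phi> G, OF finU J \<phi>(1)] G F \<phi>(2) by auto
      then show ?thesis using w by blast
    qed
    fix D assume "D \<in> ?K"
    then obtain w' J' where D: "D = trans w' v ` cface w' J'" "w' \<in> lists U" "J' \<subseteq> U" by blast
    show "(F \<inter> D) face_of F" unfolding F D(1) by (rule cone_faces[OF v w D(2) J D(3)])
    show "(F \<inter> D) face_of D" unfolding F D(1) using cone_faces[OF v D(2) w D(3) J] by (simp add: Int_commute)
  qed
qed

text \<open>An interior point of the smaller chamber avoids the wall sets, so none of its
  coordinates in the chart \<open>w'\<close> vanishes. This forces \<open>J = {}\<close>, and a face
  of \<open>C w'\<close> through such a point is all of \<open>C w'\<close>.\<close>

lemma chamber_maximal:
  assumes w: "w \<in> lists U" and w': "w' \<in> lists U" and J: "J \<subseteq> U"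
    and sub: "pt w ` C w \<subseteq> pt w' ` cface w' J"
  shows "pt w' ` cface w' J = pt w ` C w"
proof
  obtain x0 where x0: "\<And>i. i \<in> U \<Longrightarrow> ev w i x0 > 0" using interior_point[OF w] by blast
  have x0C: "x0 \<in> C w" using x0 by (auto simp: orthant_face_def intro: less_imp_le)
  have "x0 \<notin> S w" by (rule wall_pos[OF w]) (use x0 in \<open>simp add: ev_def\<close>)
  define y0 where "y0 = trans w w' x0"
  have y0S: "y0 \<notin> S w'" using S_trans[OF w w'] \<open>x0 \<notin> S w\<close> by (simp add: y0_def)
  obtain y where "y \<in> cface w' J" "pt w x0 = pt w' y" using sub x0C by blast
  then have y0J: "y0 \<in> cface w' J" using trop_point_eq_iff[OF w w'] by (simp add: y0_def)
  have y0n: "ev w' i y0 \<noteq> 0" if "i \<in> U" for i using wall_zero[OF w' that, of y0] y0S by (auto simp: ev_def)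
  have J0: "J = {}" using y0J y0n J by (auto simp: orthant_face_def)
  let ?M = "{y\<in>C w'. trans w' w y \<in> C w}"
  have y0M: "y0 \<in> ?M" using y0J J0 x0C by (simp add: y0_def trans_comp trans_self)
  then obtain K where K: "K \<subseteq> U" "?M = cface w' K"
    using faces_of_orthant_face[OF finU _ _ meet_face[OF w' w]] ev_linear by blast
  have "K = {}" using y0M y0n K unfolding K(2) by (auto simp: orthant_face_def)
  then have M: "?M = C w'" using K by simp
  show "pt w' ` cface w' J \<subseteq> pt w ` C w"
  proof
    fix p assume "p \<in> pt w' ` cface w' J"
    then obtain y where y: "p = pt w' y" "y \<in> C w'" using J0 by blast
    then have "trans w' w y \<in> C w" using M by blast
    moreover have "p = pt w (trans w' w y)" using y trop_point_eq_iff[OF w' w] by simp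
    ultimately show "p \<in> pt w ` C w" by blast
  qed
qed (rule sub)

lemma fan_maximal: "maximal_cones fan = fg_chamber \<Gamma> s ` lists U"
proof (intro equalityI subsetI)
  fix F assume F: "F \<in> maximal_cones fan"
  then obtain w J where w: "F = pt w ` cface w J" "w \<in> lists U" "J \<subseteq> U"
    by (auto simp: maximal_cones_def fan_def)
  have "F \<subseteq> fg_chamber \<Gamma> s w" unfolding w(1) chamber_eq using cface_sub[of "{}" J w] by blast
  moreover have "fg_chamber \<Gamma> s w \<in> fan" unfolding chamber_eq fan_def using w(2) by blast
  ultimately have "fg_chamber \<Gamma> s w = F" using F by (auto simp: maximal_cones_def)
  then show "F \<in> fg_chamber \<Gamma> s ` lists U" using w(2) by blast
next
  fix F assume "F \<in> fg_chamber \<Gamma> s ` lists U"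
  then obtain w where w: "w \<in> lists U" "F = pt w ` C w" using chamber_eq by blast
  have "F \<in> fan" unfolding w(2) fan_def using w(1) by blast
  moreover have "D = F" if "D \<in> fan" "F \<subseteq> D" for D
  proof -
    obtain w' J where D: "D = pt w' ` cface w' J" "w' \<in> lists U" "J \<subseteq> U"
      using \<open>D \<in> fan\<close> by (auto simp: fan_def)
    show ?thesis using chamber_maximal[OF w(1) D(2,3)] \<open>F \<subseteq> D\<close> unfolding w(2) D(1) .
  qed
  ultimately show "F \<in> maximal_cones fan" by (auto simp: maximal_cones_def)
qed

end

theorem theorem3p31:
  fixes \<Gamma> :: "('v::euclidean_space, 'i::finite, 'c) fixed_data"
    and s :: "('v, 'i, 'c) seed"
  assumes "generalized_fixed_data \<Gamma>"
    and "torus_seed \<Gamma> s"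
    and "reciprocal_seed \<Gamma> s"
  shows "\<exists>F. trop_simplicial_fan \<Gamma> s F \<and>
             maximal_cones F = fg_chamber \<Gamma> s ` lists (idx_uf \<Gamma>)"
proof -
  obtain S where S: "wall_family \<Gamma> s S"
    using wall_family_exists(1)[OF assms(1,2)] by blast
  interpret cluster_fan \<Gamma> s S "idx_uf \<Gamma>" "\<lambda>w. vec (seed_at \<Gamma> s w)"
    by unfold_locales (use S assms(1) wall_family_exists(2)[OF assms(1,2)] in \<open>simp_all\<close>)
  show ?thesis using fan_simplicial fan_maximal by blast
qed

end
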